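(* Let $\mathcal{M}=(M_k)_{k\ge0}$ be a regular sequence. Let $\Omega=\Omega'\times I\times\Omega''\subset\mathbb{R}^N\times\mathbb{R}\times\mathbb{C}^M$, where $\Omega'\subset\mathbb{R}^N$ is an open neighborhood of the origin, $I\subset\mathbb{R}$ is an open interval containing $0$, and $\Omega''\subset\mathbb{C}^M$ is an open set. Let $$L=\frac{\partial}{\partial t}+\sum_{i=1}^Na_i(x,t,\zeta)\frac{\partial}{\partial x_i}+\sum_{j=1}^Mb_j(x,t,\zeta)\frac{\partial}{\partial\zeta_j}$$ be a vector field on $\Omega$, where $a_i,b_j$ are of class $\mathcal{C}^{\mathcal{M}}$ with respect to $(x,t)$ and holomorphic in $\zeta$. Let $f\in\mathcal{C}^\infty(\Omega'\times\Omega'')$ be holomorphic in $\zeta$ and of class $\mathcal{C}^{\mathcal{M}}$ in $x$. Then for every open neighborhood of the origin $U\Subset\Omega'$ and every open neighborhood of the origin $V\Subset\Omega''$ there are a $\mathcal{C}^\infty$ function $u=u(x,t,\zeta)$ defined on $U\times\mathbb{R}\times V$ and holomorphic in $\zeta$, and constants $A,Q,\delta>0$ with $(-\delta,\delta)\subset I$, such that $$\begin{cases}|Lu(x,t,\zeta)|\le A\,h(Q|t|), & (x,t,\zeta)\in U\times(-\delta,\delta)\times V,\\ u(x,0,\zeta)=f(x,\zeta), & (x,\zeta)\in U\times V,\end{cases}$$ i.e. $u$ is an $(\mathcal{M},t)$-approximate solution of $L$ on $U\times\mathbb{R}\times V$ with initial datum $f$.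
   Context: Regular sequence: a sequence $\mathcal{M}=(M_k)_{k\ge0}$ of positive reals such that, with $m_k=M_k/k!$: (a) $m_0=m_1=1$; (b) $m_k^2\le m_{k-1}m_{k+1}$ for $k\ge1$; (c) $\sup_{k\ge 1}(m_{k+1}/m_k)^{1/k}<\infty$; (d) $\lim_{k\to\infty}m_k^{1/k}=\infty$. For $r>0$, $h(r)=\inf_{k\in\mathbb{Z}_+}m_kr^k$, and $h(0)=0$. For $W\subset\mathbb{R}^n$ and $W''\subset\mathbb{C}^M$ open, a function $g$ on $W\times W''$ is of class $\mathcal{C}^{\mathcal{M}}$ in $y\in W$ and holomorphic in $\zeta\in W''$ if it is $\mathcal{C}^\infty$, holomorphic in $\zeta$, and for each compact $K\subset W\times W''$ there is $A>0$ with $\sup_K|\partial_y^\alpha g|\le A^{|\alpha|+1}M_{|\alpha|}$ for all $\alpha\in\mathbb{Z}_+^n$. $(\mathcal{M},t)$-approximate solution of $L$ on $U\times\mathbb{R}\times V$ with initial datum $f$: a function $u\in\mathcal{C}^1(U\times\mathbb{R}\times V)$ such that $u(x,0,\zeta)=f(x,\zeta)$ on $U\times V$ and for every compact $K\subset U\times V$ there are $A,\gamma,\delta>0$ with $\sup_{(x,\zeta)\in K}|Lu(x,t,\zeta)|\le A\,h(\gamma|t|)$ for $0<|t|\le\delta$ (only small $|t|$, where $L$ is defined, are involved). *)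

theory Defs
  imports "HOL-Analysis.Analysis"
begin

definition quot_fact :: "(nat \<Rightarrow> real) \<Rightarrow> nat \<Rightarrow> real" where
  "quot_fact M k = M k / fact k"

definition regular_sequence :: "(nat \<Rightarrow> real) \<Rightarrow> bool" where
  "regular_sequence M \<longleftrightarrow>
     (let m = quot_fact M in
       (\<forall>k. M k > 0) \<and>
       m 0 = 1 \<and> m 1 = 1 \<and>
       (\<forall>k\<ge>1. (m k)\<^sup>2 \<le> m (k - 1) * m (k + 1)) \<and>
       bdd_above ((\<lambda>k. root k (m (k + 1) / m k)) ` {1..}) \<and>
       filterlim (\<lambda>k. root k (m k)) at_top sequentially)"

definition assoc_h :: "(nat \<Rightarrow> real) \<Rightarrow> real \<Rightarrow> real" where
  "assoc_h M r = (if r > 0 then (INF k. quot_fact M k * r ^ k) else 0)"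

definition dir_deriv ::
    "'a::real_normed_vector \<Rightarrow> ('a \<Rightarrow> 'b::real_normed_vector) \<Rightarrow> 'a \<Rightarrow> 'b" where
  "dir_deriv v f = (\<lambda>p. frechet_derivative f (at p) v)"

text \<open>
  In this theory the sets \<open>S\<close> are always open, so that values of \<open>f\<close> outside \<open>S\<close> are irrelevant.
\<close>
primrec Ck_on :: "nat \<Rightarrow> 'a::real_normed_vector set \<Rightarrow> ('a \<Rightarrow> 'b::real_normed_vector) \<Rightarrow> bool" where
  "Ck_on 0 S f \<longleftrightarrow> continuous_on S f"
| "Ck_on (Suc k) S f \<longleftrightarrow>
     (\<forall>p\<in>S. f differentiable (at p)) \<and> (\<forall>v. Ck_on k S (dir_deriv v f))"

definition Cinf_on :: "'a::real_normed_vector set \<Rightarrow> ('a \<Rightarrow> 'b::real_normed_vector) \<Rightarrow> bool" where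
  "Cinf_on S f \<longleftrightarrow> (\<forall>k. Ck_on k S f)"

text \<open>
  Multi-indices in the coordinates of a Euclidean space \<open>'a\<close> are functions
  \<open>\<alpha> :: 'a \<Rightarrow> nat\<close>, of which only the values on \<open>Basis\<close> matter. The partial derivatives are
  taken along a fixed enumeration of the coordinates; the order is immaterial for smooth functions.
\<close>
definition basis_enum :: "'a::euclidean_space list" where
  "basis_enum = (SOME es. distinct es \<and> set es = Basis)"

definition mi_size :: "('a::euclidean_space \<Rightarrow> nat) \<Rightarrow> nat" where
  "mi_size \<alpha> = (\<Sum>e\<in>Basis. \<alpha> e)"

text \<open>The derivative \<open>\<partial>\<^sub>y\<^sup>\<alpha> g\<close> of a function \<open>g (y, \<zeta>)\<close>.\<close>
definition mi_deriv_fst ::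
    "('a::euclidean_space \<Rightarrow> nat) \<Rightarrow> ('a \<times> 'c::real_normed_vector \<Rightarrow> 'b::real_normed_vector)
      \<Rightarrow> 'a \<times> 'c \<Rightarrow> 'b" where
  "mi_deriv_fst \<alpha> g = foldr (\<lambda>e. dir_deriv (e, 0) ^^ \<alpha> e) basis_enum g"

text \<open>Complex Frechet differentiability: the real derivative exists and is complex linear.\<close>
definition holo_on :: "(complex ^ 'm) set \<Rightarrow> (complex ^ 'm \<Rightarrow> complex) \<Rightarrow> bool" where
  "holo_on S F \<longleftrightarrow>
     (\<forall>\<zeta>\<in>S. \<exists>D. (F has_derivative D) (at \<zeta>) \<and> (\<forall>c v. D (c *s v) = c * D v))"

definition holo_snd_on ::
    "'a set \<Rightarrow> (complex ^ 'm) set \<Rightarrow> ('a \<times> (complex ^ 'm) \<Rightarrow> complex) \<Rightarrow> bool" where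
  "holo_snd_on W W2 g \<longleftrightarrow> (\<forall>y\<in>W. holo_on W2 (\<lambda>\<zeta>. g (y, \<zeta>)))"

definition CM_holo_on ::
    "(nat \<Rightarrow> real) \<Rightarrow> 'a::euclidean_space set \<Rightarrow> (complex ^ 'm) set
      \<Rightarrow> ('a \<times> (complex ^ 'm) \<Rightarrow> complex) \<Rightarrow> bool" where
  "CM_holo_on M W W2 g \<longleftrightarrow>
     Cinf_on (W \<times> W2) g \<and> holo_snd_on W W2 g \<and>
     (\<forall>K. compact K \<and> K \<subseteq> W \<times> W2 \<longrightarrow>
        (\<exists>A>0. \<forall>\<alpha>. \<forall>p\<in>K.
           norm (mi_deriv_fst \<alpha> g p) \<le> A ^ (mi_size \<alpha> + 1) * M (mi_size \<alpha>)))"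

text \<open>Points are written \<open>((x, t), \<zeta>)\<close> with \<open>x \<in> \<real>\<^sup>N\<close>, \<open>t \<in> \<real>\<close>, \<open>\<zeta> \<in> \<complex>\<^sup>M\<close>.\<close>
type_synonym ('n, 'm) pt = "((real ^ 'n) \<times> real) \<times> (complex ^ 'm)"

definition d_t :: "(('n::finite, 'm::finite) pt \<Rightarrow> complex) \<Rightarrow> ('n, 'm) pt \<Rightarrow> complex" where
  "d_t u = dir_deriv ((0, 1), 0) u"

definition d_x :: "'n \<Rightarrow> (('n::finite, 'm::finite) pt \<Rightarrow> complex) \<Rightarrow> ('n, 'm) pt \<Rightarrow> complex" where
  "d_x i u = dir_deriv ((axis i 1, 0), 0) u"

text \<open>The Wirtinger derivative, so that it also makes sense for \<open>u\<close> not holomorphic in \<open>\<zeta>\<close>.\<close>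
definition d_zeta :: "'m \<Rightarrow> (('n::finite, 'm::finite) pt \<Rightarrow> complex) \<Rightarrow> ('n, 'm) pt \<Rightarrow> complex" where
  "d_zeta j u p =
     (dir_deriv (0, axis j 1) u p - \<i> * dir_deriv (0, axis j \<i>) u p) / 2"

definition vfield ::
    "('n \<Rightarrow> ('n, 'm) pt \<Rightarrow> complex) \<Rightarrow> ('m \<Rightarrow> ('n, 'm) pt \<Rightarrow> complex)
      \<Rightarrow> (('n::finite, 'm::finite) pt \<Rightarrow> complex) \<Rightarrow> ('n, 'm) pt \<Rightarrow> complex" where
  "vfield a b u p =
     d_t u p + (\<Sum>i\<in>UNIV. a i p * d_x i u p) + (\<Sum>j\<in>UNIV. b j p * d_zeta j u p)"

text \<open>
  \<open>I\<close> is the \<open>t\<close>-interval on which the coefficients of the vector field are given. The choice of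
  \<open>\<delta>\<close> is restricted so that the field is evaluated only there.
\<close>
definition approx_solution ::
    "(nat \<Rightarrow> real) \<Rightarrow> real set
      \<Rightarrow> ('n \<Rightarrow> ('n, 'm) pt \<Rightarrow> complex) \<Rightarrow> ('m \<Rightarrow> ('n, 'm) pt \<Rightarrow> complex)
      \<Rightarrow> (real ^ 'n) set \<Rightarrow> (complex ^ 'm) set
      \<Rightarrow> ((real ^ 'n) \<times> (complex ^ 'm) \<Rightarrow> complex)
      \<Rightarrow> (('n::finite, 'm::finite) pt \<Rightarrow> complex) \<Rightarrow> bool" where
  "approx_solution M I a b U V f u \<longleftrightarrow>
     Ck_on 1 ((U \<times> UNIV) \<times> V) u \<and>
     (\<forall>x\<in>U. \<forall>\<zeta>\<in>V. u ((x, 0), \<zeta>) = f (x, \<zeta>)) \<and>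
     (\<forall>K. compact K \<and> K \<subseteq> U \<times> V \<longrightarrow>
        (\<exists>A>0. \<exists>\<gamma>>0. \<exists>\<delta>>0. {-\<delta>..\<delta>} \<subseteq> I \<and>
           (\<forall>t. 0 < \<bar>t\<bar> \<and> \<bar>t\<bar> \<le> \<delta> \<longrightarrow>
              (\<forall>(x, \<zeta>)\<in>K.
                 norm (vfield a b u ((x, t), \<zeta>)) \<le> A * assoc_h M (\<gamma> * \<bar>t\<bar>)))))"

end

theory Submission
  imports Defs "HOL-Complex_Analysis.Complex_Analysis" "HOL-Computational_Algebra.Polynomial"
begin

text \<open>
  The formal solution is the Lie series \<open>\<Sum>k. (-t)^k / k! * L^k f\<close>. Since \<open>L t = 1\<close>, the operator
  maps its \<open>k\<close>-th term to \<open>R k - R (k - 1)\<close> with \<open>R k = (-t)^k / k! * L^(k + 1) f\<close>, so partial sums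
  telescope exactly and the coefficients need not be expanded in \<open>t\<close>. By Cauchy's estimates in
  \<open>\<zeta>\<close>, all data are of class \<open>C\<^sup>M\<close> in all real variables jointly; the Leibniz rule and
  \<open>m j * m k \<le> m (j + k)\<close> then give \<open>\<bar>\<partial>^w L^k f\<bar> \<le> C^(k + \<bar>w\<bar> + 1) * M (k + \<bar>w\<bar>)\<close> for every word
  \<open>w\<close> of coordinate directions. The series is made convergent by smooth cutoffs in \<open>t\<close>, the
  \<open>k\<close>-th one living at a scale \<open>s k\<close> decreasing to \<open>0\<close>. The error is then a sum of terms of size
  \<open>C^k * m k * \<bar>t\<bar>^k\<close>, each confined to \<open>s (k + 1) / 2 \<le> \<bar>t\<bar> \<le> s k\<close>, and for a suitable choice of
  the scales such a term is at most \<open>2^(-k) * A * h (Q * \<bar>t\<bar>)\<close>.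
\<close>

section \<open>Smooth functions and words of directional derivatives\<close>

text \<open>Condition (c) bounds \<open>ratio k = m (k + 1) / m k\<close> only by
  \<open>B ^ k\<close>, so \<open>ratio\<close> may be constant on a long stretch and then jump by
  an exponential factor. With cutoffs at the scale \<open>1 / ratio k\<close>, the bound for
  derivatives of high order, which contains \<open>m (k + a) * t ^ k\<close>, can then grow
  exponentially in \<open>k\<close>, and the sum need not be smooth. Much smaller scales restore
  convergence but spoil the estimate: where the term of index \<open>k\<close> sits,
  \<open>m k * t ^ k\<close> has to be below \<open>m j * (Q * t) ^ j\<close>, up to a constant, for
  every \<open>j\<close>, since \<open>h\<close> is an infimum. The scale
  \<open>crit_radius k\<close> meets both demands. Below it some later monomial is smaller than
  \<open>m k * t ^ k\<close> by more than a factor \<open>2 ^ k\<close>, which either limits the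
  jump of \<open>ratio\<close> or makes \<open>t\<close> exponentially small. Above
  \<open>crit_radius (k + 1)\<close> all later monomials dominate up to a factor exponential in
  \<open>k\<close>, and such factors go into \<open>Q\<close>.\<close>

lemma dir_deriv_eqI: "(f has_derivative D) (at p) \<Longrightarrow> dir_deriv v f p = D v"
  unfolding dir_deriv_def using frechet_derivative_at by metis

lemma has_derivative_dir_deriv:
  "f differentiable (at p) \<Longrightarrow> (f has_derivative (\<lambda>v. dir_deriv v f p)) (at p)"
  unfolding dir_deriv_def using frechet_derivative_works by (metis eta_contract_eq)

lemma linear_dir_deriv: "f differentiable (at p) \<Longrightarrow> linear (\<lambda>v. dir_deriv v f p)"
  by (rule has_derivative_linear[OF has_derivative_dir_deriv])

text \<open>No differentiability is assumed: \<open>frechet_derivative\<close> is a choice from the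
  predicate \<open>has_derivative\<close>, and near \<open>p\<close> this predicate is the same for
  both functions.\<close>

lemma dir_deriv_cong:
  assumes "open S" "\<And>p. p \<in> S \<Longrightarrow> f p = g p" "p \<in> S"
  shows "dir_deriv v f p = dir_deriv v g p"
proof -
  have "(f has_derivative D) (at p) \<longleftrightarrow> (g has_derivative D) (at p)" for D
    using assms has_derivative_transform_within_open[of _ D p UNIV S] by metis
  then show ?thesis unfolding dir_deriv_def frechet_derivative_def by simp
qed

lemma differentiable_cong_open:
  assumes "open S" "\<And>p. p \<in> S \<Longrightarrow> f p = g p" "p \<in> S" "f differentiable (at p)"
  shows "g differentiable (at p)"
  using assms has_derivative_transform_within_open[of f _ p UNIV S g] unfolding differentiable_def by metis

text \<open>Derivatives are indexed by words of directions instead of multi-indices: the Leibniz rule then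
  yields one-variable binomial convolutions.\<close>

definition wderiv ::
    "'a::real_normed_vector list \<Rightarrow> ('a \<Rightarrow> 'b::real_normed_vector) \<Rightarrow> 'a \<Rightarrow> 'b" where
  "wderiv w f = foldr dir_deriv w f"

lemma wderiv_Nil [simp]: "wderiv [] f = f"
  and wderiv_Cons [simp]: "wderiv (v # w) f = dir_deriv v (wderiv w f)"
  and wderiv_append: "wderiv (w @ w') f = wderiv w (wderiv w' f)"
  by (simp_all add: wderiv_def)

lemma wderiv_cong:
  assumes "open S" "\<And>p. p \<in> S \<Longrightarrow> f p = g p" "p \<in> S"
  shows "wderiv w f p = wderiv w g p"
  using assms(3)
proof (induction w arbitrary: p)
  case (Cons v w)
  then show ?case using dir_deriv_cong[OF assms(1), of "wderiv w f" "wderiv w g" p v] by simp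
qed (use assms in simp)

lemma Ck_on_Suc_imp: "Ck_on (Suc k) S f \<Longrightarrow> Ck_on k S f"
proof (induction k arbitrary: f)
  case 0
  then show ?case by (auto intro!: continuous_at_imp_continuous_on differentiable_imp_continuous_within)
qed (simp del: Ck_on.simps(1))

lemma Cinf_on_differentiable: "Cinf_on S f \<Longrightarrow> p \<in> S \<Longrightarrow> f differentiable (at p)"
  unfolding Cinf_on_def by (metis Ck_on.simps(2))

lemma Cinf_on_dir_deriv: "Cinf_on S f \<Longrightarrow> Cinf_on S (dir_deriv v f)"
  unfolding Cinf_on_def by (metis Ck_on.simps(2))

lemma Cinf_on_wderiv: "Cinf_on S f \<Longrightarrow> Cinf_on S (wderiv w f)"
  by (induction w) (auto intro: Cinf_on_dir_deriv)

lemma Cinf_on_continuous_on: "Cinf_on S f \<Longrightarrow> continuous_on S f"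
  unfolding Cinf_on_def by (metis Ck_on.simps(1))

lemma Ck_on_cong:
  assumes S: "open S" and "\<And>p. p \<in> S \<Longrightarrow> f p = g p" "Ck_on k S f"
  shows "Ck_on k S g"
  using assms(2,3)
proof (induction k arbitrary: f g)
  case 0
  then show ?case by (simp cong: continuous_on_cong)
next
  case (Suc k)
  have "Ck_on k S (dir_deriv v g)" for v
    by (rule Suc.IH[of "dir_deriv v f"]) (use Suc.prems dir_deriv_cong[OF S, of f g] in auto)
  then show ?case
    using Suc.prems differentiable_cong_open[OF S, of f g] by simp
qed

lemma Cinf_on_cong:
  "open S \<Longrightarrow> (\<And>p. p \<in> S \<Longrightarrow> f p = g p) \<Longrightarrow> Cinf_on S f \<Longrightarrow> Cinf_on S g"
  unfolding Cinf_on_def using Ck_on_cong by blast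

lemma Cinf_on_subset: "Cinf_on S f \<Longrightarrow> T \<subseteq> S \<Longrightarrow> Cinf_on T f"
proof -
  assume *: "Cinf_on S f" "T \<subseteq> S"
  have "Ck_on k S g \<Longrightarrow> Ck_on k T g" for k g
    using *(2) by (induction k arbitrary: g) (auto intro: continuous_on_subset)
  then show ?thesis using * unfolding Cinf_on_def by blast
qed

text \<open>Smoothness is local. This later glues a term cut off in \<open>t\<close> to the zero
  function outside the support of the cutoff.\<close>

lemma Cinf_on_Un:
  assumes "open S" "open T" "Cinf_on S f" "Cinf_on T f"
  shows "Cinf_on (S \<union> T) f"
proof -
  have "Ck_on k S g \<Longrightarrow> Ck_on k T g \<Longrightarrow> Ck_on k (S \<union> T) g" for k g
    using assms by (induction k arbitrary: g) (auto intro: continuous_on_open_Un)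
  then show ?thesis using assms unfolding Cinf_on_def by blast
qed

lemma dir_deriv_const [simp]: "dir_deriv v (\<lambda>_. c) = (\<lambda>_. 0)"
  by (auto intro!: dir_deriv_eqI derivative_eq_intros)

lemma wderiv_const [simp]: "wderiv w (\<lambda>_. c) = (\<lambda>_. if w = [] then c else 0)"
  by (induction w) auto

lemma Ck_on_const: "Ck_on k S (\<lambda>_. c)"
  by (induction k arbitrary: c) auto

lemma Cinf_on_const [intro]: "Cinf_on S (\<lambda>_. c)"
  by (simp add: Cinf_on_def Ck_on_const)

lemma dir_deriv_add:
  assumes "f differentiable (at p)" "g differentiable (at p)"
  shows "dir_deriv v (\<lambda>q. f q + g q) p = dir_deriv v f p + dir_deriv v g p"
  by (rule dir_deriv_eqI) (intro has_derivative_add has_derivative_dir_deriv assms)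

lemma dir_deriv_sum:
  assumes "\<And>i. i \<in> I \<Longrightarrow> f i differentiable (at p)"
  shows "dir_deriv v (\<lambda>q. \<Sum>i\<in>I. f i q) p = (\<Sum>i\<in>I. dir_deriv v (f i) p)"
  by (rule dir_deriv_eqI) (intro has_derivative_sum has_derivative_dir_deriv assms)

lemma dir_deriv_mult:
  fixes f :: "'a::real_normed_vector \<Rightarrow> 'b::real_normed_algebra"
  assumes "f differentiable (at p)" "g differentiable (at p)"
  shows "dir_deriv v (\<lambda>q. f q * g q) p = dir_deriv v f p * g p + f p * dir_deriv v g p"
  by (rule dir_deriv_eqI)
    (auto intro!: derivative_eq_intros has_derivative_dir_deriv assms)

lemma Ck_on_add:
  assumes S: "open S" and "Ck_on k S f" "Ck_on k S g"
  shows "Ck_on k S (\<lambda>p. f p + g p)"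
  using assms(2,3)
proof (induction k arbitrary: f g)
  case 0
  then show ?case by (auto intro: continuous_intros)
next
  case (Suc k)
  have "Ck_on k S (dir_deriv v (\<lambda>p. f p + g p))" for v
    by (rule Ck_on_cong[OF S, of "\<lambda>p. dir_deriv v f p + dir_deriv v g p"])
      (use Suc dir_deriv_add[of f _ g v] in auto)
  then show ?case using Suc.prems by auto
qed

lemma Cinf_on_add:
  "open S \<Longrightarrow> Cinf_on S f \<Longrightarrow> Cinf_on S g \<Longrightarrow> Cinf_on S (\<lambda>p. f p + g p)"
  unfolding Cinf_on_def using Ck_on_add by blast

lemma Cinf_on_sum:
  assumes "open S" "\<And>i. i \<in> I \<Longrightarrow> Cinf_on S (f i)"
  shows "Cinf_on S (\<lambda>p. \<Sum>i\<in>I. f i p)"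
  using assms(2)
  by (induction I rule: infinite_finite_induct) (auto intro!: Cinf_on_add assms(1))

lemma Ck_on_mult:
  fixes f :: "'a::real_normed_vector \<Rightarrow> 'b::real_normed_algebra"
  assumes S: "open S" and "Ck_on k S f" "Ck_on k S g"
  shows "Ck_on k S (\<lambda>p. f p * g p)"
  using assms(2,3)
proof (induction k arbitrary: f g)
  case 0
  then show ?case by (simp add: continuous_on_mult)
next
  case (Suc k)
  have d: "f differentiable (at p)" "g differentiable (at p)" if "p \<in> S" for p
    using Suc.prems that by auto
  have "Ck_on k S (dir_deriv v (\<lambda>p. f p * g p))" for v
  proof (rule Ck_on_cong[OF S])
    show "Ck_on k S (\<lambda>p. dir_deriv v f p * g p + f p * dir_deriv v g p)"
      using Suc.prems Suc.prems[THEN Ck_on_Suc_imp] by (intro Ck_on_add S Suc.IH) auto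
  qed (simp add: dir_deriv_mult d)
  then show ?case using d by (simp add: differentiable_mult)
qed

lemma Cinf_on_mult:
  fixes f :: "'a::real_normed_vector \<Rightarrow> 'b::real_normed_algebra"
  assumes "open S" "Cinf_on S f" "Cinf_on S g"
  shows "Cinf_on S (\<lambda>p. f p * g p)"
  using assms Ck_on_mult[of S _ f g] unfolding Cinf_on_def by simp

lemma Ck_on_inverse:
  fixes f :: "'a::real_normed_vector \<Rightarrow> 'b::real_normed_field"
  assumes S: "open S" and nz: "\<And>p. p \<in> S \<Longrightarrow> f p \<noteq> 0" and "Ck_on k S f"
  shows "Ck_on k S (\<lambda>p. inverse (f p))"
  using assms(3)
proof (induction k)
  case 0
  then show ?case using nz by (auto intro: continuous_on_inverse)
next
  case (Suc k)
  have der: "((\<lambda>p. inverse (f p)) has_derivative (\<lambda>v. (- 1) * (dir_deriv v f p * (inverse (f p) * inverse (f p))))) (at p)"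
    if "p \<in> S" for p
    using Deriv.has_derivative_inverse[where f = f, OF nz[OF that] has_derivative_dir_deriv] Suc.prems that by (simp add: mult_ac)
  have "Ck_on k S (dir_deriv v (\<lambda>p. inverse (f p)))" for v
  proof (rule Ck_on_cong[OF S])
    show "Ck_on k S (\<lambda>p. (- 1) * (dir_deriv v f p * (inverse (f p) * inverse (f p))))"
      using Suc.prems Suc.IH[OF Ck_on_Suc_imp[OF Suc.prems]] by (intro Ck_on_mult S Ck_on_const) auto
  qed (simp add: dir_deriv_eqI[OF der])
  then show ?case using der by (auto simp: differentiable_def)
qed

lemma Cinf_on_inverse:
  fixes f :: "'a::real_normed_vector \<Rightarrow> 'b::real_normed_field"
  assumes "open S" "\<And>p. p \<in> S \<Longrightarrow> f p \<noteq> 0" "Cinf_on S f"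
  shows "Cinf_on S (\<lambda>p. inverse (f p))"
  using assms Ck_on_inverse[of S f] unfolding Cinf_on_def by simp

lemma dir_deriv_bounded_linear:
  "bounded_linear L \<Longrightarrow> f differentiable (at p) \<Longrightarrow> dir_deriv v (\<lambda>q. L (f q)) p = L (dir_deriv v f p)"
  by (rule dir_deriv_eqI[OF bounded_linear.has_derivative]) (auto intro: has_derivative_dir_deriv)

lemma Ck_on_bounded_linear:
  assumes L: "bounded_linear L" and S: "open S" and "Ck_on k S f"
  shows "Ck_on k S (\<lambda>p. L (f p))"
  using assms(3)
proof (induction k arbitrary: f)
  case 0
  then show ?case by (simp add: bounded_linear.continuous_on[OF L])
next
  case (Suc k)
  have "Ck_on k S (dir_deriv v (\<lambda>p. L (f p)))" for v
    by (rule Ck_on_cong[OF S, of "\<lambda>p. L (dir_deriv v f p)"])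
      (use Suc in \<open>auto simp: dir_deriv_bounded_linear[OF L]\<close>)
  then show ?case
    using Suc.prems bounded_linear.has_derivative[OF L] unfolding differentiable_def Ck_on.simps by blast
qed

lemma Cinf_on_bounded_linear:
  "bounded_linear L \<Longrightarrow> open S \<Longrightarrow> Cinf_on S f \<Longrightarrow> Cinf_on S (\<lambda>p. L (f p))"
  unfolding Cinf_on_def by (simp add: Ck_on_bounded_linear)

lemmas dir_deriv_scaleR = dir_deriv_bounded_linear[OF bounded_linear_scaleR_right]
  and Ck_on_scaleR = Ck_on_bounded_linear[OF bounded_linear_scaleR_right]

lemma Ck_on_sum:
  assumes "open S" "\<And>i. i \<in> I \<Longrightarrow> Ck_on k S (f i)"
  shows "Ck_on k S (\<lambda>p. \<Sum>i\<in>I. f i p)"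
  using assms(2)
  by (induction I rule: infinite_finite_induct) (auto intro!: Ck_on_add Ck_on_const assms(1))

lemma dir_deriv_basis_expansion:
  fixes f :: "'a::euclidean_space \<Rightarrow> 'b::real_normed_vector"
  assumes "f differentiable (at p)"
  shows "dir_deriv v f p = (\<Sum>b\<in>Basis. (v \<bullet> b) *\<^sub>R dir_deriv b f p)"
proof -
  interpret linear "\<lambda>v. dir_deriv v f p" by (rule linear_dir_deriv[OF assms])
  have "dir_deriv v f p = dir_deriv (\<Sum>b\<in>Basis. (v \<bullet> b) *\<^sub>R b) f p"
    by (simp add: euclidean_representation)
  then show ?thesis by (simp add: sum scale)
qed

text \<open>\<open>Ck_on\<close> quantifies over all directions, whereas the bounds for a series are
  available along basis directions only. Linearity in the direction closes the gap.\<close>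

lemma Cinf_on_basisI:
  fixes f :: "'a::euclidean_space \<Rightarrow> 'b::real_normed_vector"
  assumes S: "open S"
    and d: "\<And>w p. set w \<subseteq> Basis \<Longrightarrow> p \<in> S \<Longrightarrow> wderiv w f differentiable (at p)"
  shows "Cinf_on S f"
proof -
  have "Ck_on k S (wderiv w f)" if "set w \<subseteq> Basis" for k w
    using that
  proof (induction k arbitrary: w)
    case 0
    then show ?case using d
      by (auto intro!: continuous_at_imp_continuous_on differentiable_imp_continuous_within)
  next
    case (Suc k)
    have "Ck_on k S (dir_deriv v (wderiv w f))" for v
    proof (rule Ck_on_cong[OF S])
      show "Ck_on k S (\<lambda>p. \<Sum>b\<in>Basis. (v \<bullet> b) *\<^sub>R wderiv (b # w) f p)"
        using Suc by (intro Ck_on_sum Ck_on_scaleR S Suc.IH) auto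
    qed (use Suc.prems d in \<open>auto intro!: dir_deriv_basis_expansion[symmetric]\<close>)
    then show ?case using Suc.prems d by auto
  qed
  from this[of "[]"] show ?thesis unfolding Cinf_on_def by simp
qed

section \<open>Composition with linear maps and scaling\<close>

lemma dir_deriv_comp_linear:
  assumes "bounded_linear A" "f differentiable (at (A p))"
  shows "dir_deriv v (\<lambda>q. f (A q)) p = dir_deriv (A v) f (A p)"
    and "(\<lambda>q. f (A q)) differentiable (at p)"
proof -
  have "((\<lambda>q. f (A q)) has_derivative (\<lambda>v. dir_deriv (A v) f (A p))) (at p)"
    using has_derivative_compose[OF bounded_linear_imp_has_derivative[OF assms(1)]
        has_derivative_dir_deriv[OF assms(2)]] .
  then show "dir_deriv v (\<lambda>q. f (A q)) p = dir_deriv (A v) f (A p)"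
    and "(\<lambda>q. f (A q)) differentiable (at p)"
    by (auto intro: dir_deriv_eqI simp: differentiable_def)
qed

lemma open_vimage_bounded_linear: "bounded_linear A \<Longrightarrow> open S \<Longrightarrow> open (A -` S)"
  by (simp add: linear_continuous_on continuous_open_vimage linear_continuous_at)

lemma Cinf_on_comp_linear:
  assumes A: "bounded_linear A" and S: "open S" and f: "Cinf_on S f"
  shows "Cinf_on (A -` S) (\<lambda>q. f (A q))"
proof -
  have "Ck_on k (A -` S) (\<lambda>q. g (A q))" if "Cinf_on S g" for k g
    using that
  proof (induction k arbitrary: g)
    case 0
    show ?case
      using Cinf_on_differentiable[OF 0] dir_deriv_comp_linear(2)[OF A]
      by (auto intro!: continuous_at_imp_continuous_on differentiable_imp_continuous_within)
  next
    case (Suc k)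
    have "Ck_on k (A -` S) (dir_deriv v (\<lambda>q. g (A q)))" for v
    proof (rule Ck_on_cong[OF open_vimage_bounded_linear[OF A S]])
      show "Ck_on k (A -` S) (\<lambda>q. dir_deriv (A v) g (A q))"
        by (rule Suc.IH) (rule Cinf_on_dir_deriv[OF Suc.prems])
    qed (use Cinf_on_differentiable[OF Suc.prems] in \<open>auto intro!: dir_deriv_comp_linear(1)[OF A, symmetric]\<close>)
    then show ?case
      using Cinf_on_differentiable[OF Suc.prems] dir_deriv_comp_linear(2)[OF A] by auto
  qed
  then show ?thesis using f unfolding Cinf_on_def[of "A -` S"] by blast
qed

lemma wderiv_comp_linear:
  assumes A: "bounded_linear A" and S: "open S" and f: "Cinf_on S f" and "A p \<in> S"
  shows "wderiv w (\<lambda>q. f (A q)) p = wderiv (map A w) f (A p)"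
  using assms(4)
proof (induction w arbitrary: p)
  case (Cons v w)
  have "wderiv (v # w) (\<lambda>q. f (A q)) p = dir_deriv v (\<lambda>q. wderiv (map A w) f (A q)) p"
    unfolding wderiv_Cons
    by (rule dir_deriv_cong[OF open_vimage_bounded_linear[OF A S]]) (use Cons in auto)
  also have "\<dots> = wderiv (map A (v # w)) f (A p)"
    using dir_deriv_comp_linear(1)[OF A Cinf_on_differentiable[OF Cinf_on_wderiv[OF f] Cons.prems]]
    by simp
  finally show ?case .
qed simp

lemma wderiv_scaleR:
  assumes "open S" "Cinf_on S f" "p \<in> S"
  shows "wderiv w (\<lambda>q. r *\<^sub>R f q) p = r *\<^sub>R wderiv w f p"
  using assms(3)
proof (induction w arbitrary: p)
  case (Cons v w)
  have "wderiv (v # w) (\<lambda>q. r *\<^sub>R f q) p = dir_deriv v (\<lambda>q. r *\<^sub>R wderiv w f q) p"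
    unfolding wderiv_Cons by (rule dir_deriv_cong[OF assms(1)]) (use Cons in auto)
  then show ?case
    using dir_deriv_scaleR[OF Cinf_on_differentiable[OF Cinf_on_wderiv[OF assms(2)] Cons.prems]] by simp
qed simp

lemma wderiv_scale_directions:
  assumes S: "open S" and f: "Cinf_on S f" and "p \<in> S"
  shows "wderiv (map ((*\<^sub>R) c) w) f p = c ^ length w *\<^sub>R wderiv w f p"
  using assms(3)
proof (induction w arbitrary: p)
  case (Cons v w)
  have d: "wderiv w f differentiable (at p)"
    using Cinf_on_differentiable[OF Cinf_on_wderiv[OF f]] Cons.prems by blast
  have "wderiv (map ((*\<^sub>R) c) (v # w)) f p = dir_deriv (c *\<^sub>R v) (\<lambda>q. c ^ length w *\<^sub>R wderiv w f q) p"
    unfolding wderiv_Cons list.map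
    by (rule dir_deriv_cong[OF S]) (use Cons in auto)
  also have "\<dots> = c ^ length w *\<^sub>R (c *\<^sub>R dir_deriv v (wderiv w f) p)"
    using dir_deriv_scaleR[OF d] linear_scale[OF linear_dir_deriv[OF d]] by simp
  finally show ?case by (simp add: mult.commute)
qed simp

text \<open>A linear map such as the projection that drops \<open>t\<close> kills some basis
  vectors, so the image of a word under it may contain \<open>0\<close>.\<close>

lemma wderiv_zero_direction:
  assumes S: "open S" and f: "Cinf_on S f" and "0 \<in> set w" "p \<in> S"
  shows "wderiv w f p = 0"
  using assms(3,4)
proof (induction w arbitrary: p)
  case (Cons v w)
  have d: "wderiv w f differentiable (at p)"
    using Cinf_on_differentiable[OF Cinf_on_wderiv[OF f]] Cons.prems by blast
  show ?case
  proof (cases "v = 0")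
    case True
    then show ?thesis using linear_0[OF linear_dir_deriv[OF d]] by simp
  next
    case False
    then have "wderiv w f q = 0" if "q \<in> S" for q using Cons that by auto
    then have "dir_deriv v (wderiv w f) p = dir_deriv v (\<lambda>_. 0) p"
      using Cons.prems by (intro dir_deriv_cong[OF S]) auto
    then show ?thesis by simp
  qed
qed simp

section \<open>Symmetry of mixed derivatives\<close>

lemma second_difference:
  fixes f fv fvw :: "'a::real_normed_vector \<Rightarrow> real"
  assumes h: "h > 0" and S: "\<And>s t. 0 \<le> s \<Longrightarrow> s \<le> h \<Longrightarrow> 0 \<le> t \<Longrightarrow> t \<le> h \<Longrightarrow> p + s *\<^sub>R v + t *\<^sub>R w \<in> S"
    and fv: "\<And>q. q \<in> S \<Longrightarrow> ((\<lambda>s. f (q + s *\<^sub>R v)) has_real_derivative fv q) (at 0)"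
    and fvw: "\<And>q. q \<in> S \<Longrightarrow> ((\<lambda>s. fv (q + s *\<^sub>R w)) has_real_derivative fvw q) (at 0)"
  shows "\<exists>s t. 0 < s \<and> s < h \<and> 0 < t \<and> t < h \<and>
    f (p + h *\<^sub>R v + h *\<^sub>R w) - f (p + h *\<^sub>R v) - f (p + h *\<^sub>R w) + f p
      = h\<^sup>2 * fvw (p + s *\<^sub>R v + t *\<^sub>R w)"
proof -
  \<comment> \<open>The derivatives along lines are given at parameter \<open>0\<close> for each
    base point; moving the base point gives them at every parameter.\<close>
  have shift: "((\<lambda>s. g (q + s *\<^sub>R u)) has_real_derivative d) (at s0)"
    if "((\<lambda>s. g ((q + s0 *\<^sub>R u) + s *\<^sub>R u)) has_real_derivative d) (at 0)" for g and q u :: 'a and d s0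
    using that DERIV_shift[of "\<lambda>s. g (q + s *\<^sub>R u)" d 0 s0]
    by (simp add: scaleR_left_distrib add_ac)
  \<comment> \<open>The second difference is the increment of \<open>\<phi>\<close>. The mean value
    theorem along \<open>v\<close> turns it into an increment of \<open>fv\<close>, and a second
    application along \<open>w\<close> into a value of \<open>fvw\<close>.\<close>
  define \<phi> where "\<phi> s = f (p + h *\<^sub>R w + s *\<^sub>R v) - f (p + s *\<^sub>R v)" for s
  have "(\<phi> has_real_derivative fv (p + h *\<^sub>R w + s *\<^sub>R v) - fv (p + s *\<^sub>R v)) (at s)"
    if "0 \<le> s" "s \<le> h" for s
  proof -
    have "p + s *\<^sub>R v + h *\<^sub>R w \<in> S" "p + s *\<^sub>R v + 0 *\<^sub>R w \<in> S"
      by (rule S; use that h in simp)+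
    then have "p + h *\<^sub>R w + s *\<^sub>R v \<in> S" "p + s *\<^sub>R v \<in> S"
      by (simp_all add: add.assoc add.commute[of "h *\<^sub>R w"])
    then show ?thesis unfolding \<phi>_def by (intro DERIV_diff; intro shift[OF fv])
  qed
  then obtain s where s: "0 < s" "s < h"
      "\<phi> h - \<phi> 0 = (h - 0) * (fv (p + h *\<^sub>R w + s *\<^sub>R v) - fv (p + s *\<^sub>R v))"
    using MVT2[OF h, of \<phi> "\<lambda>s. fv (p + h *\<^sub>R w + s *\<^sub>R v) - fv (p + s *\<^sub>R v)"] by blast
  have "((\<lambda>t. fv (p + s *\<^sub>R v + t *\<^sub>R w)) has_real_derivative fvw (p + s *\<^sub>R v + t *\<^sub>R w)) (at t)"
    if "0 \<le> t" "t \<le> h" for t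
    using that s S[of s t] by (intro shift[OF fvw]) auto
  then obtain t where t: "0 < t" "t < h"
      "fv (p + s *\<^sub>R v + h *\<^sub>R w) - fv (p + s *\<^sub>R v + 0 *\<^sub>R w) = (h - 0) * fvw (p + s *\<^sub>R v + t *\<^sub>R w)"
    using MVT2[OF h, of "\<lambda>t. fv (p + s *\<^sub>R v + t *\<^sub>R w)" "\<lambda>t. fvw (p + s *\<^sub>R v + t *\<^sub>R w)"] by blast
  have "\<phi> h - \<phi> 0 = h * (h * fvw (p + s *\<^sub>R v + t *\<^sub>R w))"
    using s(3) t(3) by (simp add: algebra_simps)
  then show ?thesis
    using s t by (intro exI[of _ s] exI[of _ t]) (simp add: \<phi>_def power2_eq_square algebra_simps)
qed

text \<open>One and the same second difference equals \<open>h\<^sup>2\<close> times a value of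
  \<open>fvw\<close> and \<open>h\<^sup>2\<close> times a value of \<open>fwv\<close>, at two points
  close to \<open>p\<close>. Continuity then excludes a gap at \<open>p\<close>.\<close>

lemma mixed_derivatives_eq_real:
  fixes f fv fw fvw fwv :: "'a::real_normed_vector \<Rightarrow> real"
  assumes S: "open S" "p \<in> S"
    and fv: "\<And>q. q \<in> S \<Longrightarrow> ((\<lambda>s. f (q + s *\<^sub>R v)) has_real_derivative fv q) (at 0)"
    and fvw: "\<And>q. q \<in> S \<Longrightarrow> ((\<lambda>s. fv (q + s *\<^sub>R w)) has_real_derivative fvw q) (at 0)"
    and fw: "\<And>q. q \<in> S \<Longrightarrow> ((\<lambda>s. f (q + s *\<^sub>R w)) has_real_derivative fw q) (at 0)"
    and fwv: "\<And>q. q \<in> S \<Longrightarrow> ((\<lambda>s. fw (q + s *\<^sub>R v)) has_real_derivative fwv q) (at 0)"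
    and cont: "continuous_on S fvw" "continuous_on S fwv"
  shows "fvw p = fwv p"
proof (rule ccontr)
  assume ne: "fvw p \<noteq> fwv p"
  define e where "e = \<bar>fvw p - fwv p\<bar> / 2"
  have e: "e > 0" using ne by (simp add: e_def)
  have "\<forall>\<^sub>F q in nhds p. q \<in> S \<and> dist (fvw q) (fvw p) < e \<and> dist (fwv q) (fwv p) < e"
  proof (intro eventually_conj)
    show "\<forall>\<^sub>F q in nhds p. q \<in> S" using S by (simp add: eventually_nhds_in_open)
    have "isCont fvw p" "isCont fwv p" using cont S continuous_on_eq_continuous_at by blast+
    then show "\<forall>\<^sub>F q in nhds p. dist (fvw q) (fvw p) < e" "\<forall>\<^sub>F q in nhds p. dist (fwv q) (fwv p) < e"
      using e tendstoD unfolding continuous_at tendsto_at_iff_tendsto_nhds by blast+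
  qed
  then obtain d where d: "d > 0"
    "\<And>q. dist q p < d \<Longrightarrow> q \<in> S \<and> dist (fvw q) (fvw p) < e \<and> dist (fwv q) (fwv p) < e"
    unfolding eventually_nhds_metric by blast
  \<comment> \<open>The parallelogram with sides \<open>h *\<^sub>R v\<close> and
    \<open>h *\<^sub>R w\<close> stays within distance \<open>d\<close> of \<open>p\<close>; the
    summand 1 covers the case that both directions vanish.\<close>
  define h where "h = d / (2 * (norm v + norm w + 1))"
  have h: "h > 0" unfolding h_def using d(1) by (intro divide_pos_pos) (auto intro: add_nonneg_pos)
  have near: "dist (p + s *\<^sub>R v + t *\<^sub>R w) p < d" if "0 \<le> s" "s \<le> h" "0 \<le> t" "t \<le> h" for s t
  proof -
    have "dist (p + s *\<^sub>R v + t *\<^sub>R w) p = norm (s *\<^sub>R v + t *\<^sub>R w)"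
      by (simp add: dist_norm algebra_simps)
    also have "\<dots> \<le> norm (s *\<^sub>R v) + norm (t *\<^sub>R w)" by (rule norm_triangle_ineq)
    also have "\<dots> \<le> h * norm v + h * norm w"
      using that by (auto intro!: add_mono mult_right_mono)
    also have "\<dots> < h * (2 * (norm v + norm w + 1))"
    proof -
      have "norm v + norm w < 2 * (norm v + norm w + 1)"
        using norm_ge_zero[of v] norm_ge_zero[of w] by argo
      from mult_strict_left_mono[OF this h] show ?thesis by (simp add: distrib_left)
    qed
    also have "\<dots> = d"
    proof -
      have "norm v + norm w + 1 > 0" by (auto intro: add_nonneg_pos)
      then show ?thesis unfolding h_def by (simp add: field_simps)
    qed
    finally show ?thesis .
  qed
  have near': "dist (p + s *\<^sub>R w + t *\<^sub>R v) p < d" if "0 \<le> s" "s \<le> h" "0 \<le> t" "t \<le> h" for s t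
    using near[OF that(3,4,1,2)] by (simp add: add_ac)
  obtain s t where st: "0 < s" "s < h" "0 < t" "t < h"
    "f (p + h *\<^sub>R v + h *\<^sub>R w) - f (p + h *\<^sub>R v) - f (p + h *\<^sub>R w) + f p = h\<^sup>2 * fvw (p + s *\<^sub>R v + t *\<^sub>R w)"
    using second_difference[OF h, of p v w S f fv fvw] near d fv fvw by blast
  obtain s' t' where st': "0 < s'" "s' < h" "0 < t'" "t' < h"
    "f (p + h *\<^sub>R w + h *\<^sub>R v) - f (p + h *\<^sub>R w) - f (p + h *\<^sub>R v) + f p = h\<^sup>2 * fwv (p + s' *\<^sub>R w + t' *\<^sub>R v)"
    using second_difference[OF h, of p w v S f fw fwv] near' d fw fwv by blast
  have "h\<^sup>2 * fvw (p + s *\<^sub>R v + t *\<^sub>R w) = h\<^sup>2 * fwv (p + t' *\<^sub>R v + s' *\<^sub>R w)"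
    using st(5) st'(5) by (simp add: algebra_simps)
  then have eq: "fvw (p + s *\<^sub>R v + t *\<^sub>R w) = fwv (p + t' *\<^sub>R v + s' *\<^sub>R w)" using h by simp
  have "dist (fvw (p + s *\<^sub>R v + t *\<^sub>R w)) (fvw p) < e" using d(2)[OF near] st by simp
  moreover have "dist (fwv (p + t' *\<^sub>R v + s' *\<^sub>R w)) (fwv p) < e" using d(2)[OF near] st' by simp
  ultimately show False using eq unfolding e_def dist_real_def by (simp add: abs_if split: if_splits)
qed

text \<open>The mean value theorem concerns real functions, so the values are paired with an
  arbitrary vector \<open>b\<close>; hence the class \<open>real_inner\<close>.\<close>

lemma dir_deriv_commute:
  fixes f :: "'a::real_normed_vector \<Rightarrow> 'b::real_inner"
  assumes S: "open S" and f: "Cinf_on S f" and p: "p \<in> S"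
  shows "dir_deriv v (dir_deriv w f) p = dir_deriv w (dir_deriv v f) p"
proof -
  have line: "((\<lambda>s. g (q + s *\<^sub>R u) \<bullet> b) has_real_derivative (dir_deriv u g q \<bullet> b)) (at 0)"
    if "Cinf_on S g" "q \<in> S" for g :: "'a \<Rightarrow> 'b" and q u b
  proof -
    have *: "((\<lambda>s::real. q + s *\<^sub>R u) has_derivative (\<lambda>s. s *\<^sub>R u)) (at 0)"
      by (auto intro!: derivative_eq_intros)
    have "(g has_derivative (\<lambda>v. dir_deriv v g q)) (at (q + 0 *\<^sub>R u))"
      using has_derivative_dir_deriv[OF Cinf_on_differentiable[OF that]] by simp
    from has_derivative_compose[OF * this]
    have "((\<lambda>s. g (q + s *\<^sub>R u)) has_derivative (\<lambda>s. dir_deriv (s *\<^sub>R u) g q)) (at 0)" .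
    then have "((\<lambda>s. g (q + s *\<^sub>R u) \<bullet> b) has_derivative (\<lambda>s. dir_deriv (s *\<^sub>R u) g q \<bullet> b)) (at 0)"
      by (intro has_derivative_inner_left)
    then show ?thesis
      using linear_scale[OF linear_dir_deriv[OF Cinf_on_differentiable[OF that]]]
      by (simp add: has_field_derivative_def mult.commute[of _ "dir_deriv u g q \<bullet> b"])
  qed
  have "dir_deriv v (dir_deriv w f) p \<bullet> b = dir_deriv w (dir_deriv v f) p \<bullet> b" for b
  proof (rule mixed_derivatives_eq_real[OF S p, of "\<lambda>q. f q \<bullet> b" w "\<lambda>q. dir_deriv w f q \<bullet> b" v
        "\<lambda>q. dir_deriv v (dir_deriv w f) q \<bullet> b" "\<lambda>q. dir_deriv v f q \<bullet> b"])
    show "continuous_on S (\<lambda>q. dir_deriv v (dir_deriv w f) q \<bullet> b)"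
      and "continuous_on S (\<lambda>q. dir_deriv w (dir_deriv v f) q \<bullet> b)"
      by (intro continuous_intros Cinf_on_continuous_on Cinf_on_dir_deriv f)+
  qed (intro line f Cinf_on_dir_deriv; assumption)+
  then show ?thesis using vector_eq_rdot by blast
qed

text \<open>This permits sorting a word, to separate the directions in \<open>\<zeta>\<close> from
  the others or to match the fixed enumeration behind \<open>mi_deriv_fst\<close>.\<close>

lemma wderiv_permute:
  fixes f :: "'a::real_normed_vector \<Rightarrow> 'b::real_inner"
  assumes S: "open S" and f: "Cinf_on S f" and "mset w = mset w'" "p \<in> S"
  shows "wderiv w f p = wderiv w' f p"
  using assms(3,4)
proof (induction w arbitrary: w' p)
  case (Cons v w)
  have front: "wderiv (xs @ v # ys) f q = wderiv (v # xs @ ys) f q" if "q \<in> S" for xs ys q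
    using that
  proof (induction xs arbitrary: q)
    case (Cons x xs)
    have "wderiv ((x # xs) @ v # ys) f q = dir_deriv x (dir_deriv v (wderiv (xs @ ys) f)) q"
      unfolding append_Cons wderiv_Cons
      by (rule dir_deriv_cong[OF S]) (use Cons in auto)
    also have "\<dots> = dir_deriv v (dir_deriv x (wderiv (xs @ ys) f)) q"
      by (rule dir_deriv_commute[OF S Cinf_on_wderiv[OF f] Cons.prems])
    finally show ?case by simp
  qed simp
  obtain xs ys where w': "w' = xs @ v # ys"
    using Cons.prems(1) by (metis list.set_intros(1) mset_eq_setD split_list)
  have "mset w = mset (xs @ ys)" using Cons.prems(1) w' by simp
  then have "wderiv (v # w) f p = wderiv (v # xs @ ys) f p"
    using Cons.IH[of "xs @ ys"] dir_deriv_cong[OF S, of "wderiv w f" "wderiv (xs @ ys) f"] Cons.prems(2) by simp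
  then show ?case using front Cons.prems w' by simp
qed simp

section \<open>Bounds on all derivatives of a given order\<close>

definition wbound ::
    "'a::euclidean_space set \<Rightarrow> ('a \<Rightarrow> 'b::real_normed_vector) \<Rightarrow> nat \<Rightarrow> real \<Rightarrow> bool" where
  "wbound S f k X \<longleftrightarrow>
     (\<forall>w. set w \<subseteq> Basis \<and> length w = k \<longrightarrow> (\<forall>p\<in>S. norm (wderiv w f p) \<le> X))"

lemma wboundD: "wbound S f k X \<Longrightarrow> set w \<subseteq> Basis \<Longrightarrow> length w = k \<Longrightarrow> p \<in> S \<Longrightarrow> norm (wderiv w f p) \<le> X"
  unfolding wbound_def by blast

lemma wbound_mono: "wbound S f k X \<Longrightarrow> X \<le> Y \<Longrightarrow> wbound S f k Y"
  unfolding wbound_def using order_trans by blast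

lemma wbound_subset: "wbound S f k X \<Longrightarrow> T \<subseteq> S \<Longrightarrow> wbound T f k X"
  unfolding wbound_def by blast

lemma wbound_Un: "wbound S f k X \<Longrightarrow> wbound T f k X \<Longrightarrow> wbound (S \<union> T) f k X"
  unfolding wbound_def by blast

lemma wderiv_vanish:
  assumes "open S" "\<And>p. p \<in> S \<Longrightarrow> f p = 0" "p \<in> S"
  shows "wderiv w f p = 0"
  using wderiv_cong[OF assms(1), of f "\<lambda>_. 0" p w] assms(2,3) by (simp add: wderiv_const)

lemma wbound_vanish: "open S \<Longrightarrow> (\<And>p. p \<in> S \<Longrightarrow> f p = 0) \<Longrightarrow> 0 \<le> X \<Longrightarrow> wbound S f k X"
  unfolding wbound_def using wderiv_vanish[of S f] by simp

lemma wbound_cong: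
  fixes f g :: "'a::euclidean_space \<Rightarrow> 'b::real_normed_vector"
  assumes "open S" "\<And>p. p \<in> S \<Longrightarrow> f p = g p" "wbound S f k X"
  shows "wbound S g k X"
  unfolding wbound_def
proof (intro ballI allI impI)
  fix w :: "'a list" and p assume "set w \<subseteq> Basis \<and> length w = k" "p \<in> S"
  then show "norm (wderiv w g p) \<le> X"
    using wboundD[OF assms(3), of w p] wderiv_cong[OF assms(1), of f g p w] assms(2) by simp
qed

text \<open>The last letter of a word acts first. Splitting it off replaces \<open>f\<close> by a
  first derivative, so that sum and product rules can be proved by induction on the order with the
  function varying.\<close>

lemma wbound_Suc_iff:
  fixes f :: "'a::euclidean_space \<Rightarrow> 'b::real_normed_vector"
  shows "wbound S f (Suc k) X \<longleftrightarrow> (\<forall>b\<in>Basis. wbound S (dir_deriv b f) k X)"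
proof
  show "wbound S f (Suc k) X \<Longrightarrow> \<forall>b\<in>Basis. wbound S (dir_deriv b f) k X"
  proof (unfold wbound_def, intro ballI allI impI)
    fix b :: 'a and w :: "'a list" and p
    assume *: "\<forall>w. set w \<subseteq> Basis \<and> length w = Suc k \<longrightarrow> (\<forall>p\<in>S. norm (wderiv w f p) \<le> X)"
      "b \<in> Basis" "set w \<subseteq> Basis \<and> length w = k" "p \<in> S"
    show "norm (wderiv w (dir_deriv b f) p) \<le> X"
      using *(1)[rule_format, of "w @ [b]" p] *(2-) by (simp add: wderiv_append)
  qed
next
  assume *: "\<forall>b\<in>Basis. wbound S (dir_deriv b f) k X"
  show "wbound S f (Suc k) X"
    unfolding wbound_def
  proof (intro ballI allI impI)
    fix w :: "'a list" and p assume w: "set w \<subseteq> Basis \<and> length w = Suc k" and p: "p \<in> S"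
    then have "w \<noteq> []" by auto
    then obtain w' b where wb: "w = w' @ [b]" by (metis rev_exhaust)
    then show "norm (wderiv w f p) \<le> X"
      using * w p unfolding wbound_def by (simp add: wderiv_append)
  qed
qed

lemma wbound_add:
  fixes f g :: "'a::euclidean_space \<Rightarrow> 'b::real_normed_vector"
  assumes S: "open S" and f: "Cinf_on S f" and g: "Cinf_on S g" and "wbound S f k X" "wbound S g k Y"
  shows "wbound S (\<lambda>p. f p + g p) k (X + Y)"
  using assms(2-)
proof (induction k arbitrary: f g)
  case 0
  then show ?case unfolding wbound_def by (auto intro!: norm_triangle_mono)
next
  case (Suc k)
  show ?case unfolding wbound_Suc_iff
  proof
    fix b :: 'a assume "b \<in> Basis"
    then show "wbound S (dir_deriv b (\<lambda>p. f p + g p)) k (X + Y)"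
      using Suc unfolding wbound_Suc_iff
      by (intro wbound_cong[OF S _ Suc.IH[of "dir_deriv b f" "dir_deriv b g"]])
        (auto intro: Cinf_on_dir_deriv intro!: dir_deriv_add[symmetric] dest: Cinf_on_differentiable)
  qed
qed

lemma wbound_sum:
  assumes S: "open S" and "finite I" "\<And>i. i \<in> I \<Longrightarrow> Cinf_on S (f i)"
    "\<And>i. i \<in> I \<Longrightarrow> wbound S (f i) k (X i)"
  shows "wbound S (\<lambda>p. \<Sum>i\<in>I. f i p) k (\<Sum>i\<in>I. X i)"
  using assms(2-)
proof (induction I rule: finite_induct)
  case empty
  then show ?case by (simp add: wbound_def)
next
  case (insert i I)
  then show ?case by (auto intro!: wbound_add S Cinf_on_sum)
qed

text \<open>Pascal's rule for a binomial convolution, in the form in which differentiating a product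
  once more produces it.\<close>

lemma sum_binomial_Suc:
  fixes F G :: "nat \<Rightarrow> real"
  shows "(\<Sum>j\<le>k. real (k choose j) * F (Suc j) * G (k - j)) + (\<Sum>j\<le>k. real (k choose j) * F j * G (Suc (k - j)))
    = (\<Sum>j\<le>Suc k. real (Suc k choose j) * F j * G (Suc k - j))"
proof -
  have "(\<Sum>j\<le>k. real (k choose j) * F j * G (Suc (k - j))) = (\<Sum>j\<le>Suc k. real (k choose j) * F j * G (Suc k - j))"
    by (simp add: Suc_diff_le)
  also have "\<dots> = F 0 * G (Suc k) + (\<Sum>j\<le>k. real (k choose Suc j) * F (Suc j) * G (k - j))"
    by (subst sum.atMost_Suc_shift) simp
  finally show ?thesis
    by (subst sum.atMost_Suc_shift[of _ k]) (simp add: sum.distrib[symmetric] algebra_simps)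
qed

lemma wbound_mult:
  fixes f g :: "'a::euclidean_space \<Rightarrow> 'b::real_normed_algebra"
  assumes S: "open S" and "Cinf_on S f" "Cinf_on S g"
    "\<And>j. wbound S f j (F j)" "\<And>j. wbound S g j (G j)"
  shows "wbound S (\<lambda>p. f p * g p) k (\<Sum>j\<le>k. real (k choose j) * F j * G (k - j))"
  using assms(2-)
proof (induction k arbitrary: f g F G)
  case 0
  have "norm (f p * g p) \<le> F 0 * G 0" if "p \<in> S" for p
  proof -
    have "norm (f p) \<le> F 0" "norm (g p) \<le> G 0"
      using wboundD[OF 0(3)[of 0], of "[]"] wboundD[OF 0(4)[of 0], of "[]"] that by auto
    then show ?thesis
      by (meson mult_mono norm_ge_zero norm_mult_ineq order_trans)
  qed
  then show ?case by (simp add: wbound_def)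
next
  case (Suc k)
  show ?case unfolding wbound_Suc_iff sum_binomial_Suc[symmetric]
  proof
    fix b :: 'a assume b: "b \<in> Basis"
    have F: "wbound S (dir_deriv b f) j (F (Suc j))" and G: "wbound S (dir_deriv b g) j (G (Suc j))" for j
      using Suc.prems(3)[of "Suc j"] Suc.prems(4)[of "Suc j"] b unfolding wbound_Suc_iff by auto
    have "wbound S (\<lambda>p. dir_deriv b f p * g p + f p * dir_deriv b g p) k
       ((\<Sum>j\<le>k. real (k choose j) * F (Suc j) * G (k - j)) + (\<Sum>j\<le>k. real (k choose j) * F j * G (Suc (k - j))))"
      using Suc.prems F G
      by (intro wbound_add S Suc.IH[where F = "\<lambda>j. F (Suc j)"] Suc.IH[where G = "\<lambda>j. G (Suc j)"] Cinf_on_mult Cinf_on_dir_deriv)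
    then show "wbound S (dir_deriv b (\<lambda>p. f p * g p)) k
       ((\<Sum>j\<le>k. real (k choose j) * F (Suc j) * G (k - j)) + (\<Sum>j\<le>k. real (k choose j) * F j * G (Suc (k - j))))"
      by (rule wbound_cong[OF S, rotated])
        (use Suc.prems in \<open>auto intro!: dir_deriv_mult[symmetric] Cinf_on_differentiable\<close>)
  qed
qed

lemma wbound_comp_linear:
  fixes f :: "'a::euclidean_space \<Rightarrow> 'b::real_normed_vector" and A :: "'c::euclidean_space \<Rightarrow> 'a"
  assumes A: "bounded_linear A" and S: "open S" and f: "Cinf_on S f"
    and AB: "\<And>b. b \<in> Basis \<Longrightarrow> A b \<in> insert 0 Basis" and "0 \<le> X" "wbound S f k X"
  shows "wbound (A -` S) (\<lambda>q. f (A q)) k X"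
  unfolding wbound_def
proof (intro ballI allI impI)
  fix w :: "'c list" and p assume w: "set w \<subseteq> Basis \<and> length w = k" and p: "p \<in> A -` S"
  show "norm (wderiv w (\<lambda>q. f (A q)) p) \<le> X"
  proof (cases "0 \<in> set (map A w)")
    case True
    then show ?thesis using wderiv_comp_linear[OF A S f, of p w] p wderiv_zero_direction[OF S f True, of "A p"] assms(5) by simp
  next
    case False
    then have "set (map A w) \<subseteq> Basis" using AB w by force
    then show ?thesis using wderiv_comp_linear[OF A S f, of p w] p wboundD[OF assms(6), of "map A w" "A p"] w by simp
  qed
qed

section \<open>Regular sequences\<close>

locale regular_seq =
  fixes M :: "nat \<Rightarrow> real"
  assumes regular: "regular_sequence M"
begin

abbreviation m :: "nat \<Rightarrow> real" where "m \<equiv> quot_fact M"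

definition ratio :: "nat \<Rightarrow> real" where "ratio k = m (Suc k) / m k"

lemma M_eq: "M k = fact k * m k"
  by (simp add: quot_fact_def)

lemma m_pos [simp]: "m k > 0"
  using regular unfolding regular_sequence_def Let_def quot_fact_def by simp

lemma M_pos [simp]: "M k > 0"
  using regular unfolding regular_sequence_def Let_def by simp

lemma m_0 [simp]: "m 0 = 1" and m_1: "m (Suc 0) = 1"
  using regular unfolding regular_sequence_def Let_def by simp_all

lemma m_Suc: "m (Suc k) = m k * ratio k"
  by (simp add: ratio_def less_imp_neq[OF m_pos, symmetric])

lemma ratio_pos [simp]: "ratio k > 0"
  by (simp add: ratio_def)

lemma ratio_mono: "j \<le> k \<Longrightarrow> ratio j \<le> ratio k"
proof (rule lift_Suc_mono_le[of ratio])
  fix k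
  have "(m (Suc k))\<^sup>2 \<le> m k * m (Suc (Suc k))"
    using regular unfolding regular_sequence_def Let_def
    by (metis Suc_eq_plus1 diff_Suc_1 le_add2)
  then show "ratio k \<le> ratio (Suc k)"
    by (simp add: ratio_def divide_simps power2_eq_square mult.commute less_imp_neq[OF m_pos, symmetric])
qed

lemma ratio_ge_1: "ratio k \<ge> 1"
  using ratio_mono[of 0 k] by (simp add: ratio_def m_1)

text \<open>\<open>m (k + p) / m k\<close> is a product of \<open>p\<close> consecutive ratios, of
  which \<open>ratio k\<close> is the smallest. In \<open>m_add_le\<close> each of them is replaced
  by the larger \<open>ratio (k + p)\<close>.\<close>

lemma m_add_ge: "m k * ratio k ^ p \<le> m (k + p)"
proof (induction p)
  case (Suc p)
  have "m k * ratio k ^ Suc p = (m k * ratio k ^ p) * ratio k" by simp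
  also have "\<dots> \<le> m (k + p) * ratio (k + p)"
    using Suc ratio_mono[of k "k + p"] by (intro mult_mono) (auto intro: less_imp_le)
  finally show ?case by (simp add: m_Suc)
qed simp

lemma m_add_le: "m (k + p) \<le> m k * ratio (k + p) ^ p"
proof (induction p)
  case (Suc p)
  have "m (k + Suc p) = m (k + p) * ratio (k + p)" by (simp add: m_Suc)
  also have "\<dots> \<le> (m k * ratio (k + p) ^ p) * ratio (k + p)"
    using Suc by (intro mult_right_mono) (auto intro: less_imp_le)
  also have "\<dots> = m k * ratio (k + p) ^ Suc p" by simp
  also have "\<dots> \<le> m k * ratio (k + Suc p) ^ Suc p"
    using ratio_mono[of "k + p" "k + Suc p"] by (intro mult_left_mono power_mono) (auto intro: less_imp_le)
  finally show ?case .
qed simp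

lemma m_le_add: "m k \<le> m (k + p)"
proof -
  have "m k * 1 \<le> m k * ratio k ^ p"
    using ratio_ge_1 by (intro mult_left_mono) (auto intro: less_imp_le one_le_power)
  then show ?thesis using m_add_ge[of k p] by (metis mult.right_neutral order_trans)
qed

lemma m_mult_le: "m a * m b \<le> m (a + b)"
proof (induction b)
  case (Suc b)
  have "m a * m (Suc b) = (m a * m b) * ratio b" by (simp add: m_Suc)
  also have "\<dots> \<le> m (a + b) * ratio (a + b)"
    using Suc ratio_mono[of b "a + b"] by (intro mult_mono) (auto intro: less_imp_le)
  finally show ?case by (simp add: m_Suc)
qed simp

text \<open>Cauchy's estimates contribute \<open>fact l\<close> for \<open>l\<close> derivatives in
  \<open>\<zeta>\<close>; this absorbs them into the scale of \<open>M\<close>.\<close>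

lemma M_fact_le: "M a * fact l \<le> M (a + l)"
proof -
  have "fact a * fact l \<le> (fact (a + l) :: real)"
    using fact_fact_dvd_fact[of a l] by (metis dvd_imp_le fact_gt_zero of_nat_fact of_nat_le_iff of_nat_mult)
  then have "(fact a * fact l) * m a \<le> fact (a + l) * m (a + l)"
    using m_le_add[of a l] by (intro mult_mono) (auto intro: less_imp_le)
  then show ?thesis by (simp add: M_eq mult_ac)
qed

text \<open>The factorials inside \<open>M\<close> cancel the binomial coefficient of the Leibniz
  rule, even after \<open>n\<close> earlier derivatives, because \<open>k choose r\<close> is at
  most \<open>n + k choose r\<close>.\<close>

lemma binomial_M_M_le:
  assumes "r \<le> k"
  shows "real (k choose r) * M r * M (n + k - r) \<le> M (n + k)"
proof -
  have "real (k choose r) \<le> real (n + k choose r)"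
    by (simp add: binomial_right_mono le_add2)
  also have "\<dots> = fact (n + k) / (fact r * fact (n + k - r))"
    using assms by (simp add: binomial_fact)
  finally have "real (k choose r) * (fact r * fact (n + k - r)) \<le> fact (n + k)"
    by (simp add: divide_simps)
  moreover have "m r * m (n + k - r) \<le> m (n + k)"
    using m_mult_le[of r "n + k - r"] assms by simp
  ultimately have "(real (k choose r) * (fact r * fact (n + k - r))) * (m r * m (n + k - r)) \<le> fact (n + k) * m (n + k)"
    by (intro mult_mono) (auto intro: less_imp_le)
  then show ?thesis by (simp add: M_eq mult_ac)
qed

lemma ratio_growth: "\<exists>B\<ge>1. \<forall>k. ratio k \<le> B ^ k"
proof -
  obtain B where B: "\<And>k. k \<ge> 1 \<Longrightarrow> root k (ratio k) \<le> B"
    using regular unfolding regular_sequence_def Let_def bdd_above_def ratio_def by auto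
  have "ratio k \<le> (max 1 B) ^ k" for k
  proof (cases "k = 0")
    case True
    then show ?thesis by (simp add: ratio_def m_1)
  next
    case False
    then have "ratio k = root k (ratio k) ^ k"
      by (simp add: less_imp_le)
    also have "\<dots> \<le> (max 1 B) ^ k"
      using B[of k] False by (intro power_mono) (auto intro: less_imp_le)
    finally show ?thesis .
  qed
  then show ?thesis by (intro exI[of _ "max 1 B"]) auto
qed

text \<open>\<open>root k (m k)\<close> is the geometric mean of the first \<open>k\<close> ratios,
  hence at most \<open>ratio k\<close>.\<close>

lemma ratio_at_top: "filterlim ratio at_top sequentially"
proof (rule filterlim_at_top_mono)
  show "filterlim (\<lambda>k. root k (m k)) at_top sequentially"
    using regular unfolding regular_sequence_def Let_def by simp
  show "\<forall>\<^sub>F k in sequentially. root k (m k) \<le> ratio k"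
  proof (rule eventually_sequentiallyI[of 1])
    fix k :: nat assume k: "1 \<le> k"
    have "root k (m k) \<le> root k (ratio k ^ k)"
      using m_add_le[of 0 k] k by simp
    then show "root k (m k) \<le> ratio k"
      using k by (simp add: real_root_power_cancel less_imp_le)
  qed
qed

text \<open>The critical radius of order \<open>k\<close>: beyond it the monomial \<open>m k * t ^ k\<close> is, up to the
  factor \<open>2 ^ k\<close>, dominated by all monomials of higher order. Truncating at the index determined by
  these radii (rather than by \<open>ratio\<close>) costs only a geometric factor, and makes every derivative of
  the truncated series converge, however irregularly \<open>ratio\<close> grows.\<close>

definition dominated :: "nat \<Rightarrow> real \<Rightarrow> bool" where
  "dominated k t \<longleftrightarrow> (\<forall>p. m k \<le> 2 ^ k * m (k + p) * t ^ p)"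

definition crit_radius :: "nat \<Rightarrow> real" where
  "crit_radius k = Inf {t. 0 < t \<and> dominated k t}"

lemma dominated_mono: "dominated k s \<Longrightarrow> 0 < s \<Longrightarrow> s \<le> t \<Longrightarrow> dominated k t"
  unfolding dominated_def
proof
  fix p assume *: "\<forall>p. m k \<le> 2 ^ k * m (k + p) * s ^ p" "0 < s" "s \<le> t"
  have "m k \<le> 2 ^ k * m (k + p) * s ^ p" using * by blast
  also have "\<dots> \<le> 2 ^ k * m (k + p) * t ^ p"
    using *(2,3) by (intro mult_left_mono power_mono) (auto intro: less_imp_le)
  finally show "m k \<le> 2 ^ k * m (k + p) * t ^ p" .
qed

lemma dominated_inverse_ratio: "dominated k (1 / ratio k)"
  unfolding dominated_def
proof
  fix p
  have "m k \<le> 1 * (m (k + p) * (1 / ratio k) ^ p)"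
    using m_add_ge[of k p] by (simp add: power_one_over divide_simps less_imp_neq[OF ratio_pos, symmetric])
  also have "\<dots> \<le> 2 ^ k * (m (k + p) * (1 / ratio k) ^ p)"
    by (intro mult_right_mono) (auto intro: less_imp_le)
  finally show "m k \<le> 2 ^ k * m (k + p) * (1 / ratio k) ^ p" by (simp add: mult.assoc)
qed

lemma dominated_imp_ge:
  assumes "dominated k t"
  shows "1 / (2 ^ k * ratio k) \<le> t"
proof -
  have "m k \<le> 2 ^ k * m (k + 1) * t ^ 1" using assms unfolding dominated_def by blast
  then have "m k * 1 \<le> m k * (2 ^ k * ratio k * t)" by (simp add: m_Suc mult_ac)
  then have "1 \<le> 2 ^ k * ratio k * t" using m_pos[of k] by (metis mult_le_cancel_left_pos)
  then show ?thesis by (simp add: divide_simps mult_ac)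
qed

text \<open>This makes the critical radii decrease. The factor allowed in \<open>dominated\<close>
  doubles from \<open>k\<close> to \<open>Suc k\<close>, which pays for \<open>ratio k * t\<close>
  as long as it is at most 2. Otherwise \<open>ratio (Suc k) * t\<close> exceeds 1 and all later
  monomials increase anyway.\<close>

lemma dominated_Suc:
  assumes "dominated k t" "t > 0"
  shows "dominated (Suc k) t"
  unfolding dominated_def
proof
  fix p
  show "m (Suc k) \<le> 2 ^ Suc k * m (Suc k + p) * t ^ p"
  proof (cases "ratio k * t \<le> 2")
    case True
    have "m (Suc k) \<le> (2 ^ k * m (k + Suc p) * t ^ Suc p) * ratio k"
      using assms(1)[unfolded dominated_def, rule_format, of "Suc p"] unfolding m_Suc
      by (intro mult_right_mono) (auto intro: less_imp_le)
    also have "\<dots> = (2 ^ k * m (k + Suc p) * t ^ p) * (ratio k * t)" by simp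
    also have "\<dots> \<le> (2 ^ k * m (k + Suc p) * t ^ p) * 2"
      using True assms(2) by (intro mult_left_mono) (auto intro: less_imp_le)
    finally show ?thesis by (simp add: mult_ac)
  next
    case False
    have "ratio k * t \<le> ratio (Suc k) * t"
      using ratio_mono[of k "Suc k"] assms(2) by simp
    then have 1: "1 \<le> ratio (Suc k) * t" using False by simp
    have "m (Suc k) * 1 \<le> m (Suc k) * (ratio (Suc k) * t) ^ p"
      using 1 by (intro mult_left_mono one_le_power) (auto intro: less_imp_le)
    also have "\<dots> = m (Suc k) * ratio (Suc k) ^ p * t ^ p" by (simp add: power_mult_distrib)
    also have "\<dots> \<le> m (Suc k + p) * t ^ p"
      using m_add_ge[of "Suc k" p] assms(2) by (intro mult_right_mono) auto
    also have "\<dots> \<le> 2 ^ Suc k * (m (Suc k + p) * t ^ p)"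
      using mult_right_mono[OF one_le_power[of "2::real" "Suc k"], of "m (Suc k + p) * t ^ p"] assms(2)
      by (simp add: less_imp_le del: power_Suc)
    finally show ?thesis by (simp add: mult_ac)
  qed
qed

lemma crit_radius_bdd: "bdd_below {t. 0 < t \<and> dominated k t}"
  by (intro bdd_belowI[of _ 0]) auto

lemma crit_radius_le: "crit_radius k \<le> 1 / ratio k"
  unfolding crit_radius_def
  by (rule cInf_lower[OF _ crit_radius_bdd]) (simp add: dominated_inverse_ratio)

text \<open>The case \<open>p = 1\<close> of domination. Together with \<open>ratio_growth\<close>
  it makes \<open>1 / crit_radius k\<close> at most exponential in \<open>k\<close>.\<close>

lemma crit_radius_ge: "1 / (2 ^ k * ratio k) \<le> crit_radius k"
proof -
  have "1 / ratio k \<in> {t. 0 < t \<and> dominated k t}" by (simp add: dominated_inverse_ratio)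
  then show ?thesis
    unfolding crit_radius_def by (intro cInf_greatest; blast intro: dominated_imp_ge)
qed

lemma crit_radius_pos [simp]: "crit_radius k > 0"
  by (rule less_le_trans[OF _ crit_radius_ge]) simp

lemma crit_radius_le_1: "crit_radius k \<le> 1"
proof -
  have "1 / ratio k \<le> 1" using ratio_ge_1[of k] by (simp add: divide_simps)
  then show ?thesis using crit_radius_le[of k] by (rule order_trans[rotated])
qed

lemma dominated_if_gt: "crit_radius k < t \<Longrightarrow> dominated k t"
  unfolding crit_radius_def
  by (subst (asm) cInf_less_iff[OF _ crit_radius_bdd])
    (use dominated_inverse_ratio[of k] ratio_pos[of k] zero_less_divide_1_iff in \<open>blast, blast intro: dominated_mono less_imp_le\<close>)

lemma not_dominated_if_less: "0 < t \<Longrightarrow> t < crit_radius k \<Longrightarrow> \<not> dominated k t"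
  unfolding crit_radius_def using cInf_lower[OF _ crit_radius_bdd, of t k] by auto

lemma crit_radius_Suc_le: "crit_radius (Suc k) \<le> crit_radius k"
  unfolding crit_radius_def
  by (rule cInf_superset_mono[OF _ crit_radius_bdd])
    (use dominated_inverse_ratio[of k] ratio_pos[of k] in
      \<open>auto intro!: dominated_Suc exI[of _ "1 / ratio k"]\<close>)

lemma crit_radius_tendsto_0: "crit_radius \<longlonglongrightarrow> 0"
proof (rule tendsto_sandwich[of "\<lambda>_. 0"])
  show "(\<lambda>k. 1 / ratio k) \<longlonglongrightarrow> 0"
    using ratio_at_top filterlim_at_top_imp_at_infinity tendsto_divide_0[OF tendsto_const] by blast
qed (auto intro!: always_eventually crit_radius_le less_imp_le)

text \<open>Here \<open>a\<close> counts derivatives falling on the iterates and \<open>b\<close>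
  the powers of \<open>1 / t\<close> produced by the cutoffs. Below the critical radius some
  \<open>p\<close> violates domination. If \<open>p\<close> is at least \<open>2 * a\<close>, then
  \<open>m (k + a)\<close> exceeds \<open>m k\<close> by at most \<open>t ^ (2 * a)\<close>
  inverted: otherwise the monomials would increase from \<open>k + a\<close> to
  \<open>k + p\<close>, against the choice of \<open>p\<close>. If \<open>p\<close> is smaller, then
  \<open>t ^ (2 * a)\<close> is at most \<open>2 ^ k\<close> inverted, and a fixed power of
  \<open>t\<close> beats the exponential quotient \<open>m (k + a) / m k\<close>.\<close>

lemma m_shift_le_below_crit_radius:
  "\<exists>C q. \<forall>k\<ge>q. \<forall>t. 0 < t \<and> t < crit_radius k \<longrightarrow> m (k + a) * t ^ k \<le> C * t ^ b"
proof -
  obtain B where B: "B \<ge> 1" "\<And>k. ratio k \<le> B ^ k" using ratio_growth by blast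
  obtain n where n: "B \<le> 2 ^ n" using real_arch_pow[of 2 B] by (auto intro: less_imp_le)
  \<comment> \<open>The powers of \<open>t\<close> to be spent: \<open>2 * a * (n * a)\<close> when
    \<open>p < 2 * a\<close>, where \<open>B ^ (k * a)\<close> is bounded through
    \<open>B \<le> 2 ^ n\<close>; \<open>2 * a\<close> in the other case; and \<open>b\<close> for
    the conclusion.\<close>
  define q where "q = 2 * a * (n * a) + 2 * a + b"
  have "m (k + a) * t ^ k \<le> (m q * B ^ (a * a)) * t ^ b" if k: "k \<ge> q" and t: "0 < t" "t < crit_radius k" for k t
  proof -
    have t1: "t \<le> 1" using t(2) crit_radius_le_1[of k] by simp
    have rt: "ratio k * t \<le> 1"
      using less_le_trans[OF t(2) crit_radius_le] by (simp add: divide_simps mult.commute)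
    obtain p where p: "2 ^ k * m (k + p) * t ^ p < m k"
      using not_dominated_if_less[OF t] unfolding dominated_def by (auto simp: not_le)
    have "m (k + a) * t ^ (q - b) \<le> B ^ (a * a) * m k"
    proof (cases "2 * a \<le> p")
      case True
      have "m (k + p) * t ^ p \<le> 2 ^ k * (m (k + p) * t ^ p)"
        using mult_right_mono[OF one_le_power[of "2::real" k], of "m (k + p) * t ^ p"] t(1) by (simp add: less_imp_le)
      then have p': "m (k + p) * t ^ p < m k" using p unfolding mult.assoc by (rule le_less_trans)
      have "m (k + a) * t ^ (2 * a) \<le> m k"
      proof (rule ccontr)
        assume "\<not> m (k + a) * t ^ (2 * a) \<le> m k"
        then have c: "m k < m (k + a) * t ^ (2 * a)" by simp
        have "m (k + a) * t ^ (2 * a) \<le> (m k * ratio (k + a) ^ a) * t ^ (2 * a)"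
          using m_add_le[of k a] t(1) by (intro mult_right_mono) auto
        also have "\<dots> = m k * (ratio (k + a) * t ^ 2) ^ a"
          by (simp add: power_mult_distrib power_mult mult.assoc)
        finally have "m k * 1 < m k * (ratio (k + a) * t ^ 2) ^ a"
          using c by linarith
        then have "1 < (ratio (k + a) * t ^ 2) ^ a" using m_pos[of k] by (metis mult_less_cancel_left_pos)
        then have "1 \<le> ratio (k + a) * t ^ 2"
          using power_le_one[of "ratio (k + a) * t ^ 2" a] t(1)
          by (meson less_imp_le linorder_not_le mult_nonneg_nonneg ratio_pos zero_le_power2)
        also have "\<dots> \<le> ratio (k + a) * t"
          using t(1) t1 by (intro mult_left_mono) (auto simp: power2_eq_square less_imp_le mult_left_le)
        finally have r1: "1 \<le> ratio (k + a) * t" .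
        \<comment> \<open>The inserted factor is at least 1 and completes the product to a lower
          bound of \<open>m (k + p) * t ^ p\<close>.\<close>
        have "m k * 1 < (m (k + a) * t ^ (2 * a)) * 1" using c by simp
        also have "\<dots> \<le> (m (k + a) * t ^ (2 * a)) * (ratio (k + a) ^ a * (ratio (k + a) * t) ^ (p - 2 * a))"
        proof (intro mult_left_mono)
          have "1 * 1 \<le> ratio (k + a) ^ a * (ratio (k + a) * t) ^ (p - 2 * a)"
            using r1 ratio_ge_1 by (intro mult_mono one_le_power) (auto intro: less_imp_le)
          then show "1 \<le> ratio (k + a) ^ a * (ratio (k + a) * t) ^ (p - 2 * a)" by simp
        qed (use t in \<open>auto intro: less_imp_le\<close>)
        also have "\<dots> = (m (k + a) * ratio (k + a) ^ (p - a)) * t ^ p"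
        proof -
          have "ratio (k + a) ^ (p - a) = ratio (k + a) ^ a * ratio (k + a) ^ (p - 2 * a)"
            using True by (simp flip: power_add)
          moreover have "t ^ p = t ^ (2 * a) * t ^ (p - 2 * a)" using True by (simp flip: power_add)
          ultimately show ?thesis by (simp add: power_mult_distrib mult_ac)
        qed
        also have "\<dots> \<le> m (k + p) * t ^ p"
          using m_add_ge[of "k + a" "p - a"] True t(1) by (intro mult_right_mono) auto
        finally show False using p' by simp
      qed
      moreover have "m (k + a) * t ^ (q - b) \<le> m (k + a) * t ^ (2 * a)"
        using t(1) t1 by (intro mult_left_mono power_decreasing) (auto simp: q_def less_imp_le)
      moreover have "1 * m k \<le> B ^ (a * a) * m k"
        using B(1) by (intro mult_right_mono one_le_power) (auto intro: less_imp_le)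
      ultimately show ?thesis by linarith
    next
      case False
      have "t ^ (2 * a) \<le> t ^ p"
        using t(1) t1 False by (intro power_decreasing) auto
      then have "2 ^ k * t ^ (2 * a) * m k \<le> 2 ^ k * t ^ p * m (k + p)"
        using t(1) m_le_add[of k p] by (intro mult_mono[OF mult_left_mono]) (auto intro: less_imp_le)
      also have "2 ^ k * t ^ p * m (k + p) = 2 ^ k * m (k + p) * t ^ p" by (simp only: mult_ac)
      finally have "2 ^ k * t ^ (2 * a) * m k \<le> 1 * m k" using p by linarith
      then have two: "2 ^ k * t ^ (2 * a) \<le> 1" using m_pos[of k] by (metis mult_le_cancel_right_pos)
      have "m (k + a) \<le> m k * ratio (k + a) ^ a" by (rule m_add_le)
      also have "\<dots> \<le> m k * (B ^ (k + a)) ^ a"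
        using B(2)[of "k + a"] by (intro mult_left_mono power_mono) (auto intro: less_imp_le)
      also have "\<dots> = m k * (B ^ (a * a) * B ^ (k * a))" by (simp add: power_add power_mult_distrib flip: power_mult)
      also have "\<dots> \<le> m k * (B ^ (a * a) * (2 ^ n) ^ (k * a))"
        using B(1) n by (intro mult_left_mono power_mono) (auto intro: less_imp_le)
      also have "(2 ^ n) ^ (k * a) = ((2::real) ^ k) ^ (n * a)" by (simp add: mult_ac flip: power_mult)
      finally have "m (k + a) * t ^ (q - b) \<le> (m k * (B ^ (a * a) * (2 ^ k) ^ (n * a))) * t ^ (2 * a * (n * a))"
        using t t1 B(1) by (intro mult_mono power_decreasing) (auto simp: q_def intro!: mult_nonneg_nonneg less_imp_le)
      also have "\<dots> = m k * B ^ (a * a) * (2 ^ k * t ^ (2 * a)) ^ (n * a)"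
        by (simp add: power_mult_distrib power_mult[of t "2 * a"])
      also have "\<dots> \<le> m k * B ^ (a * a) * 1"
        using two t(1) B(1) by (intro mult_left_mono power_le_one) (auto intro!: mult_nonneg_nonneg less_imp_le)
      finally show ?thesis by (simp add: mult_ac)
    qed
    then have "m (k + a) * t ^ (q - b) * (t ^ (k - q) * t ^ b) \<le> B ^ (a * a) * m k * (t ^ (k - q) * t ^ b)"
      using t(1) by (intro mult_right_mono) auto
    moreover have "t ^ k = t ^ (q - b) * (t ^ (k - q) * t ^ b)"
      using k by (simp add: q_def flip: power_add)
    \<comment> \<open>The powers of \<open>t\<close> not yet spent pay for the growth from
      \<open>m q\<close> to \<open>m k\<close>, since \<open>ratio k * t \<le> 1\<close>.\<close>
    moreover have "m k * t ^ (k - q) \<le> m q"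
    proof -
      have "m k \<le> m q * ratio k ^ (k - q)" using m_add_le[of q "k - q"] k by simp
      then have "m k * t ^ (k - q) \<le> m q * ratio k ^ (k - q) * t ^ (k - q)"
        using t(1) by (intro mult_right_mono) auto
      also have "\<dots> = m q * (ratio k * t) ^ (k - q)" by (simp add: power_mult_distrib)
      also have "\<dots> \<le> m q * 1"
        using rt t(1) by (intro mult_left_mono power_le_one) (auto intro: less_imp_le)
      finally show ?thesis by simp
    qed
    then have "B ^ (a * a) * t ^ b * (m k * t ^ (k - q)) \<le> B ^ (a * a) * t ^ b * m q"
      using t(1) B(1) by (intro mult_left_mono) auto
    ultimately show ?thesis by (simp add: mult_ac)
  qed
  then show ?thesis by blast
qed

section \<open>Comparison of monomials with the associated function \<open>h\<close>\<close>

lemma assoc_h_geI: "r > 0 \<Longrightarrow> (\<And>j. X \<le> m j * r ^ j) \<Longrightarrow> X \<le> assoc_h M r"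
  unfolding assoc_h_def by (auto intro: cINF_greatest)

lemma assoc_h_nonneg: "0 \<le> assoc_h M r"
proof (cases "r > 0")
  case True
  then show ?thesis by (intro assoc_h_geI) (auto intro: less_imp_le)
qed (simp add: assoc_h_def)

text \<open>Each competitor of index \<open>j\<close> in the infimum is treated separately. For
  \<open>j \<le> k\<close> the upper limit on \<open>t\<close> gives
  \<open>G * t * ratio k \<le> 1\<close>, so monomials decrease from \<open>j\<close> to
  \<open>k\<close>. For \<open>j > k\<close> the lower limit on \<open>t\<close> gives domination of
  \<open>m (Suc k)\<close>; what is lost is exponential in \<open>k\<close>, hence in
  \<open>j\<close>.\<close>

lemma monomial_le_assoc_h:
  assumes G: "G \<ge> 1" and lam: "lam \<ge> G"
  shows "\<exists>A>0. \<exists>Q>0. \<forall>k t. 0 < t \<and> lam * t < crit_radius k \<and> crit_radius (Suc k) \<le> 2 * lam * t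
    \<longrightarrow> G ^ k * m k * t ^ k \<le> A * assoc_h M (Q * t)"
proof -
  obtain B where B: "B \<ge> 1" "\<And>k. ratio k \<le> B ^ k" using ratio_growth by blast
  \<comment> \<open>The factor \<open>4 * B\<close> collects \<open>2 ^ Suc k\<close> from
    domination and \<open>(2 * B) ^ Suc k\<close> from the lower bound on the critical radius;
    \<open>3 * lam\<close> is the rescaling of \<open>t\<close> at which domination is
    applied.\<close>
  define Q where "Q = 4 * B * G * (3 * lam)"
  have lam1: "lam \<ge> 1" using G lam by simp
  have QG: "G \<le> Q"
  proof -
    have "1 * G * 1 \<le> (4 * B) * G * (3 * lam)"
      using G B(1) lam1 by (intro mult_mono) auto
    then show ?thesis by (simp add: Q_def)
  qed
  have "G ^ k * m k * t ^ k \<le> (2 * lam) * assoc_h M (Q * t)"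
    if t: "0 < t" "lam * t < crit_radius k" "crit_radius (Suc k) \<le> 2 * lam * t" for k t
  proof -
    have "G ^ k * m k * t ^ k / (2 * lam) \<le> m j * (Q * t) ^ j" for j
    proof (cases "j \<le> k")
      case True
      have "G * t * ratio k \<le> lam * t * ratio k"
        using lam t(1) by (intro mult_right_mono) (auto intro: less_imp_le)
      also have "\<dots> \<le> 1"
        using less_le_trans[OF t(2) crit_radius_le] by (simp add: divide_simps mult.commute)
      finally have rt: "G * t * ratio k \<le> 1" .
      have "G ^ k * m k * t ^ k = (G * t) ^ k * m k" by (simp add: power_mult_distrib)
      also have "\<dots> \<le> (G * t) ^ k * (m j * ratio k ^ (k - j))"
        using m_add_le[of j "k - j"] True G t(1) by (intro mult_left_mono) auto
      also have "(G * t) ^ k = (G * t) ^ j * (G * t) ^ (k - j)" using True by (simp flip: power_add)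
      also have "(G * t) ^ j * (G * t) ^ (k - j) * (m j * ratio k ^ (k - j)) = m j * (G * t) ^ j * (G * t * ratio k) ^ (k - j)"
        by (simp add: power_mult_distrib mult_ac)
      also have "\<dots> \<le> m j * (G * t) ^ j * 1"
        using rt G t(1) by (intro mult_left_mono power_le_one) (auto intro: less_imp_le)
      also have "\<dots> \<le> m j * (Q * t) ^ j"
        using QG G t(1) unfolding mult_1_right
        by (intro mult_left_mono power_mono mult_right_mono) (auto intro: less_imp_le)
      finally have "G ^ k * m k * t ^ k \<le> m j * (Q * t) ^ j" .
      moreover have "G ^ k * m k * t ^ k / (2 * lam) \<le> G ^ k * m k * t ^ k / 1"
        using lam1 G t(1) by (intro divide_left_mono) (auto intro: less_imp_le)
      ultimately show ?thesis by simp
    next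
      case False
      define p where "p = j - Suc k"
      have j: "j = Suc k + p" using False by (simp add: p_def)
      \<comment> \<open>Domination is available only strictly beyond the critical radius, which is
        why 2 becomes 3.\<close>
      have "crit_radius (Suc k) < 3 * lam * t"
        using t(3) mult_pos_pos[of lam t] lam1 t(1) by linarith
      then have "dominated (Suc k) (3 * lam * t)" by (rule dominated_if_gt)
      then have dom: "m (Suc k) \<le> 2 ^ Suc k * m j * (3 * lam * t) ^ p"
        unfolding dominated_def j by blast
      have "1 / (2 ^ Suc k * B ^ Suc k) \<le> 1 / (2 ^ Suc k * ratio (Suc k))"
        using B(1) B(2)[of "Suc k"]
        by (intro divide_left_mono mult_left_mono mult_pos_pos) (auto simp del: power_Suc)
      also have "\<dots> \<le> crit_radius (Suc k)" by (rule crit_radius_ge)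
      also have "\<dots> \<le> 2 * lam * t" by (rule t(3))
      \<comment> \<open>Domination from \<open>Suc k\<close> supplies \<open>t ^ p\<close>, but
        \<open>j = Suc k + p\<close> calls for one more \<open>t\<close> than
        \<open>t ^ p * t ^ k\<close>. The missing factor is bounded below exponentially in
        \<open>k\<close>.\<close>
      finally have inv: "1 \<le> 2 * lam * t * (2 * B) ^ Suc k"
        using B(1) by (simp add: divide_simps power_mult_distrib mult_ac)
      have "m k * 1 \<le> m k * ratio k"
        using ratio_ge_1[of k] by (intro mult_left_mono) (auto intro: less_imp_le)
      then have mk: "m k \<le> m (Suc k)" by (simp add: m_Suc)
      have "G ^ k * m k \<le> G ^ j * m (Suc k)"
        using mk G False by (intro mult_mono power_increasing) (auto intro: less_imp_le)
      then have "G ^ k * m k * t ^ k * 1 \<le> G ^ j * m (Suc k) * t ^ k * (2 * lam * t * (2 * B) ^ Suc k)"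
        using inv G t(1) by (intro mult_mono[OF mult_right_mono]) (auto intro: less_imp_le)
      also have "\<dots> \<le> G ^ j * (2 ^ Suc k * m j * (3 * lam * t) ^ p) * t ^ k * (2 * lam * t * (2 * B) ^ Suc k)"
        using dom G t(1) lam1 B(1)
        by (intro mult_right_mono mult_left_mono) (auto intro: less_imp_le)
      also have "\<dots> = (2 * lam) * (m j * G ^ j * (4 * B) ^ Suc k * ((3 * lam) ^ p * t ^ j))"
      proof -
        have B4: "(4 * B) ^ Suc k = 2 ^ Suc k * (2 * B) ^ Suc k"
          unfolding power_mult_distrib[symmetric] by simp
        have tj: "t ^ j = t ^ p * t ^ k * t" by (simp add: j power_add)
        show ?thesis unfolding B4 tj power_mult_distrib[of "3 * lam"] by (simp only: mult_ac)
      qed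
      also have "\<dots> \<le> (2 * lam) * (m j * G ^ j * (4 * B) ^ j * ((3 * lam) ^ j * t ^ j))"
      proof -
        have "(4 * B) ^ Suc k \<le> (4 * B) ^ j" "(3 * lam) ^ p \<le> (3 * lam) ^ j"
          using B(1) lam1 False unfolding p_def by (intro power_increasing; linarith)+
        then show ?thesis
          using G t(1) lam1 B(1)
          by (intro mult_left_mono mult_mono[OF mult_left_mono mult_right_mono]) (auto intro: less_imp_le simp del: power_Suc)
      qed
      also have "\<dots> = (2 * lam) * (m j * (Q * t) ^ j)"
        by (simp only: Q_def power_mult_distrib mult_ac)
      finally show ?thesis using lam1 by (simp add: divide_simps mult_ac)
    qed
    then have "G ^ k * m k * t ^ k / (2 * lam) \<le> assoc_h M (Q * t)"
      using QG G t(1) by (intro assoc_h_geI) auto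
    then show ?thesis using lam1 by (simp add: divide_simps mult_ac)
  qed
  then show ?thesis using lam1 QG G by (intro exI[of _ "2 * lam"] conjI exI[of _ Q]) auto
qed

end

section \<open>Series of smooth functions\<close>

text \<open>Differentiation of series requires uniform convergence of the derivatives as linear
  maps. Bounds along the basis suffice after expanding the direction in coordinates.\<close>

lemma dir_deriv_suminf:
  fixes h :: "nat \<Rightarrow> 'a::euclidean_space \<Rightarrow> 'b::banach"
  assumes S: "open S" "p \<in> S"
    and d: "\<And>k q. q \<in> S \<Longrightarrow> h k differentiable (at q)"
    and Y: "\<And>k q b. q \<in> S \<Longrightarrow> b \<in> Basis \<Longrightarrow> norm (dir_deriv b (h k) q) \<le> Y k" "summable Y"
    and s: "\<And>q. q \<in> S \<Longrightarrow> summable (\<lambda>k. h k q)"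
  shows "(\<lambda>q. \<Sum>k. h k q) differentiable (at p)"
    and "b \<in> Basis \<Longrightarrow> dir_deriv b (\<lambda>q. \<Sum>k. h k q) p = (\<Sum>k. dir_deriv b (h k) p)"
proof -
  obtain r where r: "r > 0" "ball p r \<subseteq> S" using S open_contains_ball by blast
  define D where "D q v = (\<Sum>b\<in>Basis. (v \<bullet> b) *\<^sub>R (\<Sum>k. dir_deriv b (h k) q))" for q v
  have sm: "summable (\<lambda>k. dir_deriv b (h k) q)" if "q \<in> S" "b \<in> Basis" for b q
    using Y that by (intro summable_comparison_test'[OF Y(2)])
  have tail: "norm ((\<Sum>i<n. dir_deriv b (h i) q) - (\<Sum>k. dir_deriv b (h k) q)) \<le> (\<Sum>k. Y (k + n))"
    if "q \<in> S" "b \<in> Basis" for b q n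
  proof -
    have "(\<Sum>i<n. dir_deriv b (h i) q) - (\<Sum>k. dir_deriv b (h k) q) = - (\<Sum>k. dir_deriv b (h (k + n)) q)"
      using suminf_split_initial_segment[OF sm[OF that], of n] by simp
    also have "norm \<dots> \<le> (\<Sum>k. Y (k + n))"
      unfolding norm_minus_cancel using Y that
      by (intro norm_suminf_le summable_ignore_initial_segment) auto
    finally show ?thesis .
  qed
  have "\<exists>g. \<forall>x\<in>ball p r. (\<lambda>k. h k x) sums g x \<and> (g has_derivative D x) (at x within ball p r)"
  proof (rule has_derivative_series[where f' = "\<lambda>k q v. dir_deriv v (h k) q"])
    show "(h k has_derivative (\<lambda>v. dir_deriv v (h k) x)) (at x within ball p r)" if "x \<in> ball p r" for k x
      using has_derivative_dir_deriv[OF d] that r(2) has_derivative_at_withinI by blast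
    show "\<forall>\<^sub>F n in sequentially. \<forall>x\<in>ball p r. \<forall>v. norm ((\<Sum>i<n. dir_deriv v (h i) x) - D x v) \<le> e * norm v"
      if e: "e > 0" for e
    proof -
      \<comment> \<open>The tolerance \<open>e\<close> is shared among the basis directions, each of
        which contributes at most \<open>norm v * (e / N)\<close>.\<close>
      define N where "N = real DIM('a)"
      have N: "N > 0" by (simp add: N_def)
      have "(\<lambda>n. \<Sum>k. Y (k + n)) \<longlonglongrightarrow> 0" by (rule suminf_exist_split2[OF Y(2)])
      then have "\<forall>\<^sub>F n in sequentially. (\<Sum>k. Y (k + n)) < e / N"
        using e N by (intro order_tendstoD) auto
      then show ?thesis
      proof (rule eventually_mono, intro ballI allI)
        fix n x v assume n: "(\<Sum>k. Y (k + n)) < e / N" and x: "x \<in> ball p r"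
        then have xS: "x \<in> S" using r(2) by blast
        have "(\<Sum>i<n. dir_deriv v (h i) x) = (\<Sum>b\<in>Basis. (v \<bullet> b) *\<^sub>R (\<Sum>i<n. dir_deriv b (h i) x))"
          by (subst dir_deriv_basis_expansion[OF d[OF xS]]) (simp add: scaleR_sum_right sum.swap[of _ "{..<n}"])
        then have "norm ((\<Sum>i<n. dir_deriv v (h i) x) - D x v)
            = norm (\<Sum>b\<in>Basis. (v \<bullet> b) *\<^sub>R ((\<Sum>i<n. dir_deriv b (h i) x) - (\<Sum>k. dir_deriv b (h k) x)))"
          by (simp add: D_def scaleR_diff_right sum_subtractf)
        also have "\<dots> \<le> (\<Sum>b\<in>(Basis::'a set). norm v * (e / N))"
        proof (rule sum_norm_le)
          fix b :: 'a assume b: "b \<in> Basis"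
          show "norm ((v \<bullet> b) *\<^sub>R ((\<Sum>i<n. dir_deriv b (h i) x) - (\<Sum>k. dir_deriv b (h k) x))) \<le> norm v * (e / N)"
            unfolding norm_scaleR using tail[OF xS b, of n] n Basis_le_norm[OF b, of v]
            by (intro mult_mono) auto
        qed
        also have "\<dots> = e * norm v" using N by (simp add: N_def)
        finally show "norm ((\<Sum>i<n. dir_deriv v (h i) x) - D x v) \<le> e * norm v" .
      qed
    qed
    show "(\<lambda>k. h k p) sums (\<Sum>k. h k p)" using s S by (simp add: summable_sums)
  qed (use r in auto)
  then obtain g where g: "\<And>x. x \<in> ball p r \<Longrightarrow> (\<lambda>k. h k x) sums g x"
    "\<And>x. x \<in> ball p r \<Longrightarrow> (g has_derivative D x) (at x within ball p r)" by blast
  have "(g has_derivative D p) (at p)"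
    using g(2)[of p] r(1) at_within_open[of p "ball p r"] by (metis centre_in_ball open_ball)
  then have der: "((\<lambda>q. \<Sum>k. h k q) has_derivative D p) (at p)"
    by (rule has_derivative_transform_within_open[of _ _ _ _ "ball p r"])
      (use r g(1) sums_unique in auto)
  then show "(\<lambda>q. \<Sum>k. h k q) differentiable (at p)" unfolding differentiable_def by blast
  assume b: "b \<in> Basis"
  have "dir_deriv b (\<lambda>q. \<Sum>k. h k q) p = D p b" by (rule dir_deriv_eqI[OF der])
  also have "\<dots> = (\<Sum>c\<in>Basis. if c = b then (\<Sum>k. dir_deriv b (h k) p) else 0)"
    unfolding D_def using b by (intro sum.cong) (auto simp: inner_Basis)
  also have "\<dots> = (\<Sum>k. dir_deriv b (h k) p)" using b by simp
  finally show "dir_deriv b (\<lambda>q. \<Sum>k. h k q) p = (\<Sum>k. dir_deriv b (h k) p)" .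
qed

lemma
  fixes h :: "nat \<Rightarrow> 'a::euclidean_space \<Rightarrow> 'b::banach"
  assumes S: "open S"
    and h: "\<And>k. Cinf_on S (h k)"
    and X: "\<And>n k. wbound S (h k) n (X n k)" "\<And>n. summable (X n)"
  shows Cinf_on_suminf: "Cinf_on S (\<lambda>q. \<Sum>k. h k q)"
    and wderiv_suminf: "set w \<subseteq> Basis \<Longrightarrow> p \<in> S \<Longrightarrow> wderiv w (\<lambda>q. \<Sum>k. h k q) p = (\<Sum>k. wderiv w (h k) p)"
    and summable_wderiv: "set w \<subseteq> Basis \<Longrightarrow> p \<in> S \<Longrightarrow> summable (\<lambda>k. wderiv w (h k) p)"
proof -
  show sm: "summable (\<lambda>k. wderiv w (h k) p)" if "set w \<subseteq> Basis" "p \<in> S" for w p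
    using wboundD[OF X(1) that(1) refl that(2)] by (intro summable_comparison_test'[OF X(2)])
  have Y: "norm (dir_deriv b (wderiv w (h k)) q) \<le> X (Suc (length w)) k"
    if "set w \<subseteq> Basis" "q \<in> S" "b \<in> Basis" for w q b k
    using wboundD[OF X(1), of "b # w" "Suc (length w)" q] that by simp
  have eq: "wderiv w (\<lambda>q. \<Sum>k. h k q) p = (\<Sum>k. wderiv w (h k) p)" if "set w \<subseteq> Basis" "p \<in> S" for w p
    using that
  proof (induction w arbitrary: p)
    case (Cons b w)
    then have w: "set w \<subseteq> Basis" and b: "b \<in> Basis" by auto
    have "wderiv (b # w) (\<lambda>q. \<Sum>k. h k q) p = dir_deriv b (\<lambda>q. \<Sum>k. wderiv w (h k) q) p"
      unfolding wderiv_Cons by (rule dir_deriv_cong[OF S]) (use Cons w in auto)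
    also have "\<dots> = (\<Sum>k. wderiv (b # w) (h k) p)"
      unfolding wderiv_Cons
      by (rule dir_deriv_suminf(2)[OF S _ _ _ X(2)[of "Suc (length w)"]])
        (use Cons.prems w b Y sm in \<open>auto simp: Cinf_on_differentiable[OF Cinf_on_wderiv[OF h]]\<close>)
    finally show ?case .
  qed simp
  then show "set w \<subseteq> Basis \<Longrightarrow> p \<in> S \<Longrightarrow> wderiv w (\<lambda>q. \<Sum>k. h k q) p = (\<Sum>k. wderiv w (h k) p)" .
  show "Cinf_on S (\<lambda>q. \<Sum>k. h k q)"
  proof (rule Cinf_on_basisI[OF S])
    fix w p assume w: "set w \<subseteq> (Basis::'a set)" and p: "p \<in> S"
    have "(\<lambda>q. \<Sum>k. wderiv w (h k) q) differentiable (at p)"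
      by (rule dir_deriv_suminf(1)[OF S _ _ _ X(2)[of "Suc (length w)"]])
        (use p w Y sm in \<open>auto simp: Cinf_on_differentiable[OF Cinf_on_wderiv[OF h]]\<close>)
    then show "wderiv w (\<lambda>q. \<Sum>k. h k q) differentiable (at p)"
      by (rule differentiable_cong_open[OF S _ p, rotated]) (use w eq in auto)
  qed
qed

section \<open>Cauchy--Riemann equations and Cauchy estimates\<close>

text \<open>Holomorphy in \<open>\<zeta>\<close> as a pointwise linear identity between directional
  derivatives. In this form it passes to derivatives in any direction, by symmetry of second
  derivatives, as well as to sums, products and termwise differentiated series.\<close>

definition CR_on :: "('y::real_normed_vector \<times> (complex ^ 'm)) set \<Rightarrow> ('y \<times> (complex ^ 'm) \<Rightarrow> complex) \<Rightarrow> bool" where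
  "CR_on S g \<longleftrightarrow> Cinf_on S g \<and> (\<forall>p\<in>S. \<forall>v. dir_deriv (0, \<i> *s v) g p = \<i> * dir_deriv (0, v) g p)"

lemma CR_on_Cinf: "CR_on S g \<Longrightarrow> Cinf_on S g"
  and CR_onD: "CR_on S g \<Longrightarrow> p \<in> S \<Longrightarrow> dir_deriv (0, \<i> *s v) g p = \<i> * dir_deriv (0, v) g p"
  unfolding CR_on_def by auto

lemma CR_on_cong:
  assumes S: "open S" and "\<And>p. p \<in> S \<Longrightarrow> f p = g p" "CR_on S f"
  shows "CR_on S g"
  using assms dir_deriv_cong[OF S assms(2)] Cinf_on_cong[OF S assms(2)] unfolding CR_on_def by simp

lemma CR_on_subset: "CR_on S g \<Longrightarrow> T \<subseteq> S \<Longrightarrow> CR_on T g"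
  unfolding CR_on_def using Cinf_on_subset by blast

lemma CR_on_Un: "open S \<Longrightarrow> open T \<Longrightarrow> CR_on S g \<Longrightarrow> CR_on T g \<Longrightarrow> CR_on (S \<union> T) g"
  unfolding CR_on_def using Cinf_on_Un by blast

lemma CR_on_const: "CR_on S (\<lambda>_. c)"
  unfolding CR_on_def by (auto simp: fun_eq_iff)

lemma CR_on_dir_deriv:
  assumes S: "open S" and g: "CR_on S g"
  shows "CR_on S (dir_deriv w g)"
  unfolding CR_on_def
proof (intro conjI ballI allI Cinf_on_dir_deriv[OF CR_on_Cinf[OF g]])
  fix p v assume p: "p \<in> S"
  note G = CR_on_Cinf[OF g]
  have "dir_deriv (0, \<i> *s v) (dir_deriv w g) p = dir_deriv w (dir_deriv (0, \<i> *s v) g) p"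
    by (rule dir_deriv_commute[OF S G p])
  also have "\<dots> = dir_deriv w (\<lambda>q. \<i> * dir_deriv (0, v) g q) p"
    by (rule dir_deriv_cong[OF S _ p]) (rule CR_onD[OF g])
  also have "\<dots> = \<i> * dir_deriv w (dir_deriv (0, v) g) p"
    using Cinf_on_differentiable[OF Cinf_on_dir_deriv[OF G] p]
    by (subst dir_deriv_mult) auto
  also have "dir_deriv w (dir_deriv (0, v) g) p = dir_deriv (0, v) (dir_deriv w g) p"
    by (rule dir_deriv_commute[OF S G p])
  finally show "dir_deriv (0, \<i> *s v) (dir_deriv w g) p = \<i> * dir_deriv (0, v) (dir_deriv w g) p" .
qed

lemma CR_on_wderiv: "open S \<Longrightarrow> CR_on S g \<Longrightarrow> CR_on S (wderiv w g)"
  by (induction w) (auto intro: CR_on_dir_deriv)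

lemma CR_on_add:
  assumes S: "open S" and "CR_on S f" "CR_on S g"
  shows "CR_on S (\<lambda>p. f p + g p)"
  unfolding CR_on_def
proof (intro conjI ballI allI Cinf_on_add S CR_on_Cinf assms(2,3))
  fix p v assume p: "p \<in> S"
  have d: "f differentiable (at p)" "g differentiable (at p)"
    using Cinf_on_differentiable[OF CR_on_Cinf p] assms by auto
  show "dir_deriv (0, \<i> *s v) (\<lambda>p. f p + g p) p = \<i> * dir_deriv (0, v) (\<lambda>p. f p + g p) p"
    using CR_onD[OF assms(2) p] CR_onD[OF assms(3) p] by (simp add: dir_deriv_add[OF d] distrib_left)
qed

lemma CR_on_sum:
  assumes S: "open S" and "\<And>i. i \<in> I \<Longrightarrow> CR_on S (f i)"
  shows "CR_on S (\<lambda>p. \<Sum>i\<in>I. f i p)"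
  unfolding CR_on_def
proof (intro conjI ballI allI Cinf_on_sum S CR_on_Cinf assms(2))
  fix p v assume p: "p \<in> S"
  have d: "\<And>i. i \<in> I \<Longrightarrow> f i differentiable (at p)"
    using Cinf_on_differentiable[OF CR_on_Cinf[OF assms(2)] p] .
  show "dir_deriv (0, \<i> *s v) (\<lambda>p. \<Sum>i\<in>I. f i p) p = \<i> * dir_deriv (0, v) (\<lambda>p. \<Sum>i\<in>I. f i p) p"
    using CR_onD[OF assms(2) p] by (simp add: dir_deriv_sum[OF d] sum_distrib_left)
qed

lemma CR_on_mult:
  assumes S: "open S" and "CR_on S f" "CR_on S g"
  shows "CR_on S (\<lambda>p. f p * g p)"
  unfolding CR_on_def
proof (intro conjI ballI allI Cinf_on_mult S CR_on_Cinf assms(2,3))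
  fix p v assume p: "p \<in> S"
  have d: "f differentiable (at p)" "g differentiable (at p)"
    using Cinf_on_differentiable[OF CR_on_Cinf p] assms by auto
  show "dir_deriv (0, \<i> *s v) (\<lambda>p. f p * g p) p = \<i> * dir_deriv (0, v) (\<lambda>p. f p * g p) p"
    using CR_onD[OF assms(2) p] CR_onD[OF assms(3) p] by (simp add: dir_deriv_mult[OF d] algebra_simps)
qed

lemma CR_on_complex_linear:
  assumes "CR_on S g" "p \<in> S"
  shows "dir_deriv (0, c *s v) g p = c * dir_deriv (0, v) g p"
proof -
  note d = Cinf_on_differentiable[OF CR_on_Cinf[OF assms(1)] assms(2)]
  have c: "c *s v = Re c *\<^sub>R v + Im c *\<^sub>R (\<i> *s v)"
    by (vector vec_eq_iff) (simp add: complex_eq_iff)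
  have "dir_deriv (0, c *s v) g p = dir_deriv (Re c *\<^sub>R (0, v) + Im c *\<^sub>R (0, \<i> *s v)) g p"
    by (simp add: c)
  also have "\<dots> = Re c *\<^sub>R dir_deriv (0, v) g p + Im c *\<^sub>R dir_deriv (0, \<i> *s v) g p"
    by (simp only: linear_add[OF linear_dir_deriv[OF d]] linear_scale[OF linear_dir_deriv[OF d]])
  also have "\<dots> = c * dir_deriv (0, v) g p"
    using CR_onD[OF assms] by (simp add: complex_eq_iff)
  finally show ?thesis .
qed

lemma has_derivative_section:
  assumes "g differentiable (at (y, \<zeta>))"
  shows "((\<lambda>\<zeta>. g (y, \<zeta>)) has_derivative (\<lambda>v. dir_deriv (0, v) g (y, \<zeta>))) (at \<zeta>)"
proof -
  have "((\<lambda>\<zeta>. (y, \<zeta>)) has_derivative (\<lambda>v. (0, v))) (at \<zeta>)"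
    by (intro has_derivative_Pair has_derivative_const has_derivative_ident)
  from has_derivative_compose[OF this has_derivative_dir_deriv[OF assms]] show ?thesis .
qed

lemma CR_on_imp_holo_snd_on: "CR_on (W \<times> W2) g \<Longrightarrow> holo_snd_on W W2 g"
  unfolding holo_snd_on_def holo_on_def
proof (intro ballI)
  fix y \<zeta> assume g: "CR_on (W \<times> W2) g" and "y \<in> W" "\<zeta> \<in> W2"
  then have p: "(y, \<zeta>) \<in> W \<times> W2" by simp
  show "\<exists>D. ((\<lambda>\<zeta>. g (y, \<zeta>)) has_derivative D) (at \<zeta>) \<and> (\<forall>c v. D (c *s v) = c * D v)"
    using has_derivative_section[OF Cinf_on_differentiable[OF CR_on_Cinf[OF g] p]]
      CR_on_complex_linear[OF g p]
    by (intro exI[of _ "\<lambda>v. dir_deriv (0, v) g (y, \<zeta>)"] conjI allI)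
qed

lemma CM_holo_on_imp_CR_on:
  assumes "CM_holo_on M W W2 g"
  shows "CR_on (W \<times> W2) g"
proof -
  have g: "Cinf_on (W \<times> W2) g" "holo_snd_on W W2 g" using assms unfolding CM_holo_on_def by auto
  have "dir_deriv (0, \<i> *s v) g (y, \<zeta>) = \<i> * dir_deriv (0, v) g (y, \<zeta>)" if p: "y \<in> W" "\<zeta> \<in> W2" for y \<zeta> v
  proof -
    obtain D where D: "((\<lambda>\<zeta>. g (y, \<zeta>)) has_derivative D) (at \<zeta>)" "\<And>c v. D (c *s v) = c * D v"
      using g(2)[unfolded holo_snd_on_def holo_on_def, rule_format, OF p] by auto
    have "((\<lambda>\<zeta>. g (y, \<zeta>)) has_derivative (\<lambda>v. dir_deriv (0, v) g (y, \<zeta>))) (at \<zeta>)"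
      using Cinf_on_differentiable[OF g(1)] p by (intro has_derivative_section) auto
    then have "D = (\<lambda>v. dir_deriv (0, v) g (y, \<zeta>))" using D(1) has_derivative_unique by blast
    then show ?thesis using D(2) by metis
  qed
  then show ?thesis using g(1) unfolding CR_on_def by auto
qed

lemma norm_vec_smult: "norm (c *s v) = norm c * norm v" for v :: "complex ^ 'm"
  by (simp add: norm_vec_def norm_mult L2_set_right_distrib)

lemma linear_snd_smult: "linear (\<lambda>z. (0 :: 'y::real_vector, z *s v))" for v :: "complex ^ 'm"
  by (rule linearI) (simp_all add: vec_eq_iff algebra_simps)

text \<open>Cauchy's inequality in one variable, applied on the complex line through
  \<open>p\<close> in the direction \<open>v\<close>.\<close>

lemma Cauchy_dir_deriv:
  assumes S: "open S" and g: "CR_on S g" and r: "r > 0"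
    and X: "\<And>z. norm z \<le> r \<Longrightarrow> p + (0, z *s v) \<in> S"
      "\<And>z. norm z \<le> r \<Longrightarrow> norm (g (p + (0, z *s v))) \<le> X"
  shows "norm (dir_deriv (0, v) g p) \<le> X / r"
proof -
  define \<phi> where "\<phi> z = g (p + (0, z *s v))" for z
  have der: "(\<phi> has_field_derivative dir_deriv (0, v) g (p + (0, z *s v))) (at z)" if "norm z \<le> r" for z
  proof -
    note q = X(1)[OF that]
    have "((\<lambda>z. p + (0, z *s v)) has_derivative (\<lambda>z. 0 + (0, z *s v))) (at z)"
      by (intro has_derivative_add has_derivative_const linear_imp_has_derivative linear_snd_smult)
    then have "((\<lambda>z. p + (0, z *s v)) has_derivative (\<lambda>z. (0, z *s v))) (at z)" by simp
    from has_derivative_compose[OF this has_derivative_dir_deriv[OF Cinf_on_differentiable[OF CR_on_Cinf[OF g] q]]]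
    have "(\<phi> has_derivative (\<lambda>c. dir_deriv (0, c *s v) g (p + (0, z *s v)))) (at z)"
      unfolding \<phi>_def .
    then show ?thesis
      using CR_on_complex_linear[OF g q] by (simp add: has_field_derivative_def mult_commute_abs)
  qed
  have "\<phi> holomorphic_on ball 0 r"
    unfolding holomorphic_on_open[OF open_ball] using der by (metis dist_0_norm less_imp_le mem_ball)
  moreover have "continuous_on (cball 0 r) \<phi>"
    using der by (auto intro!: continuous_at_imp_continuous_on DERIV_isCont)
  ultimately have "norm ((deriv ^^ 1) \<phi> 0) \<le> fact 1 * X / r ^ 1"
    using r X(2) by (intro Cauchy_inequality) (auto simp: \<phi>_def)
  moreover have "deriv \<phi> 0 = dir_deriv (0, v) g p"
    using DERIV_imp_deriv[OF der[of 0]] r by (simp flip: zero_prod_def)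
  ultimately show ?thesis by simp
qed

section \<open>Cauchy estimates for iterated derivatives\<close>

definition thicken :: "'a::metric_space set \<Rightarrow> real \<Rightarrow> 'a set" where
  "thicken K s = (\<Union>q\<in>K. cball q s)"

lemma thicken_add: "p \<in> thicken K s \<Longrightarrow> dist p q \<le> r \<Longrightarrow> q \<in> thicken K (s + r)"
  unfolding thicken_def by (auto simp: mem_cball) (meson add_mono dist_triangle_le order_trans dist_triangle)

lemma subset_thicken: "s \<ge> 0 \<Longrightarrow> K \<subseteq> thicken K s"
  unfolding thicken_def by auto

lemma thicken_mono: "s \<le> s' \<Longrightarrow> thicken K s \<subseteq> thicken K s'"
  unfolding thicken_def by (auto simp: mem_cball)

lemma compact_thicken:
  fixes K :: "'a::euclidean_space set"
  assumes "compact K"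
  shows "compact (thicken K s)"
proof -
  have "thicken K s = {x + y |x y. x \<in> K \<and> y \<in> cball 0 s}"
  proof (intro set_eqI iffI)
    fix p assume "p \<in> thicken K s"
    then obtain q where "q \<in> K" "dist q p \<le> s" unfolding thicken_def by auto
    then show "p \<in> {x + y |x y. x \<in> K \<and> y \<in> cball 0 s}"
      unfolding mem_Collect_eq by (intro exI[of _ q] exI[of _ "p - q"]) (auto simp: dist_norm norm_minus_commute)
  next
    fix p assume "p \<in> {x + y |x y. x \<in> K \<and> y \<in> cball 0 s}"
    then obtain x y where "p = x + y" "x \<in> K" "norm y \<le> s" by auto
    then show "p \<in> thicken K s"
      unfolding thicken_def by (auto intro!: bexI[of _ x] simp: dist_norm)
  qed
  then show ?thesis using compact_sums[OF assms compact_cball[of 0 s]] by simp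
qed

text \<open>Each derivative costs room \<open>r\<close> in the thickening. With \<open>r = R / l\<close> for words of length \<open>l\<close>
  the total loss is \<open>l ^ l / R ^ l\<close>, which is of factorial size.\<close>

lemma iterated_Cauchy:
  fixes g :: "'y::euclidean_space \<times> (complex ^ 'm) \<Rightarrow> complex" and s R r :: real
  assumes S: "open S" and g: "CR_on S g" and r: "r > 0"
    and KS: "thicken K R \<subseteq> S" and X: "\<And>p. p \<in> thicken K R \<Longrightarrow> norm (g p) \<le> X"
    and w: "\<And>e. e \<in> set w \<Longrightarrow> \<exists>v. e = (0, v) \<and> norm v = 1"
    and "s + length w * r \<le> R" "p \<in> thicken K s"
  shows "norm (wderiv w g p) \<le> X / r ^ length w"
  using w assms(7,8)
proof (induction w arbitrary: s p)
  case Nil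
  then have "p \<in> thicken K R" using thicken_mono[of s R K] by auto
  then show ?case using X by simp
next
  case (Cons e w)
  obtain v where v: "e = (0, v)" "norm v = 1" using Cons.prems(1)[of e] by auto
  have q: "p + (0, z *s v) \<in> thicken K (s + r)" if "norm z \<le> r" for z
  proof (rule thicken_add[OF Cons.prems(3)])
    show "dist p (p + (0, z *s v)) \<le> r"
      using that v(2) by (simp add: dist_norm norm_Pair norm_vec_smult)
  qed
  have le: "s + r + length w * r \<le> R" using Cons.prems(2) by (simp add: algebra_simps)
  then have "s + r \<le> R" using r by (smt (verit) mult_nonneg_nonneg of_nat_0_le_iff)
  then have "thicken K (s + r) \<subseteq> S" using KS thicken_mono by blast
  then have "norm (dir_deriv (0, v) (wderiv w g) p) \<le> (X / r ^ length w) / r"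
    using q Cons.IH[OF _ le] Cons.prems(1)
    by (intro Cauchy_dir_deriv[OF S CR_on_wderiv[OF S g] r]) auto
  then show ?case by (simp add: v(1) mult.commute)
qed

text \<open>The quotient of \<open>n ^ n\<close> by \<open>fact n\<close> is a single term of the
  exponential series at \<open>n\<close>.\<close>

lemma power_self_le_exp_fact: "real n ^ n \<le> exp 1 ^ n * fact n"
proof -
  have "real n ^ n / fact n = (\<Sum>k\<in>{n}. real n ^ k /\<^sub>R fact k)" by (simp add: divide_inverse)
  also have "\<dots> \<le> (\<Sum>k. real n ^ k /\<^sub>R fact k)"
    by (rule sum_le_suminf) (use summable_exp_generic[of "real n"] in \<open>auto simp: mult.commute\<close>)
  also have "\<dots> = exp (real n)" by (simp add: exp_def)
  also have "\<dots> = exp 1 ^ n" using exp_of_nat_mult[of n "1::real"] by simp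
  finally show ?thesis by (simp add: divide_simps)
qed

section \<open>From multi-indices to words of directions\<close>

lemma mi_deriv_fst_eq_wderiv:
  "mi_deriv_fst \<alpha> g = wderiv (concat (map (\<lambda>e. replicate (\<alpha> e) (e, 0)) basis_enum)) g"
proof -
  have "foldr (\<lambda>e. dir_deriv (e, 0) ^^ \<alpha> e) es g = wderiv (concat (map (\<lambda>e. replicate (\<alpha> e) (e, 0)) es)) g" for es
  proof (induction es)
    case (Cons e es)
    have "(dir_deriv (e, 0) ^^ n) h = wderiv (replicate n (e, 0)) h" for n h
      by (induction n) auto
    with Cons show ?case by (simp add: wderiv_append)
  qed simp
  then show ?thesis unfolding mi_deriv_fst_def by blast
qed

lemma basis_enum: "distinct (basis_enum :: 'a::euclidean_space list)" "set (basis_enum :: 'a list) = Basis"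
proof -
  have "\<exists>es :: 'a list. distinct es \<and> set es = Basis"
    using finite_distinct_list[OF finite_Basis] by blast
  from someI_ex[OF this] show "distinct (basis_enum :: 'a::euclidean_space list)" "set (basis_enum :: 'a list) = Basis"
    unfolding basis_enum_def by blast+
qed

lemma mset_concat_replicate_basis_enum:
  fixes w :: "('a::euclidean_space \<times> 'c::real_vector) list"
  assumes "set w \<subseteq> Basis \<times> {0}"
  shows "mset (concat (map (\<lambda>e. replicate (count_list w (e, 0)) (e, 0)) basis_enum)) = mset w"
proof (rule multiset_eqI)
  fix p :: "'a \<times> 'c"
  obtain e z where p: "p = (e, z)" by fastforce
  have "count (mset (concat (map (\<lambda>e. replicate (\<alpha> e) (e, 0)) es))) p = (if z = 0 \<and> e \<in> set es then \<alpha> e else 0)"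
    if "distinct es" for es :: "'a list" and \<alpha>
    using that by (induction es) (auto simp: p)
  from this[OF basis_enum(1)]
  show "count (mset (concat (map (\<lambda>e. replicate (count_list w (e, 0)) (e, 0)) basis_enum))) p = count (mset w) p"
    using assms by (auto simp: basis_enum(2) p count_mset count_list_0_iff)
qed

text \<open>The multi-index counts how often each letter occurs; the order of the letters is
  immaterial by \<open>wderiv_permute\<close>.\<close>

lemma wderiv_eq_mi_deriv_fst:
  fixes g :: "'a::euclidean_space \<times> 'c::real_normed_vector \<Rightarrow> 'b::real_inner"
  assumes "open S" "Cinf_on S g" "set w \<subseteq> Basis \<times> {0}"
  obtains \<alpha> where "mi_size \<alpha> = length w" "\<And>p. p \<in> S \<Longrightarrow> wderiv w g p = mi_deriv_fst \<alpha> g p"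
proof
  define \<alpha> where "\<alpha> e = count_list w (e, 0)" for e
  note m = mset_concat_replicate_basis_enum[OF assms(3)]
  show "mi_size \<alpha> = length w"
    using arg_cong[OF m, of size] basis_enum(1)
    by (simp add: mi_size_def \<alpha>_def length_concat comp_def sum_list_distinct_conv_sum_set[OF basis_enum(1)] basis_enum(2))
  show "wderiv w g p = mi_deriv_fst \<alpha> g p" if "p \<in> S" for p
    unfolding mi_deriv_fst_eq_wderiv \<alpha>_def using wderiv_permute[OF assms(1,2) m[symmetric] that] .
qed

context regular_seq
begin

text \<open>The class only bounds derivatives in the first variable. A word is sorted so that these
  act first; the result still satisfies the Cauchy-Riemann equations, so the remaining derivatives
  in \<open>\<zeta>\<close> follow from its size by Cauchy.\<close>

lemma CM_holo_on_wbound: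
  fixes g :: "'a::euclidean_space \<times> (complex ^ 'm) \<Rightarrow> complex"
  assumes g: "CM_holo_on M W W2 g" and W: "open W" "open W2" and K: "compact K" "K \<subseteq> W \<times> W2"
  shows "\<exists>A\<ge>1. \<forall>k. wbound K g k (A ^ (k + 1) * M k)"
proof -
  let ?S = "W \<times> W2"
  have S: "open ?S" using W by (rule open_Times)
  note CR = CM_holo_on_imp_CR_on[OF g]
  \<comment> \<open>Cauchy's estimates use values off \<open>K\<close>, so the bound of the class is
    taken on a thickened compact set.\<close>
  obtain R where R: "R > 0" "thicken K R \<subseteq> ?S"
    using compact_subset_open_imp_cball_epsilon_subset[OF K(1) S K(2)] unfolding thicken_def by blast
  obtain A0 where A0: "A0 > 0" "\<And>\<alpha> p. p \<in> thicken K R \<Longrightarrow> norm (mi_deriv_fst \<alpha> g p) \<le> A0 ^ (mi_size \<alpha> + 1) * M (mi_size \<alpha>)"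
    using g[unfolded CM_holo_on_def, THEN conjunct2, THEN conjunct2, rule_format, of "thicken K R"]
      compact_thicken[OF K(1), of R] R(2) by auto
  define A where "A = max 1 (max A0 (exp 1 / R))"
  have "norm (wderiv w g p) \<le> A ^ (length w + 1) * M (length w)" if w: "set w \<subseteq> Basis" and p: "p \<in> K" for w p
  proof -
    define wx where "wx = filter (\<lambda>e. snd e = 0) w"
    define wz where "wz = filter (\<lambda>e. snd e \<noteq> 0) w"
    have len: "length w = length wx + length wz"
      unfolding wx_def wz_def by (rule sum_length_filter_compl[symmetric])
    have mset: "mset w = mset (wz @ wx)" unfolding wx_def wz_def by simp
    have pS: "p \<in> ?S" using p K by blast
    have eq: "wderiv w g p = wderiv wz (wderiv wx g) p"
      using wderiv_permute[OF S CR_on_Cinf[OF CR] mset pS] by (simp add: wderiv_append)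
    have "set wx \<subseteq> Basis \<times> {0}"
      using w unfolding wx_def Basis_prod_def by auto
    then obtain \<alpha> where \<alpha>: "mi_size \<alpha> = length wx" "\<And>p. p \<in> ?S \<Longrightarrow> wderiv wx g p = mi_deriv_fst \<alpha> g p"
      using wderiv_eq_mi_deriv_fst[OF S CR_on_Cinf[OF CR]] by blast
    have X: "norm (wderiv wx g q) \<le> A0 ^ (length wx + 1) * M (length wx)" if "q \<in> thicken K R" for q
      using A0(2)[OF that, of \<alpha>] \<alpha> that R(2) by auto
    define l where "l = length wz"
    have "norm (wderiv wz (wderiv wx g) p) \<le> (A0 ^ (length wx + 1) * M (length wx)) * ((exp 1 / R) ^ l * fact l)"
    proof (cases "l = 0")
      case True
      then show ?thesis using X[of p] p subset_thicken[of R K] R(1) by (auto simp: l_def)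
    next
      case False
      define r where "r = R / l"
      have r: "r > 0" using False R(1) by (simp add: r_def)
      have "norm (wderiv wz (wderiv wx g) p) \<le> (A0 ^ (length wx + 1) * M (length wx)) / r ^ length wz"
      proof (rule iterated_Cauchy[OF S CR_on_wderiv[OF S CR] r R(2) X])
        show "\<exists>v. e = (0, v) \<and> norm v = 1" if "e \<in> set wz" for e
          using that w unfolding wz_def Basis_prod_def by (auto simp: norm_Basis)
        show "0 + real (length wz) * r \<le> R" using False by (simp add: r_def l_def)
        show "p \<in> thicken K 0" using subset_thicken[of 0 K] p by auto
      qed
      also have "1 / r ^ length wz = real l ^ l / R ^ l" by (simp add: r_def l_def power_divide)
      then have "(A0 ^ (length wx + 1) * M (length wx)) / r ^ length wz = (A0 ^ (length wx + 1) * M (length wx)) * (real l ^ l / R ^ l)"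
        by (metis mult.right_neutral times_divide_eq_right)
      also have "\<dots> \<le> (A0 ^ (length wx + 1) * M (length wx)) * ((exp 1 / R) ^ l * fact l)"
        using power_self_le_exp_fact[of l] A0(1) R(1)
        by (intro mult_left_mono) (auto simp: power_divide divide_right_mono less_imp_le)
      finally show ?thesis .
    qed
    also have "\<dots> = A0 ^ (length wx + 1) * (exp 1 / R) ^ l * (M (length wx) * fact l)" by (simp only: mult_ac)
    also have "\<dots> \<le> A ^ (length wx + 1) * A ^ l * M (length wx + l)"
      using A0(1) R(1) M_fact_le[of "length wx" l]
      by (intro mult_mono power_mono) (auto simp: A_def intro: less_imp_le)
    also have "\<dots> = A ^ (length w + 1) * M (length w)" by (simp add: len l_def power_add mult_ac)
    finally show ?thesis using eq by simp
  qed
  then show ?thesis unfolding wbound_def by (intro exI[of _ A]) (auto simp: A_def)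
qed

end

section \<open>A smooth cutoff\<close>

text \<open>The functions p(1/x) exp(-1/x), extended by 0 to x \<le> 0. The family is closed under
  differentiation, which acts on the polynomial as \<open>flat_step\<close>; smoothness then follows
  by induction.\<close>

definition poly_flat :: "real poly \<Rightarrow> real \<Rightarrow> real" where
  "poly_flat p x = (if x > 0 then poly p (1 / x) * exp (- 1 / x) else 0)"

definition flat_step :: "real poly \<Rightarrow> real poly" where
  "flat_step p = [:0, 0, 1:] * (p - pderiv p)"

lemma tendsto_poly_exp: "((\<lambda>y. poly p y * exp (- y)) \<longlongrightarrow> 0) at_top" for p :: "real poly"
proof -
  have "((\<lambda>y. \<Sum>i\<le>degree p. coeff p i * (y ^ i / exp y)) \<longlongrightarrow> (\<Sum>i\<le>degree p. coeff p i * 0)) at_top"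
    by (intro tendsto_sum tendsto_mult tendsto_const tendsto_power_div_exp_0)
  then show ?thesis
    by (simp add: poly_altdef sum_distrib_right exp_minus divide_inverse mult.assoc)
qed

lemma poly_flat_has_derivative: "(poly_flat p has_real_derivative poly_flat (flat_step p) x) (at x)"
proof (cases "x = 0")
  case False
  show ?thesis
  proof (cases "x > 0")
    case True
    have "((\<lambda>x. poly p (1 / x) * exp (- 1 / x)) has_real_derivative poly_flat (flat_step p) x) (at x)"
      using True unfolding poly_flat_def flat_step_def
      by (auto intro!: derivative_eq_intros simp: field_simps power2_eq_square)
    then show ?thesis
      by (rule has_field_derivative_transform_within_open[of _ _ _ "{0<..}"])
        (use True in \<open>auto simp: poly_flat_def\<close>)
  next
    case neg: False
    have "((\<lambda>_. 0) has_real_derivative poly_flat (flat_step p) x) (at x)"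
      using neg by (auto simp: poly_flat_def)
    then show ?thesis
      by (rule has_field_derivative_transform_within_open[of _ _ _ "{..<0}"])
        (use False neg in \<open>auto simp: poly_flat_def\<close>)
  qed
next
  case True
  have "((\<lambda>h. poly_flat p h / h) \<longlongrightarrow> 0) (at_right 0)"
  proof -
    \<comment> \<open>In the difference quotient at 0 the division by \<open>h\<close> multiplies
      the polynomial by its variable.\<close>
    have "((\<lambda>h::real. poly ([:0, 1:] * p) (inverse h) * exp (- inverse h)) \<longlongrightarrow> 0) (at_right 0)"
      by (rule filterlim_compose[OF tendsto_poly_exp filterlim_inverse_at_top_right])
    then show ?thesis
      by (rule Lim_transform_eventually)
        (auto simp: eventually_at_filter poly_flat_def divide_inverse)
  qed
  moreover have "((\<lambda>h. poly_flat p h / h) \<longlongrightarrow> 0) (at_left 0)"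
    by (rule Lim_transform_eventually[OF tendsto_const])
      (auto simp: eventually_at_filter poly_flat_def)
  ultimately have "((\<lambda>h. poly_flat p h / h) \<longlongrightarrow> 0) (at 0)"
    using filterlim_split_at by blast
  then show ?thesis using True by (simp add: has_field_derivative_iff poly_flat_def)
qed

lemma Cinf_on_poly_flat_comp:
  fixes q :: "real \<Rightarrow> real"
  assumes q: "Cinf_on UNIV q"
  shows "Cinf_on UNIV (\<lambda>x. poly_flat p (q x))"
proof -
  have der: "((\<lambda>x. poly_flat p (q x)) has_derivative (\<lambda>v. dir_deriv v q x * poly_flat (flat_step p) (q x))) (at x)" for p x
    using has_derivative_compose[OF has_derivative_dir_deriv[OF Cinf_on_differentiable[OF q UNIV_I]]
        poly_flat_has_derivative[of p "q x", unfolded has_field_derivative_def]]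
    by (simp add: mult.commute)
  have "Ck_on k UNIV (\<lambda>x. poly_flat p (q x))" for k p
  proof (induction k arbitrary: p)
    case 0
    show ?case
      using has_derivative_continuous[OF der] by (simp add: continuous_at_imp_continuous_on)
  next
    case (Suc k)
    have "Ck_on k UNIV (\<lambda>x. dir_deriv v q x * poly_flat (flat_step p) (q x))" for v
      using Suc Cinf_on_dir_deriv[OF q, of v] by (intro Ck_on_mult) (auto simp: Cinf_on_def)
    then have "Ck_on k UNIV (dir_deriv v (\<lambda>x. poly_flat p (q x)))" for v
      by (rule Ck_on_cong[rotated 2]) (auto simp: dir_deriv_eqI[OF der])
    then show ?case using der by (auto simp: differentiable_def)
  qed
  then show ?thesis unfolding Cinf_on_def by blast
qed

lemma dir_deriv_ident [simp]: "dir_deriv v (\<lambda>x. x) = (\<lambda>_. v)"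
  by (rule ext) (rule dir_deriv_eqI[OF has_derivative_ident])

lemma Cinf_on_ident: "Cinf_on S (\<lambda>x. x)"
  unfolding Cinf_on_def
proof
  fix k show "Ck_on k S (\<lambda>x. x)" by (cases k) (auto simp: Ck_on_const)
qed

lemma smooth_cutoff_exists:
  obtains \<psi> :: "real \<Rightarrow> complex" where "Cinf_on UNIV \<psi>"
    "\<And>x. \<bar>x\<bar> \<le> 1 / 2 \<Longrightarrow> \<psi> x = 1" "\<And>x. 3 / 4 \<le> \<bar>x\<bar> \<Longrightarrow> \<psi> x = 0"
proof
  define \<theta> where "\<theta> = poly_flat 1"
  \<comment> \<open>\<open>\<alpha>\<close> is positive exactly for
    \<open>\<bar>x\<bar> < 3 / 4\<close> and \<open>\<beta>\<close> exactly for
    \<open>\<bar>x\<bar> > 1 / 2\<close>. These sets cover the line, so the quotient of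
    \<open>\<alpha>\<close> by \<open>\<alpha> + \<beta>\<close> is defined everywhere.\<close>
  define \<alpha> where "\<alpha> x = \<theta> (9 / 16 + (- 1) * (x * x))" for x :: real
  define \<beta> where "\<beta> x = \<theta> (x * x + (- (1 / 4)))" for x :: real
  have pos: "\<theta> x > 0" if "x > 0" for x using that by (simp add: \<theta>_def poly_flat_def)
  have zero: "\<theta> x = 0" if "x \<le> 0" for x using that by (simp add: \<theta>_def poly_flat_def)
  have nn: "\<theta> x \<ge> 0" for x using pos[of x] zero[of x] by (cases "x > 0") auto
  have nz: "\<alpha> x + \<beta> x \<noteq> 0" for x
    using pos[of "9 / 16 + (- 1) * (x * x)"] pos[of "x * x + (- (1 / 4))"]
      nn[of "9 / 16 + (- 1) * (x * x)"] nn[of "x * x + (- (1 / 4))"]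
    unfolding \<alpha>_def \<beta>_def by (cases "x * x < 9 / 16") (auto simp: add_pos_nonneg add_nonneg_pos less_imp_neq[symmetric])
  have a: "Cinf_on UNIV \<alpha>" and b: "Cinf_on UNIV \<beta>"
    unfolding \<alpha>_def \<beta>_def \<theta>_def
    by (intro Cinf_on_poly_flat_comp Cinf_on_add Cinf_on_mult Cinf_on_const Cinf_on_ident open_UNIV)+
  show "Cinf_on UNIV (\<lambda>x. complex_of_real (\<alpha> x * inverse (\<alpha> x + \<beta> x)))"
    using a b nz
    by (intro Cinf_on_bounded_linear[OF bounded_linear_of_real] Cinf_on_mult Cinf_on_inverse Cinf_on_add open_UNIV)
  show "complex_of_real (\<alpha> x * inverse (\<alpha> x + \<beta> x)) = 1" if "\<bar>x\<bar> \<le> 1 / 2" for x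
  proof -
    have "x * x \<le> 1 / 4" using power_mono[OF that, of 2] by (simp add: power2_eq_square)
    then have "\<beta> x = 0" by (simp add: \<beta>_def zero)
    then show ?thesis using nz[of x] by simp
  qed
  show "complex_of_real (\<alpha> x * inverse (\<alpha> x + \<beta> x)) = 0" if "3 / 4 \<le> \<bar>x\<bar>" for x
  proof -
    have "9 / 16 \<le> x * x" using power_mono[OF that, of 2] by (simp add: power2_eq_square)
    then have "\<alpha> x = 0" by (simp add: \<alpha>_def zero)
    then show ?thesis by simp
  qed
qed

lemma wbound_compact_support:
  fixes f :: "real \<Rightarrow> 'b::real_normed_vector"
  assumes f: "Cinf_on UNIV f" and z: "\<And>x. r < \<bar>x\<bar> \<Longrightarrow> f x = 0"
  shows "\<exists>c\<ge>0. wbound UNIV f k c"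
proof -
  let ?w = "replicate k (1::real)"
  have "compact (wderiv ?w f ` {-r..r})"
    using Cinf_on_continuous_on[OF Cinf_on_wderiv[OF f]] continuous_on_subset
    by (intro compact_continuous_image) blast+
  then obtain c where c: "\<And>x. x \<in> {-r..r} \<Longrightarrow> norm (wderiv ?w f x) \<le> c"
    by (metis bounded_iff compact_imp_bounded imageI)
  have "wderiv ?w f x = 0" if "x \<notin> {-r..r}" for x
  proof (rule wderiv_vanish[of "- {-r..r}"])
    show "f y = 0" if "y \<in> - {-r..r}" for y using that by (intro z) auto
  qed (use that in \<open>auto simp: open_Compl\<close>)
  then have "norm (wderiv ?w f x) \<le> max c 0" for x
    using c[of x] by (cases "x \<in> {-r..r}") (auto intro: max.coboundedI1)
  moreover have "w = replicate (length w) 1" if "set w \<subseteq> Basis" for w :: "real list"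
    using that by (induction w) auto
  ultimately have "wbound UNIV f k (max c 0)" unfolding wbound_def by metis
  then show ?thesis by (intro exI[of _ "max c 0"]) auto
qed

lemma wbound_ident: "wbound {-1<..<1} (\<lambda>x::real. complex_of_real x) k (if k \<le> 1 then 1 else 0)"
proof -
  have 1: "dir_deriv v (\<lambda>x::real. complex_of_real x) = (\<lambda>_. complex_of_real v)" for v
    by (auto intro!: dir_deriv_eqI bounded_linear_imp_has_derivative bounded_linear_of_real)
  show ?thesis unfolding wbound_def
  proof (intro allI impI ballI)
    fix w :: "real list" and p :: real
    assume w: "set w \<subseteq> Basis \<and> length w = k" and p: "p \<in> {-1<..<1}"
    show "norm (wderiv w complex_of_real p) \<le> (if k \<le> 1 then 1 else 0)"
    proof (cases w rule: rev_cases)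
      case Nil
      then show ?thesis using w p by auto
    next
      case (snoc w' v)
      then show ?thesis using w by (auto simp: wderiv_append wderiv_const 1)
    qed
  qed
qed

lemma Cinf_on_complex_of_real: "open S \<Longrightarrow> Cinf_on S complex_of_real"
  using Cinf_on_bounded_linear[OF bounded_linear_of_real _ Cinf_on_ident] .

lemma Cinf_on_mult_power:
  fixes \<psi> :: "real \<Rightarrow> complex"
  assumes "Cinf_on UNIV \<psi>"
  shows "Cinf_on UNIV (\<lambda>x. \<psi> x * complex_of_real x ^ k)"
proof (induction k)
  case (Suc k)
  from Cinf_on_mult[OF open_UNIV Cinf_on_complex_of_real[OF open_UNIV] this] show ?case
    by (simp add: mult_ac)
qed (use assms in simp)

text \<open>For fixed order \<open>i\<close> the bound grows only polynomially in \<open>k\<close>.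
  This is due to the support inside \<open>\<bar>x\<bar> < 1\<close>, where multiplication by
  \<open>x\<close> does not increase the size.\<close>

lemma wbound_cutoff_power:
  fixes \<psi> :: "real \<Rightarrow> complex"
  assumes \<psi>: "Cinf_on UNIV \<psi>" and z: "\<And>x. 3 / 4 \<le> \<bar>x\<bar> \<Longrightarrow> \<psi> x = 0"
  obtains c :: "nat \<Rightarrow> real" where "\<And>i. c i \<ge> 0"
    "\<And>k i. wbound UNIV (\<lambda>x. \<psi> x * complex_of_real x ^ k) i (c i * (real k + 1) ^ i)"
proof -
  note pw = Cinf_on_mult_power[OF \<psi>]
  obtain b where b: "\<And>i. b i \<ge> 0" "\<And>i. wbound UNIV \<psi> i (b i)"
    using wbound_compact_support[OF \<psi>, of "3 / 4"] z by (metis less_imp_le)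
  \<comment> \<open>Partial sums make the constants monotone in the order, so that one order less
    can be bounded by the same constant.\<close>
  define c where "c i = (\<Sum>j\<le>i. b j)" for i
  have c0: "c i \<ge> 0" for i unfolding c_def by (intro sum_nonneg b)
  have "b i \<le> c i" for i unfolding c_def using b by (intro member_le_sum) auto
  then have bc: "wbound UNIV \<psi> i (c i)" for i using b(2) wbound_mono by blast
  have "wbound UNIV (\<lambda>x. \<psi> x * complex_of_real x ^ k) i (c i * (real k + 1) ^ i)" for k i
  proof (induction k arbitrary: i)
    case 0
    then show ?case using bc by simp
  next
    case (Suc k)
    let ?F = "\<lambda>j. if j \<le> Suc 0 then 1 else (0::real)"
    have sub: "wbound {-1<..<1} (\<lambda>x. \<psi> x * complex_of_real x ^ k) j (c j * (real k + 1) ^ j)" for j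
      using Suc.IH[of j] unfolding wbound_def by blast
    have "wbound {-1<..<1} (\<lambda>x. complex_of_real x * (\<psi> x * complex_of_real x ^ k)) i
       (\<Sum>j\<le>i. real (i choose j) * ?F j * (c (i - j) * (real k + 1) ^ (i - j)))"
      using wbound_ident sub by (intro wbound_mult Cinf_on_complex_of_real Cinf_on_subset[OF pw]) auto
    moreover have "(\<Sum>j\<le>i. real (i choose j) * ?F j * (c (i - j) * (real k + 1) ^ (i - j))) \<le> c i * (real (Suc k) + 1) ^ i"
    proof (cases i)
      case (Suc n)
      have "(\<Sum>j\<le>i. real (i choose j) * ?F j * (c (i - j) * (real k + 1) ^ (i - j)))
        = (\<Sum>j\<in>{0, 1}. real (i choose j) * ?F j * (c (i - j) * (real k + 1) ^ (i - j)))"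
        by (rule sum.mono_neutral_right) (auto simp: Suc)
      also have "\<dots> = c i * (real k + 1) ^ i + i * (c n * (real k + 1) ^ n)" by (simp add: Suc)
      also have "\<dots> \<le> c i * (real k + 1) ^ i + i * (c i * (real k + 1) ^ n)"
        using b by (intro add_left_mono mult_left_mono mult_right_mono) (auto simp: c_def Suc)
      also have "\<dots> = c i * ((real k + 1) ^ i + i * (real k + 1) ^ n)" by (simp only: distrib_left mult.left_commute)
      also have "\<dots> \<le> c i * (real (Suc k) + 1) ^ i"
      proof (intro mult_left_mono c0)
        \<comment> \<open>The left side consists of the two leading terms of the binomial expansion
          of \<open>((k + 1) + 1) ^ Suc n\<close>.\<close>
        have "(real k + 1) ^ n * (1 + real k) + real (Suc n) * (real k + 1) ^ n \<le> (real k + 2) ^ Suc n"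
        proof (induction n)
          case (Suc n)
          have "(real k + 1) ^ Suc n * (1 + real k) + real (Suc (Suc n)) * (real k + 1) ^ Suc n
            = (real k + 1) * ((real k + 1) ^ n * (1 + real k) + real (Suc n) * (real k + 1) ^ n) + (real k + 1) ^ Suc n"
            by (simp add: algebra_simps)
          also have "\<dots> \<le> (real k + 1) * (real k + 2) ^ Suc n + (real k + 2) ^ Suc n"
            using Suc by (intro add_mono mult_left_mono power_mono) auto
          also have "\<dots> = (real k + 2) ^ Suc (Suc n)" by (simp add: algebra_simps)
          finally show ?case .
        qed simp
        then show "(real k + 1) ^ i + i * (real k + 1) ^ n \<le> (real (Suc k) + 1) ^ i"
          by (simp add: Suc mult_ac add_ac)
      qed
      finally show ?thesis by simp
    qed (simp add: c0)
    ultimately have "wbound {-1<..<1} (\<lambda>x. complex_of_real x * (\<psi> x * complex_of_real x ^ k)) i (c i * (real (Suc k) + 1) ^ i)"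
      using wbound_mono by blast
    moreover have "wbound (- {-3/4..3/4}) (\<lambda>x. complex_of_real x * (\<psi> x * complex_of_real x ^ k)) i (c i * (real (Suc k) + 1) ^ i)"
      using c0 z by (intro wbound_vanish) (auto simp: open_Compl)
    ultimately have "wbound ({-1<..<1} \<union> - {-3/4..3/4}) (\<lambda>x. complex_of_real x * (\<psi> x * complex_of_real x ^ k)) i (c i * (real (Suc k) + 1) ^ i)"
      by (rule wbound_Un)
    moreover have "{-1<..<1} \<union> - {-3/4..3/4} = (UNIV :: real set)" by auto
    ultimately show ?case by (simp add: mult_ac)
  qed
  then show ?thesis using that c0 by blast
qed

section \<open>Iterates of the vector field\<close>

text \<open>All real coordinates are treated alike. The given field is the case of coefficient 1
  along \<open>t\<close> and coefficient 0 along the imaginary directions of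
  \<open>\<zeta>\<close>.\<close>

definition vop :: "('a \<Rightarrow> 'a \<Rightarrow> complex) \<Rightarrow> ('a::euclidean_space \<Rightarrow> complex) \<Rightarrow> 'a \<Rightarrow> complex" where
  "vop c g p = (\<Sum>e\<in>Basis. c e p * dir_deriv e g p)"

lemma vop_mult:
  assumes "f differentiable (at p)" "g differentiable (at p)"
  shows "vop c (\<lambda>q. f q * g q) p = vop c f p * g p + f p * vop c g p"
  unfolding vop_def
  by (simp add: dir_deriv_mult[OF assms] sum_distrib_left sum_distrib_right sum.distrib algebra_simps)

lemma CR_on_vop:
  assumes S: "open S" and "\<And>e. e \<in> Basis \<Longrightarrow> CR_on S (c e)" "CR_on S g"
  shows "CR_on S (vop c g)"
  unfolding vop_def[abs_def] by (intro CR_on_sum CR_on_mult CR_on_dir_deriv assms)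

lemma CR_on_vop_funpow:
  assumes "open S" "\<And>e. e \<in> Basis \<Longrightarrow> CR_on S (c e)" "CR_on S g"
  shows "CR_on S ((vop c ^^ q) g)"
  using assms by (induction q) (auto intro: CR_on_vop)

context regular_seq
begin

text \<open>The rate \<open>C\<close> of the coefficients is at most half the rate \<open>D\<close>
  of \<open>g\<close>, so the Leibniz sum is dominated by a geometric series and costs a factor 2
  instead of \<open>k + 1\<close>. Hence \<open>D\<close> survives every application, and only the
  constant \<open>H\<close> and the index of \<open>M\<close> move.\<close>

lemma wbound_vop:
  fixes g :: "'a::euclidean_space \<Rightarrow> complex"
  assumes S: "open S" and c: "\<And>e. e \<in> Basis \<Longrightarrow> Cinf_on S (c e)" and g: "Cinf_on S g"
    and cb: "\<And>e j. e \<in> Basis \<Longrightarrow> wbound S (c e) j (C ^ (j + 1) * M j)"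
    and gb: "\<And>j. wbound S g j (H * D ^ j * M (n + j))"
    and CD: "C \<ge> 1" "D \<ge> 2 * C" and H: "H \<ge> 0"
  shows "wbound S (vop c g) k ((H * (real DIM('a) * (2 * C * D))) * D ^ k * M (Suc n + k))"
proof -
  have D: "D > 0" using CD by linarith
  have "wbound S (\<lambda>p. c e p * dir_deriv e g p) k (H * (2 * C * D) * D ^ k * M (Suc n + k))" if e: "e \<in> Basis" for e
  proof (rule wbound_mono)
    have "wbound S (dir_deriv e g) j (H * D ^ Suc j * M (n + Suc j))" for j
      using gb[of "Suc j"] e unfolding wbound_Suc_iff by blast
    then show "wbound S (\<lambda>p. c e p * dir_deriv e g p) k
        (\<Sum>j\<le>k. real (k choose j) * (C ^ (j + 1) * M j) * (H * D ^ Suc (k - j) * M (n + Suc (k - j))))"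
      using c cb e by (intro wbound_mult[OF S] Cinf_on_dir_deriv g)
    have "(\<Sum>j\<le>k. real (k choose j) * (C ^ (j + 1) * M j) * (H * D ^ Suc (k - j) * M (n + Suc (k - j))))
       \<le> (\<Sum>j\<le>k. (H * C * D * D ^ k * M (Suc n + k)) * (1 / 2) ^ j)"
    proof (rule sum_mono)
      fix j assume "j \<in> {..k}"
      then have j: "j \<le> k" by simp
      have "real (k choose j) * (C ^ (j + 1) * M j) * (H * D ^ Suc (k - j) * M (n + Suc (k - j)))
        = (H * C * D) * (C ^ j * D ^ (k - j)) * (real (k choose j) * M j * M (Suc n + k - j))"
        using j by (simp add: Suc_diff_le mult_ac)
      also have "\<dots> \<le> (H * C * D) * ((D / 2) ^ j * D ^ (k - j)) * M (Suc n + k)"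
        using CD D H binomial_M_M_le[OF j, of "Suc n"]
        by (intro mult_mono mult_left_mono mult_right_mono power_mono) (auto intro!: mult_nonneg_nonneg intro: less_imp_le)
      also have "(D / 2) ^ j * D ^ (k - j) = D ^ k * (1 / 2) ^ j"
        using j by (simp add: power_divide flip: power_add)
      finally show "real (k choose j) * (C ^ (j + 1) * M j) * (H * D ^ Suc (k - j) * M (n + Suc (k - j)))
        \<le> (H * C * D * D ^ k * M (Suc n + k)) * (1 / 2) ^ j" by (simp add: mult_ac)
    qed
    also have "\<dots> = (H * C * D * D ^ k * M (Suc n + k)) * (\<Sum>j\<le>k. (1 / 2) ^ j)"
      by (simp add: sum_distrib_left)
    also have "\<dots> \<le> (H * C * D * D ^ k * M (Suc n + k)) * 2"
      using CD D H
      by (intro mult_left_mono mult_nonneg_nonneg)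
        (auto simp: sum_gp0 less_imp_le)
    finally show "(\<Sum>j\<le>k. real (k choose j) * (C ^ (j + 1) * M j) * (H * D ^ Suc (k - j) * M (n + Suc (k - j))))
      \<le> H * (2 * C * D) * D ^ k * M (Suc n + k)" by (simp add: mult_ac)
  qed
  then have "wbound S (vop c g) k (\<Sum>e\<in>(Basis::'a set). H * (2 * C * D) * D ^ k * M (Suc n + k))"
    unfolding vop_def[abs_def]
    by (intro wbound_sum[OF S finite_Basis] Cinf_on_mult[OF S c Cinf_on_dir_deriv[OF g]])
  then show ?thesis by (simp add: mult_ac)
qed

lemma wbound_vop_funpow:
  fixes g :: "'a::euclidean_space \<Rightarrow> complex"
  assumes S: "open S" and c: "\<And>e. e \<in> Basis \<Longrightarrow> Cinf_on S (c e)" and g: "Cinf_on S g"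
    and cb: "\<And>e j. e \<in> Basis \<Longrightarrow> wbound S (c e) j (C ^ (j + 1) * M j)"
    and gb: "\<And>j. wbound S g j (H * D ^ j * M j)"
    and CD: "C \<ge> 1" "D \<ge> 2 * C" and H: "H \<ge> 0"
  shows "wbound S ((vop c ^^ q) g) k (H * (real DIM('a) * (2 * C * D)) ^ q * D ^ k * M (q + k))"
proof (induction q arbitrary: k)
  case (Suc q)
  have "Cinf_on S ((vop c ^^ r) g)" for r
  proof (induction r)
    case (Suc r)
    then show ?case
      unfolding funpow.simps comp_def vop_def[abs_def]
      by (intro Cinf_on_sum[OF S] Cinf_on_mult[OF S c] Cinf_on_dir_deriv)
  qed (simp add: g)
  moreover have "0 \<le> H * (real DIM('a) * (2 * C * D)) ^ q" using CD H by auto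
  ultimately have "wbound S (vop c ((vop c ^^ q) g)) k
      ((H * (real DIM('a) * (2 * C * D)) ^ q) * (real DIM('a) * (2 * C * D)) * D ^ k * M (Suc q + k))"
    using Suc.IH by (intro wbound_vop[OF S c _ cb _ CD])
  then show ?case by (simp add: mult_ac)
qed (use gb in simp)

end

section \<open>The approximate solution\<close>

lemma fact_add_le: "fact (k + a) \<le> fact k * fact a * (2::real) ^ (k + a)"
proof -
  have "fact (k + a) = fact k * fact a * real (k + a choose k)"
    using binomial_fact[of k "k + a", where 'a = real] by simp
  also have "\<dots> \<le> fact k * fact a * 2 ^ (k + a)"
    using binomial_le_pow2[of "k + a" k] by (intro mult_left_mono) (auto simp flip: of_nat_power_le_of_nat_cancel_iff of_nat_le_iff)
  finally show ?thesis .
qed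

text \<open>The power is compared with the rising product of \<open>k + 1\<close> up to
  \<open>k + i\<close>. Powers of \<open>k + 1\<close> coming from derivatives of the cutoffs thus
  cost only \<open>2 ^ k\<close>.\<close>

lemma Suc_power_le: "(real k + 1) ^ i \<le> fact i * 2 ^ (k + i)"
proof -
  have "fact k * (real k + 1) ^ i \<le> fact (k + i)"
  proof (induction i)
    case (Suc i)
    have "fact k * (real k + 1) ^ Suc i = (fact k * (real k + 1) ^ i) * (real k + 1)" by simp
    also have "\<dots> \<le> fact (k + i) * (real k + real i + 1)"
      using Suc by (intro mult_mono) auto
    finally show ?case by (simp add: algebra_simps)
  qed simp
  also have "\<dots> \<le> fact k * (fact i * 2 ^ (k + i))" using fact_add_le[of k i] by (simp add: mult.assoc)
  finally show ?thesis by (simp only: mult_le_cancel_left_pos fact_gt_zero)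
qed

lemma
  fixes \<Phi> :: "real \<Rightarrow> complex"
  assumes \<Phi>: "Cinf_on UNIV \<Phi>"
  shows Cinf_on_dilation: "Cinf_on UNIV (\<lambda>t. r *\<^sub>R \<Phi> (c * t))"
    and wbound_dilation: "wbound UNIV \<Phi> i X \<Longrightarrow> wbound UNIV (\<lambda>t. r *\<^sub>R \<Phi> (c * t)) i (\<bar>r\<bar> * \<bar>c\<bar> ^ i * X)"
proof -
  have L: "bounded_linear (\<lambda>t::real. c * t)" by (rule bounded_linear_mult_right)
  have 1: "Cinf_on UNIV (\<lambda>t. \<Phi> (c * t))"
    using Cinf_on_comp_linear[OF L open_UNIV \<Phi>] by simp
  then show "Cinf_on UNIV (\<lambda>t. r *\<^sub>R \<Phi> (c * t))"
    by (intro Cinf_on_bounded_linear[OF bounded_linear_scaleR_right] open_UNIV)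
  assume b: "wbound UNIV \<Phi> i X"
  show "wbound UNIV (\<lambda>t. r *\<^sub>R \<Phi> (c * t)) i (\<bar>r\<bar> * \<bar>c\<bar> ^ i * X)"
    unfolding wbound_def
  proof (intro allI impI ballI)
    fix w :: "real list" and t :: real assume w: "set w \<subseteq> Basis \<and> length w = i"
    have "(*\<^sub>R) c = (*) c" by (simp add: fun_eq_iff)
    then have "wderiv w (\<lambda>t. \<Phi> (c * t)) t = wderiv (map ((*\<^sub>R) c) w) \<Phi> (c * t)"
      using wderiv_comp_linear[OF L open_UNIV \<Phi>, of t w] by simp
    also have "\<dots> = c ^ i *\<^sub>R wderiv w \<Phi> (c * t)"
      using wderiv_scale_directions[OF open_UNIV \<Phi>] w by simp
    finally have "norm (wderiv w (\<lambda>t. r *\<^sub>R \<Phi> (c * t)) t) = \<bar>r\<bar> * (\<bar>c\<bar> ^ i * norm (wderiv w \<Phi> (c * t)))"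
      using wderiv_scaleR[OF open_UNIV 1, of t w r] by (simp add: power_abs abs_mult)
    also have "\<dots> \<le> \<bar>r\<bar> * (\<bar>c\<bar> ^ i * X)"
      using wboundD[OF b, of w "c * t"] w by (intro mult_left_mono) auto
    finally show "norm (wderiv w (\<lambda>t. r *\<^sub>R \<Phi> (c * t)) t) \<le> \<bar>r\<bar> * \<bar>c\<bar> ^ i * X" by (simp add: mult_ac)
  qed
qed

definition signed_monom :: "nat \<Rightarrow> real \<Rightarrow> complex" where
  "signed_monom k t = complex_of_real ((- t) ^ k / fact k)"

lemma norm_signed_monom: "norm (signed_monom k t) = \<bar>t\<bar> ^ k / fact k"
  by (simp add: signed_monom_def norm_divide norm_power power_abs)

lemma signed_monom_has_derivative:
  "(signed_monom k has_derivative (\<lambda>v. v *\<^sub>R (case k of 0 \<Rightarrow> 0 | Suc j \<Rightarrow> - signed_monom j t))) (at t)"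
proof (cases k)
  case 0
  then show ?thesis by (simp add: signed_monom_def[abs_def])
next
  case (Suc j)
  have "((\<lambda>t. (- t) ^ Suc j / fact (Suc j)) has_real_derivative - ((- t) ^ j / fact j)) (at t)"
    by (rule derivative_eq_intros refl | simp)+
  then have "((\<lambda>t. (- t) ^ Suc j / fact (Suc j)) has_derivative (\<lambda>v. - ((- t) ^ j / fact j) * v)) (at t)"
    unfolding has_field_derivative_def .
  from bounded_linear.has_derivative[OF bounded_linear_of_real this]
  have "(signed_monom k has_derivative (\<lambda>v. complex_of_real (- ((- t) ^ j / fact j) * v))) (at t)"
    unfolding signed_monom_def[abs_def] Suc .
  moreover have "complex_of_real (- ((- t) ^ j / fact j) * v) = v *\<^sub>R - signed_monom j t" for v
    unfolding signed_monom_def scaleR_conv_of_real of_real_minus[symmetric] of_real_mult[symmetric]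
    by (simp only: mult.commute)
  ultimately show ?thesis by (simp add: Suc)
qed

lemma linear_time: "bounded_linear (\<lambda>p :: ('y::real_normed_vector \<times> real) \<times> 'z::real_normed_vector. snd (fst p))"
  using bounded_linear_compose[OF bounded_linear_snd bounded_linear_fst] .

lemma
  fixes \<eta> :: "real \<Rightarrow> complex"
  assumes \<eta>: "Cinf_on UNIV \<eta>"
  shows CR_on_time: "CR_on S (\<lambda>p :: ('y::euclidean_space \<times> real) \<times> (complex ^ 'm). \<eta> (snd (fst p)))"
    and wbound_time: "wbound UNIV \<eta> k X \<Longrightarrow> wbound UNIV (\<lambda>p :: ('y \<times> real) \<times> (complex ^ 'm). \<eta> (snd (fst p))) k X"
    and dir_deriv_time: "dir_deriv e (\<lambda>p :: ('y \<times> real) \<times> (complex ^ 'm). \<eta> (snd (fst p))) p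
      = snd (fst e) *\<^sub>R dir_deriv 1 \<eta> (snd (fst p))"
proof -
  note d = Cinf_on_differentiable[OF \<eta> UNIV_I]
  have dd: "dir_deriv e (\<lambda>p :: ('y \<times> real) \<times> (complex ^ 'm). \<eta> (snd (fst p))) p
      = snd (fst e) *\<^sub>R dir_deriv 1 \<eta> (snd (fst p))" for e p
    using dir_deriv_comp_linear(1)[OF linear_time d, of e p]
      linear_scale[OF linear_dir_deriv[OF d], of "snd (fst e)" 1 "snd (fst p)"] by simp
  then show "dir_deriv e (\<lambda>p :: ('y \<times> real) \<times> (complex ^ 'm). \<eta> (snd (fst p))) p
      = snd (fst e) *\<^sub>R dir_deriv 1 \<eta> (snd (fst p))" .
  have "Cinf_on UNIV (\<lambda>p :: ('y \<times> real) \<times> (complex ^ 'm). \<eta> (snd (fst p)))"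
    using Cinf_on_comp_linear[OF linear_time open_UNIV \<eta>] by simp
  then show "CR_on S (\<lambda>p :: ('y \<times> real) \<times> (complex ^ 'm). \<eta> (snd (fst p)))"
    unfolding CR_on_def using Cinf_on_subset[of UNIV _ S] by (simp add: dd)
  assume b: "wbound UNIV \<eta> k X"
  have "norm (wderiv (replicate k 1) \<eta> 0) \<le> X" using b by (rule wboundD) auto
  then have "0 \<le> X" using norm_ge_zero order_trans by blast
  then have "wbound ((\<lambda>p. snd (fst p)) -` UNIV) (\<lambda>p :: ('y \<times> real) \<times> (complex ^ 'm). \<eta> (snd (fst p))) k X"
    using b by (intro wbound_comp_linear[OF linear_time open_UNIV \<eta>]) (auto simp: Basis_prod_def)
  then show "wbound UNIV (\<lambda>p :: ('y \<times> real) \<times> (complex ^ 'm). \<eta> (snd (fst p))) k X" by simp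
qed

context regular_seq
begin

text \<open>The summand bounds a derivative of the \<open>k\<close>-th term in which
  \<open>i\<close> letters fall on the cutoff and \<open>a\<close> on the iterate. After the
  comparison below the critical radius, \<open>(8 * G / lam) ^ k\<close> remains, and
  \<open>lam \<ge> 16 * G\<close> makes it geometric.\<close>

lemma summable_cutoff_terms:
  assumes G: "G > 0" "lam \<ge> 16 * G"
  shows "summable (\<lambda>k. (crit_radius k / lam) ^ k / fact k * (real k + 1) ^ i * (lam / crit_radius k) ^ i * G ^ k * M (k + a))"
proof -
  obtain C q where Cq: "\<And>k t. k \<ge> q \<Longrightarrow> 0 < t \<Longrightarrow> t < crit_radius k \<Longrightarrow> m (k + a) * t ^ k \<le> C * t ^ i"
    using m_shift_le_below_crit_radius[of a i] by blast
  define K where "K = fact i * 2 ^ i * fact a * 2 ^ a * (lam / 2) ^ i * C"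
  have lam: "lam > 0" using G by linarith
  show ?thesis
  proof (rule summable_comparison_test[OF exI[of _ q]])
    show "summable (\<lambda>k. K * (1 / 2) ^ k)" by (intro summable_mult summable_geometric) simp
    show "\<forall>k\<ge>q. norm ((crit_radius k / lam) ^ k / fact k * (real k + 1) ^ i * (lam / crit_radius k) ^ i * G ^ k * M (k + a)) \<le> K * (1 / 2) ^ k"
    proof (intro allI impI)
      fix k assume k: "q \<le> k"
      \<comment> \<open>The comparison holds strictly below the critical radius; halving costs
        another \<open>2 ^ k\<close>.\<close>
      define t where "t = crit_radius k / 2"
      have t: "0 < t" "t < crit_radius k" using crit_radius_pos[of k] by (auto simp: t_def)
      have cr: "crit_radius k = 2 * t" by (simp add: t_def)
      have mt: "m (k + a) * t ^ k \<le> C * t ^ i" by (rule Cq[OF k t])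
      have C: "C \<ge> 0"
      proof -
        have "0 < m (k + a) * t ^ k" using t by simp
        then have "0 < C * t ^ i" using mt by linarith
        then show ?thesis using t(1) by (simp add: zero_less_mult_iff)
      qed
      let ?x = "(crit_radius k / lam) ^ k / fact k * (real k + 1) ^ i * (lam / crit_radius k) ^ i * G ^ k * M (k + a)"
      have "?x = (2 * G / lam) ^ k * (lam / 2) ^ i * (real k + 1) ^ i * (fact (k + a) / fact k) * ((m (k + a) * t ^ k) / t ^ i)"
        by (simp add: cr M_eq power_mult_distrib power_divide mult_ac)
      also have "\<dots> \<le> (2 * G / lam) ^ k * (lam / 2) ^ i * (fact i * 2 ^ (k + i)) * (fact a * 2 ^ (k + a)) * C"
      proof (intro mult_mono Suc_power_le order_refl)
        show "fact (k + a) / fact k \<le> fact a * (2::real) ^ (k + a)"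
          using fact_add_le[of k a] by (simp add: divide_simps mult_ac)
        show "m (k + a) * t ^ k / t ^ i \<le> C" using mt t(1) by (simp add: divide_simps)
      qed (use G lam t in \<open>auto intro!: mult_nonneg_nonneg divide_nonneg_nonneg intro: less_imp_le\<close>)
      also have "\<dots> = K * (8 * G / lam) ^ k"
      proof -
        have "(8 * G / lam) ^ k = (2 * G / lam) ^ k * 2 ^ k * 2 ^ k"
          unfolding power_mult_distrib[symmetric] by simp
        then show ?thesis by (simp add: K_def power_add mult_ac)
      qed
      also have "\<dots> \<le> K * (1 / 2) ^ k"
        using G lam C by (intro mult_left_mono power_mono) (auto simp: K_def divide_simps)
      finally have "?x \<le> K * (1 / 2) ^ k" .
      moreover have "?x \<ge> 0" using G lam t by (auto simp: cr intro!: mult_nonneg_nonneg divide_nonneg_nonneg less_imp_le)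
      ultimately show "norm ?x \<le> K * (1 / 2) ^ k" by simp
    qed
  qed
qed

end

context regular_seq
begin

text \<open>Bounds are assumed on all of \<open>S {-d<..<d}\<close>, not merely on its compact
  subsets, because the scales and the constants \<open>A\<close> and \<open>Q\<close> have to serve
  all points at once. Assumption \<open>c_t\<close> is the relation L t = 1.\<close>

lemma approximate_solution_exists:
  fixes c :: "('y::euclidean_space \<times> real) \<times> (complex ^ 'm) \<Rightarrow> ('y \<times> real) \<times> (complex ^ 'm) \<Rightarrow> complex"
    and f :: "('y \<times> real) \<times> (complex ^ 'm) \<Rightarrow> complex"
    and U :: "'y set" and V :: "(complex ^ 'm) set"
  defines "S \<equiv> \<lambda>I. (U \<times> I) \<times> V"
  assumes U: "open U" and V: "open V" and d: "d > 0"
    and c: "\<And>e. e \<in> Basis \<Longrightarrow> CR_on (S {-d<..<d}) (c e)"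
    and c_t: "\<And>p. c ((0, 1), 0) p = 1"
    and f: "CR_on (S {-d<..<d}) f"
    and C: "C \<ge> 1"
    and cb: "\<And>e j. e \<in> Basis \<Longrightarrow> wbound (S {-d<..<d}) (c e) j (C ^ (j + 1) * M j)"
    and fb: "\<And>j. wbound (S {-d<..<d}) f j (C ^ (j + 1) * M j)"
  shows "\<exists>u. CR_on (S UNIV) u \<and> (\<forall>x\<in>U. \<forall>\<zeta>\<in>V. u ((x, 0), \<zeta>) = f ((x, 0), \<zeta>)) \<and>
    (\<exists>A>0. \<exists>Q>0. \<forall>p\<in>S {-d<..<d}. norm (vop c u p) \<le> A * assoc_h M (Q * \<bar>snd (fst p)\<bar>))"
proof -
  let ?S0 = "S {-d<..<d}" and ?\<tau> = "\<lambda>p :: ('y \<times> real) \<times> (complex ^ 'm). snd (fst p)"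
  have S0: "open ?S0" and SU: "open (S UNIV)" unfolding S_def using U V by (auto intro!: open_Times)
  have S0_sub: "?S0 \<subseteq> S UNIV" unfolding S_def by auto
  obtain \<psi> :: "real \<Rightarrow> complex" where \<psi>: "Cinf_on UNIV \<psi>" "\<And>x. \<bar>x\<bar> \<le> 1 / 2 \<Longrightarrow> \<psi> x = 1" "\<And>x. 3 / 4 \<le> \<bar>x\<bar> \<Longrightarrow> \<psi> x = 0"
    using smooth_cutoff_exists by metis
  obtain b :: "nat \<Rightarrow> real" where b: "\<And>i. b i \<ge> 0"
    "\<And>k i. wbound UNIV (\<lambda>x. \<psi> x * complex_of_real x ^ k) i (b i * (real k + 1) ^ i)"
    using wbound_cutoff_power[OF \<psi>(1,3)] by metis
  have b\<psi>: "norm (\<psi> x) \<le> b 0" "norm (dir_deriv 1 \<psi> x) \<le> b 1" for x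
    using wboundD[OF b(2)[of 0 0], of "[]" x] wboundD[OF b(2)[of 0 1], of "[1]" x] by simp_all
  have \<psi>'0: "dir_deriv 1 \<psi> x = 0" if "\<bar>x\<bar> < 1 / 2 \<or> 3 / 4 < \<bar>x\<bar>" for x
    using that
  proof
    assume x: "\<bar>x\<bar> < 1 / 2"
    have "dir_deriv 1 \<psi> x = dir_deriv 1 (\<lambda>_. 1) x"
      by (rule dir_deriv_cong[of "{-1/2<..<1/2}"]) (use x \<psi>(2) in auto)
    then show ?thesis by simp
  next
    assume x: "3 / 4 < \<bar>x\<bar>"
    have "dir_deriv 1 \<psi> x = dir_deriv 1 (\<lambda>_. 0) x"
      by (rule dir_deriv_cong[of "- {-3/4..3/4}"]) (use x \<psi>(3) in \<open>auto simp: open_Compl\<close>)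
    then show ?thesis by simp
  qed
  obtain B where B: "B \<ge> 1" "\<And>k. ratio k \<le> B ^ k" using ratio_growth by blast

  define D where "D = 2 * C"
  define G where "G = real DIM(('y \<times> real) \<times> (complex ^ 'm)) * (2 * C * D)"
  define g where "g k = (vop c ^^ k) f" for k
  \<comment> \<open>The first summand gives \<open>16 * G\<close> for the convergence of derivatives
    and \<open>4 * B * G\<close> for the error estimate; the second gives
    \<open>s k \<le> d\<close>, so that the cutoffs live where the coefficients are
    controlled.\<close>
  define lam where "lam = 16 * B * G + 1 / d"
  define s where "s k = crit_radius k / lam" for k
  have D: "D \<ge> 1" using C by (simp add: D_def)
  have G: "G \<ge> 1"
  proof -
    have "1 \<le> DIM(('y \<times> real) \<times> (complex ^ 'm))" by (simp add: Suc_leI)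
    then have "1 * (1 * 1) \<le> real DIM(('y \<times> real) \<times> (complex ^ 'm)) * (2 * C * D)"
      using C D by (intro mult_mono) auto
    then show ?thesis by (simp add: G_def)
  qed
  have BG: "G \<le> B * G" "1 \<le> B * G"
    using mult_mono[of 1 B 1 G] mult_right_mono[OF B(1), of G] B(1) G by auto
  have lam: "lam \<ge> 16 * G" "lam \<ge> 4 * B * G" "lam \<ge> 1" "lam \<ge> 1 / d" "lam > 0"
    using BG divide_pos_pos[OF zero_less_one d] unfolding lam_def mult.assoc by linarith+
  have s: "s k > 0" "s (Suc k) \<le> s k" for k
    using lam(5) crit_radius_Suc_le[of k] by (auto simp: s_def divide_right_mono)
  have s_le: "s k \<le> d" for k
  proof -
    have "s k \<le> 1 / lam" using crit_radius_le_1[of k] lam(5) by (simp add: s_def divide_right_mono)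
    also have "\<dots> \<le> d" using lam(4,5) d by (simp add: divide_simps mult.commute)
    finally show ?thesis .
  qed
  have s_lim: "s \<longlonglongrightarrow> 0"
    unfolding s_def using tendsto_divide[OF crit_radius_tendsto_0 tendsto_const, of lam] lam(5) by simp

  have gCR: "CR_on ?S0 (g k)" for k
    unfolding g_def by (rule CR_on_vop_funpow[OF S0 c f])
  have gb: "wbound ?S0 (g k) j (C * G ^ k * D ^ j * M (k + j))" for k j
    unfolding g_def G_def
  proof (rule wbound_vop_funpow[OF S0 CR_on_Cinf[OF c] CR_on_Cinf[OF f] cb])
    show "wbound ?S0 f j (C * D ^ j * M j)" for j
    proof (rule wbound_mono[OF fb])
      have "C ^ j \<le> D ^ j" using C by (intro power_mono) (auto simp: D_def)
      then show "C ^ (j + 1) * M j \<le> C * D ^ j * M j"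
        using C by (simp add: less_imp_le)
    qed
  qed (use C in \<open>auto simp: D_def\<close>)

  define \<eta> where "\<eta> k t = \<psi> (1 / s k * t) * signed_monom k t" for k t
  \<comment> \<open>Written as a dilation, the cutoff monomial is a scalar times a fixed profile, to
    which \<open>wbound_cutoff_power\<close> applies.\<close>
  have \<eta>_eq: "\<eta> k = (\<lambda>t. ((- s k) ^ k / fact k) *\<^sub>R (\<psi> (1 / s k * t) * complex_of_real (1 / s k * t) ^ k))" for k
  proof
    fix t
    have "(- s k) ^ k * (1 / s k * t) ^ k = (- t) ^ k"
      unfolding power_mult_distrib[symmetric] using s(1)[of k] by simp
    then have "signed_monom k t = ((- s k) ^ k / fact k) *\<^sub>R complex_of_real (1 / s k * t) ^ k"
      unfolding signed_monom_def scaleR_conv_of_real of_real_power[symmetric] of_real_mult[symmetric]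
      by (simp only: times_divide_eq_left)
    then show "\<eta> k t = ((- s k) ^ k / fact k) *\<^sub>R (\<psi> (1 / s k * t) * complex_of_real (1 / s k * t) ^ k)"
      by (simp add: \<eta>_def)
  qed
  note cut = Cinf_on_mult_power[OF \<psi>(1)]
  have \<eta>C: "Cinf_on UNIV (\<eta> k)" for k
    unfolding \<eta>_eq by (rule Cinf_on_dilation[OF cut])
  have \<eta>b: "wbound UNIV (\<eta> k) i (s k ^ k / fact k * (1 / s k) ^ i * (b i * (real k + 1) ^ i))" for k i
    using wbound_dilation[OF cut b(2), of "(- s k) ^ k / fact k" "1 / s k" k i] s(1)[of k]
    unfolding \<eta>_eq by (simp add: power_abs)
  have \<eta>0: "\<eta> k t = 0" if "3 / 4 * s k \<le> \<bar>t\<bar>" for k t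
  proof -
    have "3 / 4 \<le> \<bar>1 / s k * t\<bar>" using that s(1)[of k] by (simp add: abs_mult divide_simps)
    then show ?thesis by (simp add: \<eta>_def \<psi>(3))
  qed

  define h where "h k p = \<eta> k (?\<tau> p) * g k p" for k p
  \<comment> \<open>The iterates \<open>g k\<close> are controlled only for
    \<open>\<bar>t\<bar> < d\<close>. On \<open>T k\<close> the cutoff makes \<open>h k\<close>
    vanish, and together the two open sets cover all times.\<close>
  define T where "T k = {p \<in> S UNIV. 3 / 4 * s k < \<bar>?\<tau> p\<bar>}" for k
  have T: "open (T k)" for k
  proof -
    have "open ({p :: ('y \<times> real) \<times> (complex ^ 'm). 3 / 4 * s k < \<bar>?\<tau> p\<bar>})"
      by (intro open_Collect_less continuous_intros)
    then have "open (S UNIV \<inter> {p. 3 / 4 * s k < \<bar>?\<tau> p\<bar>})" using SU by (rule open_Int[rotated])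
    then show ?thesis by (simp add: T_def Collect_conj_eq)
  qed
  have cover: "S UNIV \<subseteq> ?S0 \<union> T k" for k
  proof
    fix p assume p: "p \<in> S UNIV"
    show "p \<in> ?S0 \<union> T k"
    proof (cases "3 / 4 * s k < \<bar>?\<tau> p\<bar>")
      case False
      then have "\<bar>?\<tau> p\<bar> < d" using s(1)[of k] s_le[of k] by linarith
      then show ?thesis using p unfolding S_def by (cases p) auto
    qed (use p in \<open>auto simp: T_def\<close>)
  qed
  have hT: "h k p = 0" if "p \<in> T k" for k p
    using that \<eta>0[of k "?\<tau> p"] by (simp add: T_def h_def)
  have hCR: "CR_on (S UNIV) (h k)" for k
  proof (rule CR_on_subset[OF CR_on_Un[OF S0 T] cover])
    show "CR_on ?S0 (h k)"
      unfolding h_def[abs_def] by (intro CR_on_mult S0 CR_on_time \<eta>C gCR)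
    show "CR_on (T k) (h k)" by (rule CR_on_cong[OF T _ CR_on_const[of _ 0]]) (simp add: hT)
  qed
  define X where "X n k = (\<Sum>i\<le>n. real (n choose i) * (s k ^ k / fact k * (1 / s k) ^ i * (b i * (real k + 1) ^ i))
    * (C * G ^ k * D ^ (n - i) * M (k + (n - i))))" for n k
  have X0: "0 \<le> X n k" for n k
    unfolding X_def using b(1) s(1) C D G
    by (intro sum_nonneg mult_nonneg_nonneg divide_nonneg_nonneg zero_le_power) (auto intro: less_imp_le)
  have hb: "wbound (S UNIV) (h k) n (X n k)" for n k
  proof (rule wbound_subset[OF wbound_Un cover])
    show "wbound ?S0 (h k) n (X n k)"
      unfolding X_def h_def[abs_def]
      by (intro wbound_mult S0 CR_on_Cinf[OF CR_on_time] CR_on_Cinf[OF gCR] gb \<eta>C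
          wbound_subset[OF wbound_time[OF \<eta>C \<eta>b] subset_UNIV])
    show "wbound (T k) (h k) n (X n k)" by (rule wbound_vanish[OF T hT X0])
  qed
  have Xs: "summable (X n)" for n
    unfolding X_def
  proof (intro summable_sum)
    fix i
    have "summable (\<lambda>k. (real (n choose i) * b i * C * D ^ (n - i)) *
      ((crit_radius k / lam) ^ k / fact k * (real k + 1) ^ i * (lam / crit_radius k) ^ i * G ^ k * M (k + (n - i))))"
      using G lam(1) by (intro summable_mult summable_cutoff_terms) auto
    then show "summable (\<lambda>k. real (n choose i) * (s k ^ k / fact k * (1 / s k) ^ i * (b i * (real k + 1) ^ i))
      * (C * G ^ k * D ^ (n - i) * M (k + (n - i))))"
      by (simp add: s_def mult_ac)
  qed
  define u where "u p = (\<Sum>k. h k p)" for p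
  note hC = CR_on_Cinf[OF hCR]
  have uC: "Cinf_on (S UNIV) u"
    unfolding u_def[abs_def] by (rule Cinf_on_suminf[OF SU hC hb Xs])
  have us: "(\<lambda>k. dir_deriv e (h k) p) sums dir_deriv e u p" if p: "p \<in> S UNIV" for e p
  proof -
    have B: "(\<lambda>k. dir_deriv b (h k) p) sums dir_deriv b u p" if "b \<in> Basis" for b
      using wderiv_suminf[OF SU hC hb Xs, of "[b]" p] summable_wderiv[OF SU hC hb Xs, of "[b]" p] that p
      unfolding u_def[abs_def] by (simp add: summable_sums)
    have "(\<lambda>k. \<Sum>b\<in>Basis. (e \<bullet> b) *\<^sub>R dir_deriv b (h k) p) sums (\<Sum>b\<in>Basis. (e \<bullet> b) *\<^sub>R dir_deriv b u p)"
      by (intro sums_sum sums_scaleR_right B)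
    then show ?thesis
      by (simp only: dir_deriv_basis_expansion[OF Cinf_on_differentiable[OF hC p], symmetric]
          dir_deriv_basis_expansion[OF Cinf_on_differentiable[OF uC p], symmetric])
  qed
  have uCR: "CR_on (S UNIV) u"
    unfolding CR_on_def
  proof (intro conjI ballI allI uC)
    fix p v assume p: "p \<in> S UNIV"
    have "(\<lambda>k. \<i> * dir_deriv (0, v) (h k) p) sums (\<i> * dir_deriv (0, v) u p)"
      by (intro sums_mult us p)
    moreover have "(\<lambda>k. \<i> * dir_deriv (0, v) (h k) p) sums dir_deriv (0, \<i> *s v) u p"
      using us[OF p, of "(0, \<i> *s v)"] CR_onD[OF hCR p] by simp
    ultimately show "dir_deriv (0, \<i> *s v) u p = \<i> * dir_deriv (0, v) u p" by (metis sums_unique2)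
  qed
  \<comment> \<open>At \<open>t = 0\<close> only the monomial of index 0 is nonzero, with value 1,
    and the cutoff equals 1.\<close>
  have u0: "u ((x, 0), \<zeta>) = f ((x, 0), \<zeta>)" for x \<zeta>
  proof -
    have "h k ((x, 0), \<zeta>) = (if k = 0 then f ((x, 0), \<zeta>) else 0)" for k
      by (simp add: h_def \<eta>_def \<psi>(2) signed_monom_def g_def)
    then show ?thesis unfolding u_def using suminf_finite[of "{0}" "\<lambda>k. h k ((x, 0), \<zeta>)"] by simp
  qed

  \<comment> \<open>In the telescoping sum, \<open>signed_monom k * g (Suc k)\<close> arises from
    the term \<open>k\<close> with the cutoff of scale \<open>s k\<close> and, with opposite sign,
    from the term \<open>Suc k\<close> with that of scale \<open>s (Suc k)\<close>. Their difference
    and the derivative of the cutoff are all that remains.\<close>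
  define E where "E k p = (1 / s k) *\<^sub>R dir_deriv 1 \<psi> (1 / s k * ?\<tau> p) * signed_monom k (?\<tau> p) * g k p
    + (\<psi> (1 / s k * ?\<tau> p) - \<psi> (1 / s (Suc k) * ?\<tau> p)) * (signed_monom k (?\<tau> p) * g (Suc k) p)" for k p
  have vop_h: "vop c (h k) p = (1 / s k) *\<^sub>R dir_deriv 1 \<psi> (1 / s k * ?\<tau> p) * signed_monom k (?\<tau> p) * g k p
      + \<psi> (1 / s k * ?\<tau> p) * (signed_monom k (?\<tau> p) * g (Suc k) p
        - (case k of 0 \<Rightarrow> 0 | Suc j \<Rightarrow> signed_monom j (?\<tau> p) * g k p))" if p: "p \<in> ?S0" for k p
  proof -
    let ?t = "?\<tau> p"
    have L: "bounded_linear (\<lambda>t::real. 1 / s k * t)" by (rule bounded_linear_mult_right)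
    have \<psi>d: "\<psi> differentiable (at (1 / s k * ?t))" using Cinf_on_differentiable[OF \<psi>(1)] by blast
    have "dir_deriv 1 (\<lambda>t. \<psi> (1 / s k * t)) ?t = (1 / s k) *\<^sub>R dir_deriv 1 \<psi> (1 / s k * ?t)"
      using dir_deriv_comp_linear(1)[OF L \<psi>d, of 1] linear_scale[OF linear_dir_deriv[OF \<psi>d], of "1 / s k" 1]
      by simp
    moreover have "dir_deriv 1 (signed_monom k) ?t = (case k of 0 \<Rightarrow> 0 | Suc j \<Rightarrow> - signed_monom j ?t)"
      using dir_deriv_eqI[OF signed_monom_has_derivative, of 1 k ?t] by simp
    moreover have "signed_monom k differentiable (at ?t)"
      using signed_monom_has_derivative unfolding differentiable_def by blast
    ultimately have \<eta>': "dir_deriv 1 (\<eta> k) ?t = (1 / s k) *\<^sub>R dir_deriv 1 \<psi> (1 / s k * ?t) * signed_monom k ?t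
        + \<psi> (1 / s k * ?t) * (case k of 0 \<Rightarrow> 0 | Suc j \<Rightarrow> - signed_monom j ?t)"
      unfolding \<eta>_def[abs_def] using dir_deriv_comp_linear(2)[OF L \<psi>d] by (simp add: dir_deriv_mult)
    have "vop c (\<lambda>q. \<eta> k (?\<tau> q)) p = (\<Sum>e\<in>(Basis :: (('y \<times> real) \<times> (complex ^ 'm)) set). if e = ((0, 1), 0) then dir_deriv 1 (\<eta> k) ?t else 0)"
      unfolding vop_def
    proof (rule sum.cong[OF refl])
      fix e :: "('y \<times> real) \<times> (complex ^ 'm)" assume "e \<in> Basis"
      then show "c e p * dir_deriv e (\<lambda>q. \<eta> k (?\<tau> q)) p = (if e = ((0, 1), 0) then dir_deriv 1 (\<eta> k) ?t else 0)"
        unfolding dir_deriv_time[OF \<eta>C] by (auto simp: Basis_prod_def c_t)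
    qed
    also have "\<dots> = dir_deriv 1 (\<eta> k) ?t" by (simp add: Basis_prod_def image_iff)
    finally have "vop c (h k) p = dir_deriv 1 (\<eta> k) ?t * g k p + \<eta> k ?t * g (Suc k) p"
      unfolding h_def[abs_def]
      using Cinf_on_differentiable[OF CR_on_Cinf[OF CR_on_time[OF \<eta>C]] p] Cinf_on_differentiable[OF CR_on_Cinf[OF gCR] p]
      by (subst vop_mult) (auto simp: g_def)
    then show ?thesis unfolding \<eta>' \<eta>_def by (auto simp: algebra_simps split: nat.split)
  qed
  have partial: "(\<Sum>k\<le>N. vop c (h k) p) = (\<Sum>k\<le>N. E k p) + \<psi> (1 / s (Suc N) * ?\<tau> p) * (signed_monom N (?\<tau> p) * g (Suc N) p)"
    if "p \<in> ?S0" for N p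
    by (induction N) (simp_all add: vop_h[OF that] E_def algebra_simps)
  \<comment> \<open>In the base \<open>4 * B * G\<close>, the iterates contribute \<open>G\<close>,
    and \<open>2 * B\<close> pays either for \<open>1 / s k\<close> or for passing from
    \<open>M (Suc k) / fact k\<close> to \<open>m k\<close>. The last factor 2 provides the
    geometric decay in \<open>k\<close>.\<close>
  obtain A Q where AQ: "A > 0" "Q > 0"
    "\<And>k t. 0 < t \<Longrightarrow> lam * t < crit_radius k \<Longrightarrow> crit_radius (Suc k) \<le> 2 * lam * t
      \<Longrightarrow> (4 * B * G) ^ k * m k * t ^ k \<le> A * assoc_h M (Q * t)"
    using monomial_le_assoc_h[of "4 * B * G" lam] BG lam(2) by auto
  define K where "K = b 1 * lam * C + 2 * b 0 * (C * G)"
  have K: "K \<ge> 0" using b(1) C G lam(5) by (simp add: K_def)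
  have E_bound: "norm (E k p) \<le> K * A * (1 / 2) ^ k * assoc_h M (Q * \<bar>?\<tau> p\<bar>)" if p: "p \<in> ?S0" for k p
  proof -
    let ?t = "\<bar>?\<tau> p\<bar>"
    define q where "q = (2 * B * G) ^ k * m k * ?t ^ k"
    have q0: "q \<ge> 0" using B(1) G by (simp add: q_def less_imp_le)
    show ?thesis
    proof (cases "?t < s k \<and> s (Suc k) \<le> 2 * ?t")
      case True
      then have t0: "?t > 0" using s(1)[of "Suc k"] by linarith
      have "lam * ?t < crit_radius k" "crit_radius (Suc k) \<le> 2 * lam * ?t"
        using True lam(5) by (auto simp: s_def divide_simps mult_ac)
      then have "(4 * B * G) ^ k * m k * ?t ^ k \<le> A * assoc_h M (Q * ?t)" by (rule AQ(3)[OF t0])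
      moreover have "(4 * B * G) ^ k = 2 ^ k * (2 * B * G) ^ k"
        unfolding power_mult_distrib[symmetric] by (simp add: mult.assoc)
      ultimately have "2 ^ k * q \<le> A * assoc_h M (Q * ?t)"
        unfolding q_def by (simp only: mult.assoc)
      then have q: "q \<le> A * (1 / 2) ^ k * assoc_h M (Q * ?t)"
        by (simp add: power_one_over divide_simps mult_ac)
      have gk: "norm (g k p) \<le> C * G ^ k * M k" "norm (g (Suc k) p) \<le> C * G ^ Suc k * M (Suc k)"
        using wboundD[OF gb[of k 0], of "[]" p] wboundD[OF gb[of "Suc k" 0], of "[]" p] p by auto
      have inv_s: "1 / s k \<le> lam * (2 * B) ^ k"
      proof -
        have "1 / (2 ^ k * B ^ k) \<le> 1 / (2 ^ k * ratio k)"
          using B(1) B(2)[of k] by (intro divide_left_mono mult_left_mono mult_pos_pos) auto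
        also have "\<dots> \<le> crit_radius k" by (rule crit_radius_ge)
        finally show ?thesis
          using B(1) lam(5) crit_radius_pos[of k] unfolding s_def
          by (simp add: divide_simps power_mult_distrib mult_ac)
      qed
      have "norm ((1 / s k) *\<^sub>R dir_deriv 1 \<psi> (1 / s k * ?\<tau> p) * signed_monom k (?\<tau> p) * g k p)
        = (1 / s k) * norm (dir_deriv 1 \<psi> (1 / s k * ?\<tau> p)) * (?t ^ k / fact k) * norm (g k p)"
        using s(1)[of k] by (simp add: norm_mult norm_signed_monom)
      also have "\<dots> \<le> (lam * (2 * B) ^ k) * b 1 * (?t ^ k / fact k) * (C * G ^ k * M k)"
        using inv_s b\<psi>(2) gk(1) s(1)[of k] lam(5) B(1) b(1)[of 1]
        by (intro mult_mono) (auto intro!: mult_nonneg_nonneg)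
      also have "\<dots> = (b 1 * lam * C) * q"
        by (simp add: M_eq q_def power_mult_distrib)
      finally have 1: "norm ((1 / s k) *\<^sub>R dir_deriv 1 \<psi> (1 / s k * ?\<tau> p) * signed_monom k (?\<tau> p) * g k p)
        \<le> (b 1 * lam * C) * q" .
      have MSuc: "M (Suc k) / fact k \<le> (2 * B) ^ k * m k"
      proof -
        have "real (Suc k) \<le> 2 ^ k"
          using less_exp[of k] by (metis Suc_leI of_nat_le_iff of_nat_numeral of_nat_power)
        then have "real (Suc k) * ratio k \<le> 2 ^ k * B ^ k"
          using B(2)[of k] by (intro mult_mono) (auto intro: less_imp_le)
        then have "real (Suc k) * ratio k * m k \<le> (2 * B) ^ k * m k"
          by (intro mult_right_mono) (auto simp: power_mult_distrib intro: less_imp_le)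
        moreover have "M (Suc k) / fact k = real (Suc k) * ratio k * m k"
          by (simp add: M_eq m_Suc)
        ultimately show ?thesis by simp
      qed
      have "norm ((\<psi> (1 / s k * ?\<tau> p) - \<psi> (1 / s (Suc k) * ?\<tau> p)) * (signed_monom k (?\<tau> p) * g (Suc k) p))
        = norm (\<psi> (1 / s k * ?\<tau> p) - \<psi> (1 / s (Suc k) * ?\<tau> p)) * (?t ^ k / fact k * norm (g (Suc k) p))"
        by (simp add: norm_mult norm_signed_monom)
      also have "\<dots> \<le> (b 0 + b 0) * (?t ^ k / fact k * (C * G ^ Suc k * M (Suc k)))"
        using b\<psi>(1) gk(2) b(1)[of 0]
        by (intro mult_mono mult_left_mono norm_triangle_le_diff add_mono) auto
      also have "\<dots> = (2 * b 0) * (C * G ^ Suc k * ?t ^ k) * (M (Suc k) / fact k)" by simp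
      also have "\<dots> \<le> (2 * b 0) * (C * G ^ Suc k * ?t ^ k) * ((2 * B) ^ k * m k)"
        using MSuc b(1)[of 0] C G by (intro mult_left_mono) auto
      also have "\<dots> = 2 * b 0 * (C * G) * q"
        by (simp add: q_def power_mult_distrib)
      finally have 2: "norm ((\<psi> (1 / s k * ?\<tau> p) - \<psi> (1 / s (Suc k) * ?\<tau> p)) * (signed_monom k (?\<tau> p) * g (Suc k) p))
        \<le> 2 * b 0 * (C * G) * q" .
      have "norm (E k p) \<le> K * q"
        unfolding E_def K_def distrib_right by (rule norm_triangle_mono[OF 1 2])
      also have "\<dots> \<le> K * (A * (1 / 2) ^ k * assoc_h M (Q * ?t))" using q K by (rule mult_left_mono)
      finally show ?thesis by (simp add: mult_ac)
    next
      case False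
      have "E k p = 0"
      proof (cases "?t < s k")
        case True
        then have t: "?t < s (Suc k) / 2" using False by simp
        have "\<bar>1 / s k * ?\<tau> p\<bar> < 1 / 2" "\<bar>1 / s (Suc k) * ?\<tau> p\<bar> < 1 / 2"
          using t s(1)[of k] s(1)[of "Suc k"] s(2)[of k] by (auto simp: abs_mult divide_simps)
        then show ?thesis unfolding E_def using \<psi>(2) \<psi>'0 by simp
      next
        case False
        then have t: "s k \<le> ?t" "s (Suc k) \<le> ?t" using s(2)[of k] by auto
        have "3 / 4 < \<bar>1 / s k * ?\<tau> p\<bar>" "3 / 4 < \<bar>1 / s (Suc k) * ?\<tau> p\<bar>"
          using t s(1)[of k] s(1)[of "Suc k"] by (auto simp: abs_mult divide_simps)
        then show ?thesis unfolding E_def using \<psi>(3) \<psi>'0 by simp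
      qed
      then show ?thesis using K AQ(1) assoc_h_nonneg by simp
    qed
  qed
  have "norm (vop c u p) \<le> (2 * K * A + 1) * assoc_h M (Q * \<bar>?\<tau> p\<bar>)" if p: "p \<in> ?S0" for p
  proof -
    have pU: "p \<in> S UNIV" using p S0_sub by blast
    let ?H = "assoc_h M (Q * \<bar>?\<tau> p\<bar>)"
    have "(\<lambda>k. vop c (h k) p) sums vop c u p"
      unfolding vop_def by (intro sums_sum sums_mult us pU)
    then have lim: "(\<lambda>N. \<Sum>k\<le>N. vop c (h k) p) \<longlonglongrightarrow> vop c u p"
      by (simp add: sums_def_le)
    have "\<forall>\<^sub>F N in sequentially. \<psi> (1 / s (Suc N) * ?\<tau> p) * (signed_monom N (?\<tau> p) * g (Suc N) p) = 0"
    proof (cases "?\<tau> p = 0")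
      \<comment> \<open>At \<open>t = 0\<close> every cutoff equals 1, so here it is the monomial
        that vanishes, from \<open>N = 1\<close> on. The bound to be shown is 0 at such points, as
        \<open>assoc_h M 0 = 0\<close>.\<close>
      case True
      then show ?thesis
        by (intro eventually_sequentiallyI[of 1]) (simp add: signed_monom_def)
    next
      case False
      have "\<forall>\<^sub>F N in sequentially. s (Suc N) < \<bar>?\<tau> p\<bar>"
        using False by (intro order_tendstoD[OF LIMSEQ_Suc[OF s_lim]]) auto
      then show ?thesis
      proof (rule eventually_mono)
        fix N assume "s (Suc N) < \<bar>?\<tau> p\<bar>"
        then have "3 / 4 \<le> \<bar>1 / s (Suc N) * ?\<tau> p\<bar>"
          using s(1)[of "Suc N"] by (simp add: abs_mult divide_simps)
        then show "\<psi> (1 / s (Suc N) * ?\<tau> p) * (signed_monom N (?\<tau> p) * g (Suc N) p) = 0"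
          by (simp add: \<psi>(3))
      qed
    qed
    then have "\<forall>\<^sub>F N in sequentially. norm (\<Sum>k\<le>N. vop c (h k) p) \<le> (2 * K * A) * ?H"
    proof (rule eventually_mono)
      fix N assume z: "\<psi> (1 / s (Suc N) * ?\<tau> p) * (signed_monom N (?\<tau> p) * g (Suc N) p) = 0"
      have "norm (\<Sum>k\<le>N. vop c (h k) p) \<le> (\<Sum>k\<le>N. K * A * ?H * (1 / 2) ^ k)"
        unfolding partial[OF p] z using E_bound[OF p] by (auto intro!: sum_norm_le simp: mult_ac)
      also have "\<dots> = K * A * ?H * (\<Sum>k\<le>N. (1 / 2) ^ k)" by (simp add: sum_distrib_left)
      also have "\<dots> \<le> K * A * ?H * 2"
        using K AQ(1) assoc_h_nonneg by (intro mult_left_mono) (auto simp: sum_gp0)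
      finally show "norm (\<Sum>k\<le>N. vop c (h k) p) \<le> (2 * K * A) * ?H" by (simp add: mult_ac)
    qed
    then have "norm (vop c u p) \<le> (2 * K * A) * ?H"
      using tendsto_upperbound[OF tendsto_norm[OF lim]] by simp
    then show ?thesis using assoc_h_nonneg[of "Q * \<bar>?\<tau> p\<bar>"] by (simp add: algebra_simps)
  qed
  \<comment> \<open>The summand 1 only ensures a positive constant, since \<open>K\<close> may be
    0.\<close>
  moreover have "2 * K * A + 1 > 0" using K AQ(1) by (simp add: add_nonneg_pos)
  ultimately show ?thesis
    using uCR u0 AQ(2) by (intro exI[of _ u] conjI exI[of _ "2 * K * A + 1"] exI[of _ Q]) auto
qed

end

section \<open>Application to the given vector field and datum\<close>

lemma (in regular_seq) wbound_mono_rate: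
  assumes "wbound S g k (A ^ (k + 1) * M k)" "1 \<le> A" "A \<le> B"
  shows "wbound S g k (B ^ (k + 1) * M k)"
proof (rule wbound_mono[OF assms(1)])
  show "A ^ (k + 1) * M k \<le> B ^ (k + 1) * M k"
    using assms(2,3) power_mono[of A B "k + 1"] by (intro mult_right_mono) (auto intro: less_imp_le)
qed

lemma bounded_linear_drop_time:
  "bounded_linear (\<lambda>p :: ('y::real_normed_vector \<times> real) \<times> 'z::real_normed_vector. (fst (fst p), snd p))"
  by (intro bounded_linear_Pair bounded_linear_snd bounded_linear_compose[OF bounded_linear_fst bounded_linear_fst])

lemma CR_on_drop_time:
  fixes f :: "'y::euclidean_space \<times> (complex ^ 'm) \<Rightarrow> complex"
  assumes S: "open S" and f: "CR_on S f"
  shows "CR_on ((\<lambda>p :: ('y \<times> real) \<times> (complex ^ 'm). (fst (fst p), snd p)) -` S) (\<lambda>p. f (fst (fst p), snd p))"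
proof -
  note F = CR_on_Cinf[OF f]
  have "dir_deriv e (\<lambda>p :: ('y \<times> real) \<times> (complex ^ 'm). f (fst (fst p), snd p)) p
      = dir_deriv (fst (fst e), snd e) f (fst (fst p), snd p)" if "(fst (fst p), snd p) \<in> S" for e p
    using dir_deriv_comp_linear(1)[OF bounded_linear_drop_time Cinf_on_differentiable[OF F that]] .
  then show ?thesis
    unfolding CR_on_def using Cinf_on_comp_linear[OF bounded_linear_drop_time S F] CR_onD[OF f] by simp
qed

theorem theorem3p6:
  fixes M :: "nat \<Rightarrow> real"
    and \<Omega>1 :: "(real ^ 'n) set" and I :: "real set" and \<Omega>2 :: "(complex ^ 'm) set"
    and a :: "'n \<Rightarrow> ((real ^ 'n) \<times> real) \<times> (complex ^ 'm) \<Rightarrow> complex"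
    and b :: "'m \<Rightarrow> ((real ^ 'n) \<times> real) \<times> (complex ^ 'm) \<Rightarrow> complex"
    and f :: "(real ^ 'n) \<times> (complex ^ 'm) \<Rightarrow> complex"
    and U :: "(real ^ 'n) set" and V :: "(complex ^ 'm) set"
  assumes "regular_sequence M"
    and "open \<Omega>1" "0 \<in> \<Omega>1"
    and "open I" "is_interval I" "0 \<in> I"
    and "open \<Omega>2"
    and "\<And>i. CM_holo_on M (\<Omega>1 \<times> I) \<Omega>2 (a i)"
    and "\<And>j. CM_holo_on M (\<Omega>1 \<times> I) \<Omega>2 (b j)"
    and "CM_holo_on M \<Omega>1 \<Omega>2 f"
    and "open U" "0 \<in> U" "compact (closure U)" "closure U \<subseteq> \<Omega>1"
    and "open V" "0 \<in> V" "compact (closure V)" "closure V \<subseteq> \<Omega>2"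
  shows "\<exists>u :: ((real ^ 'n) \<times> real) \<times> (complex ^ 'm) \<Rightarrow> complex.
      Cinf_on ((U \<times> UNIV) \<times> V) u \<and>
      holo_snd_on (U \<times> UNIV) V u \<and>
      (\<exists>A>0. \<exists>Q>0. \<exists>\<delta>>0. {-\<delta><..<\<delta>} \<subseteq> I \<and>
         (\<forall>x\<in>U. \<forall>t\<in>{-\<delta><..<\<delta>}. \<forall>\<zeta>\<in>V.
            norm (vfield a b u ((x, t), \<zeta>)) \<le> A * assoc_h M (Q * \<bar>t\<bar>))) \<and>
      (\<forall>x\<in>U. \<forall>\<zeta>\<in>V. u ((x, 0), \<zeta>) = f (x, \<zeta>)) \<and>
      approx_solution M I a b U V f u"
proof -
  interpret regular_seq M by unfold_locales (rule assms(1))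
  obtain d where d: "d > 0" "{-d..d} \<subseteq> I"
    using open_contains_cball[of I] assms(4,6) by (auto simp: cball_eq_atLeastAtMost)
  define S where "S J = (U \<times> J) \<times> V" for J :: "real set"
  let ?S0 = "S {-d<..<d}"
  \<comment> \<open>The class gives bounds on compact sets only. Relative compactness of
    \<open>U\<close> and \<open>V\<close> places the whole domain of the estimate inside this
    one.\<close>
  define K where "K = (closure U \<times> {-d..d}) \<times> closure V"
  have S0: "open ?S0" unfolding S_def using assms(11,15) by (intro open_Times) auto
  have K: "compact K" unfolding K_def using assms(13,17) by (intro compact_Times) auto
  have K_sub: "K \<subseteq> (\<Omega>1 \<times> I) \<times> \<Omega>2" unfolding K_def using assms(14,18) d(2) by blast
  have S0_sub: "?S0 \<subseteq> K" unfolding S_def K_def using closure_subset[of U] closure_subset[of V] by auto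
  have CR: "CR_on ?S0 g" if "CM_holo_on M (\<Omega>1 \<times> I) \<Omega>2 g" for g
    using CM_holo_on_imp_CR_on[OF that] CR_on_subset S0_sub K_sub by blast
  have W: "open (\<Omega>1 \<times> I)" using assms(2,4) by (rule open_Times)
  have bound: "\<exists>A\<ge>1. \<forall>k. wbound ?S0 g k (A ^ (k + 1) * M k)" if "CM_holo_on M (\<Omega>1 \<times> I) \<Omega>2 g" for g
    using CM_holo_on_wbound[OF that W assms(7) K K_sub] wbound_subset[OF _ S0_sub] by blast
  obtain Aa where Aa: "\<And>i. Aa i \<ge> 1" "\<And>i k. wbound ?S0 (a i) k (Aa i ^ (k + 1) * M k)"
    using bound[OF assms(8)] by metis
  obtain Ab where Ab: "\<And>j. Ab j \<ge> 1" "\<And>j k. wbound ?S0 (b j) k (Ab j ^ (k + 1) * M k)"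
    using bound[OF assms(9)] by metis
  have "compact (closure U \<times> closure V)" "closure U \<times> closure V \<subseteq> \<Omega>1 \<times> \<Omega>2"
    using assms(13,14,17,18) by (auto intro: compact_Times)
  then obtain Af where Af: "Af \<ge> 1" "\<And>k. wbound (closure U \<times> closure V) f k (Af ^ (k + 1) * M k)"
    using CM_holo_on_wbound[OF assms(10,2,7)] by blast

  define A where "A = (\<Sum>i\<in>UNIV. Aa i) + (\<Sum>j\<in>UNIV. Ab j) + Af"
  have sums0: "0 \<le> (\<Sum>i\<in>UNIV. Aa i)" "0 \<le> (\<Sum>j\<in>UNIV. Ab j)"
    using Aa(1) Ab(1) order_trans[OF zero_le_one] by (auto intro!: sum_nonneg)
  have "Aa i \<le> (\<Sum>i\<in>UNIV. Aa i)" "Ab j \<le> (\<Sum>j\<in>UNIV. Ab j)" for i j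
    using Aa(1) Ab(1) order_trans[OF zero_le_one] by (auto intro!: member_le_sum)
  then have A: "1 \<le> A" "Aa i \<le> A" "Ab j \<le> A" "Af \<le> A" for i j
    using sums0 Af(1) Aa(1) Ab(1) unfolding A_def by (smt (verit))+
  \<comment> \<open>\<open>N\<close> is the number of terms in the coefficient \<open>c e\<close>
    below, each bounded at rate \<open>A\<close>. As \<open>N \<ge> 1\<close>, the factor
    \<open>N\<close> fits into \<open>C ^ (k + 1)\<close>.\<close>
  define N where "N = 1 + (real CARD('n) + real CARD('m))"
  define C where "C = N * A"
  have N: "N \<ge> 1" by (simp add: N_def)
  have AC: "A \<le> C" using mult_right_mono[OF N, of A] A(1) by (simp add: C_def)

  let ?X = "\<lambda>i. ((axis i 1, 0), 0) :: ('n, 'm) pt" and ?Z = "\<lambda>j. (0, axis j 1) :: ('n, 'm) pt"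
  \<comment> \<open>The field as a family over the real basis. Along \<open>\<zeta>\<close> only the
    real direction of each coordinate carries a coefficient; on functions satisfying the
    Cauchy-Riemann equations it acts as the complex derivative.\<close>
  define c where "c e p = (if e = ((0, 1), 0) then 1 else 0) +
    ((\<Sum>i\<in>UNIV. if e = ?X i then a i p else 0) + (\<Sum>j\<in>UNIV. if e = ?Z j then b j p else 0))"
    for e p :: "('n, 'm) pt"
  have c_t: "c ((0, 1), 0) p = 1" for p
  proof -
    have "((0, 1), 0) \<noteq> ?X i" "((0, 1), 0) \<noteq> ?Z j" for i j by auto
    then show ?thesis by (simp add: c_def)
  qed
  have term_a: "CR_on ?S0 (\<lambda>p. if e = ?X i then a i p else 0)"
      "wbound ?S0 (\<lambda>p. if e = ?X i then a i p else 0) k (A ^ (k + 1) * M k)" for e i k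
    using CR[OF assms(8)] wbound_mono_rate[OF Aa(2) Aa(1) A(2)] A(1)
    by (cases "e = ?X i"; simp add: CR_on_const wbound_vanish[OF S0] less_imp_le)+
  have term_b: "CR_on ?S0 (\<lambda>p. if e = ?Z j then b j p else 0)"
      "wbound ?S0 (\<lambda>p. if e = ?Z j then b j p else 0) k (A ^ (k + 1) * M k)" for e j k
    using CR[OF assms(9)] wbound_mono_rate[OF Ab(2) Ab(1) A(3)] A(1)
    by (cases "e = ?Z j"; simp add: CR_on_const wbound_vanish[OF S0] less_imp_le)+
  have term_1: "wbound ?S0 (\<lambda>_ :: ('n, 'm) pt. x) k (A ^ (k + 1) * M k)" if "x = 0 \<or> x = 1" for x :: complex and k
    using that A(1) M_eq[of 0] unfolding wbound_def wderiv_const by (auto simp: less_imp_le)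
  have c_CR: "CR_on ?S0 (c e)" for e
    unfolding c_def[abs_def] by (intro CR_on_add CR_on_sum S0 term_a term_b CR_on_const)
  have c_bound: "wbound ?S0 (c e) k (C ^ (k + 1) * M k)" for e k
  proof (rule wbound_mono)
    show "wbound ?S0 (c e) k (A ^ (k + 1) * M k
        + ((\<Sum>i\<in>(UNIV :: 'n set). A ^ (k + 1) * M k) + (\<Sum>j\<in>(UNIV :: 'm set). A ^ (k + 1) * M k)))"
      unfolding c_def[abs_def]
      by (intro wbound_add wbound_sum S0 term_a(2) term_b(2) term_1 CR_on_Cinf[OF term_a(1)] CR_on_Cinf[OF term_b(1)]
          Cinf_on_add Cinf_on_sum Cinf_on_const) auto
    have "A ^ (k + 1) * M k + ((\<Sum>i\<in>(UNIV :: 'n set). A ^ (k + 1) * M k) + (\<Sum>j\<in>(UNIV :: 'm set). A ^ (k + 1) * M k))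
      = N * (A ^ (k + 1) * M k)"
      by (simp add: N_def distrib_right)
    also have "\<dots> \<le> N ^ (k + 1) * (A ^ (k + 1) * M k)"
      using N A(1) self_le_power[of N "k + 1"] by (intro mult_right_mono) (auto simp: less_imp_le)
    also have "\<dots> = C ^ (k + 1) * M k"
      unfolding C_def power_mult_distrib by (simp only: mult.assoc)
    finally show "A ^ (k + 1) * M k + ((\<Sum>i\<in>(UNIV :: 'n set). A ^ (k + 1) * M k) + (\<Sum>j\<in>(UNIV :: 'm set). A ^ (k + 1) * M k))
      \<le> C ^ (k + 1) * M k" .
  qed

  define F where "F p = f (fst (fst p), snd p)" for p :: "('n, 'm) pt"
  let ?P = "\<lambda>p :: ('n, 'm) pt. (fst (fst p), snd p)"
  have UV: "open (U \<times> V)" using assms(11,15) by (rule open_Times)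
  have pre: "?S0 \<subseteq> ?P -` (U \<times> V)" by (auto simp: S_def)
  have fUV: "CR_on (U \<times> V) f"
    using order_trans[OF closure_subset assms(14)] order_trans[OF closure_subset assms(18)]
    by (intro CR_on_subset[OF CM_holo_on_imp_CR_on[OF assms(10)]] Sigma_mono)
  have F_CR: "CR_on ?S0 F"
    unfolding F_def[abs_def] by (rule CR_on_subset[OF CR_on_drop_time[OF UV fUV] pre])
  have F_bound: "wbound ?S0 F k (C ^ (k + 1) * M k)" for k
  proof -
    have "wbound (U \<times> V) f k (C ^ (k + 1) * M k)"
      by (intro wbound_subset[OF wbound_mono_rate[OF Af(2) Af(1) order_trans[OF A(4) AC]]] Sigma_mono closure_subset)
    then have "wbound (?P -` (U \<times> V)) F k (C ^ (k + 1) * M k)"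
      unfolding F_def[abs_def]
      by (rule wbound_comp_linear[OF bounded_linear_drop_time UV CR_on_Cinf[OF fUV], rotated 2])
        (use A(1) AC in \<open>auto simp: Basis_prod_def zero_prod_def less_imp_le\<close>)
    then show ?thesis using wbound_subset pre by blast
  qed

  obtain u A' Q where u: "CR_on (S UNIV) u" "\<And>x \<zeta>. x \<in> U \<Longrightarrow> \<zeta> \<in> V \<Longrightarrow> u ((x, 0), \<zeta>) = F ((x, 0), \<zeta>)"
    and AQ: "A' > 0" "Q > 0" "\<And>p. p \<in> ?S0 \<Longrightarrow> norm (vop c u p) \<le> A' * assoc_h M (Q * \<bar>snd (fst p)\<bar>)"
    using approximate_solution_exists[of U V d c F C, folded S_def, OF assms(11,15) d(1) c_CR c_t F_CR order_trans[OF A(1) AC] c_bound F_bound]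
    by blast
  have vop_eq: "vop c u p = vfield a b u p" if "p \<in> ?S0" for p
  proof -
    have p: "p \<in> S UNIV" using that by (auto simp: S_def)
    \<comment> \<open>By the Cauchy-Riemann equations both halves of the Wirtinger derivative agree
      with the derivative in the real direction.\<close>
    have zeta: "d_zeta j u p = dir_deriv (?Z j) u p" for j
    proof -
      have "axis j \<i> = \<i> *s (axis j 1 :: complex ^ 'm)" by (simp add: vec_eq_iff axis_def)
      then have "dir_deriv (0, axis j \<i>) u p = \<i> * dir_deriv (?Z j) u p" using CR_onD[OF u(1) p] by simp
      then show ?thesis by (simp add: d_zeta_def flip: mult.assoc)
    qed
    have if_mult: "(if P then y else 0) * z = (if P then y * z else 0)" for P and y z :: complex by simp
    let ?D = "\<lambda>e. dir_deriv e u p"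
    have basis: "((0, 1), 0) \<in> (Basis :: ('n, 'm) pt set)" "?X i \<in> Basis" "?Z j \<in> Basis" for i j
      by (auto simp: Basis_prod_def Basis_vec_def Basis_complex_def)
    have "vop c u p = (\<Sum>e\<in>Basis. (if e = ((0, 1), 0) then ?D e else 0)
        + ((\<Sum>i\<in>UNIV. if e = ?X i then a i p * ?D e else 0) + (\<Sum>j\<in>UNIV. if e = ?Z j then b j p * ?D e else 0)))"
      unfolding vop_def c_def distrib_right sum_distrib_right if_mult mult_1_left ..
    also have "\<dots> = ?D ((0, 1), 0) + ((\<Sum>i\<in>UNIV. \<Sum>e\<in>Basis. if e = ?X i then a i p * ?D e else 0)
        + (\<Sum>j\<in>UNIV. \<Sum>e\<in>Basis. if e = ?Z j then b j p * ?D e else 0))"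
      using basis(1) unfolding sum.distrib sum.swap[of _ UNIV Basis] by simp
    also have "\<dots> = ?D ((0, 1), 0) + ((\<Sum>i\<in>UNIV. a i p * ?D (?X i)) + (\<Sum>j\<in>UNIV. b j p * ?D (?Z j)))"
      using basis(2,3) by simp
    finally show ?thesis by (simp add: vfield_def d_t_def d_x_def zeta add.assoc)
  qed
  have est: "norm (vfield a b u ((x, t), \<zeta>)) \<le> A' * assoc_h M (Q * \<bar>t\<bar>)"
    if "x \<in> U" "t \<in> {-d<..<d}" "\<zeta> \<in> V" for x t \<zeta>
    using AQ(3)[of "((x, t), \<zeta>)"] vop_eq[of "((x, t), \<zeta>)"] that by (simp add: S_def)
  have init: "u ((x, 0), \<zeta>) = f (x, \<zeta>)" if "x \<in> U" "\<zeta> \<in> V" for x \<zeta>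
    using u(2)[OF that] by (simp add: F_def)
  have smooth: "Cinf_on ((U \<times> UNIV) \<times> V) u" using CR_on_Cinf[OF u(1)] by (simp add: S_def)
  have "approx_solution M I a b U V f u"
    unfolding approx_solution_def
  proof (intro conjI allI impI ballI)
    show "Ck_on 1 ((U \<times> UNIV) \<times> V) u" using smooth unfolding Cinf_on_def by blast
  next
    fix K assume K: "compact K \<and> K \<subseteq> U \<times> V"
    \<comment> \<open>The definition asks for a closed time interval, while the estimate holds on an
      open one.\<close>
    have "{- (d / 2)..d / 2} \<subseteq> I" using d by (auto intro: subsetD[OF d(2)])
    moreover have "norm (vfield a b u ((x, t), \<zeta>)) \<le> A' * assoc_h M (Q * \<bar>t\<bar>)"
      if "\<bar>t\<bar> \<le> d / 2" "(x, \<zeta>) \<in> K" for t x \<zeta>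
    proof (rule est)
      show "x \<in> U" "\<zeta> \<in> V" using that(2) K by auto
      show "t \<in> {-d<..<d}" using that(1) d(1) unfolding greaterThanLessThan_iff by linarith
    qed
    ultimately show "\<exists>A>0. \<exists>\<gamma>>0. \<exists>\<delta>>0. {-\<delta>..\<delta>} \<subseteq> I \<and>
           (\<forall>t. 0 < \<bar>t\<bar> \<and> \<bar>t\<bar> \<le> \<delta> \<longrightarrow>
              (\<forall>(x, \<zeta>)\<in>K. norm (vfield a b u ((x, t), \<zeta>)) \<le> A * assoc_h M (\<gamma> * \<bar>t\<bar>)))"
      using AQ(1,2) d(1) by (intro exI[of _ A'] exI[of _ Q] exI[of _ "d / 2"] conjI) auto
  qed (use init in auto)
  moreover have "holo_snd_on (U \<times> UNIV) V u"
    using CR_on_imp_holo_snd_on u(1) unfolding S_def by blast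
  moreover have "{-d<..<d} \<subseteq> I" using d(2) by auto
  ultimately show ?thesis
    using smooth init est AQ(1,2) d(1) by (intro exI[of _ u] conjI exI[of _ A'] exI[of _ Q] exI[of _ d]) auto
qed

end
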